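(* Let $n\ge1$. For all $k\in\{0,1,\dots,n\}$, all $f:\{-1,1\}^n\to\mathbb R$ and all $q\in[1,2)$, $$\big\||\nabla^kf|\big\|_{L^2}^{2}\ \ge\ W^{\ge k}(f)\left[1+\frac{q}{2k(2-q)}\ln^+\left(\frac{W^{\ge k}(f)}{\sum_{J\subseteq[n]:|J|=k}\|D_Jf\|_{L^q}^2}\right)\right]^k,$$ and further, if $\|f\|_{L^\infty}\le1$ and $q\le p<2$, $$\big\||\nabla^kf|\big\|_{L^p}^{p}\ \ge\ C(p,q)^k\,W^{\ge k}(f)\left[1+\frac{q}{2k(2-q)}\ln^+\left(\frac{1}{\sum_{J\subseteq[n]:|J|=k}\|D_Jf\|_{L^q}^2}\right)\right]^{\frac{kp}{2}},$$ where $$C(p,q)=\Big(\frac{2}{2-q}M(p)^{-\frac2p}+\frac{pq}{2e(2-p)(2-q)}\Big)^{-\frac p2},\qquad M(p):=p\,2^{-\frac p2}\max_{x\ge0}\frac{1-e^{-x}}{x^{p/2}}.$$ Moreover there is an absolute constant $c>0$ with $C(p,q)\ge c\,(2-p)(2-q)$ for all $1\le q\le p<2$.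
   Context: The cube $\{-1,1\}^n$ carries the uniform probability measure; $L^p$ norms and the $L^2$ inner product are with respect to it. For $f:\{-1,1\}^n\to\mathbb R$ and $i\in[n]=\{1,\dots,n\}$, $D_i f(x)=\frac{1}{2}\big(f(x^{(i\mapsto 1)})-f(x^{(i\mapsto -1)})\big)$, where $x^{(i\mapsto\pm1)}$ is $x$ with its $i$-th coordinate replaced by $\pm1$. For $J\subseteq[n]$, $D_J:=\prod_{i\in J}D_i$, with $D_\varnothing$ the identity. For $0\le k\le n$, $\nabla^k f:=(D_Jf)_{|J|=k}$ and $|\nabla^k f|^2:=\sum_{|J|=k}|D_Jf|^2$ (pointwise). $f^{\ge k}$ is the component of $f$ orthogonal in $L^2$ to the null space of $\nabla^k$, and $W^{\ge k}(f):=\|f^{\ge k}\|_{L^2}^2$; equivalently $W^{\ge k}(f)=\sum_{|S|\ge k}\widehat f(S)^2$ with $\widehat f(S)=\mathbb E[f\chi_S]$, $\chi_S(x)=\prod_{i\in S}x_i$. $\ln^+(x)=\max\{\ln x,0\}$. Conventions: the right-hand sides are $0$ if $W^{\ge k}(f)=0$; for $k=0$ a bracket raised to the power $0$ equals $1$. *)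

theory Defs
  imports "HOL-Probability.Probability"
begin

text \<open>
  A point of the discrete cube is an extensional function on \<open>{1..n}\<close> with values in \<open>{-1,1}\<close>.
  Real functions on the cube are represented by functions on all of \<open>nat \<Rightarrow> real\<close>; the notions
  below depend only on their values on the cube.
\<close>

definition cube :: "nat \<Rightarrow> (nat \<Rightarrow> real) set" where
  "cube n = ({1..n} \<rightarrow>\<^sub>E {-1, 1})"

definition cube_expectation :: "nat \<Rightarrow> ((nat \<Rightarrow> real) \<Rightarrow> real) \<Rightarrow> real" where
  "cube_expectation n f = measure_pmf.expectation (pmf_of_set (cube n)) f"

definition Lp_norm :: "nat \<Rightarrow> real \<Rightarrow> ((nat \<Rightarrow> real) \<Rightarrow> real) \<Rightarrow> real" where
  "Lp_norm n p f = (cube_expectation n (\<lambda>x. \<bar>f x\<bar> powr p)) powr (1 / p)"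

definition Linf_norm :: "nat \<Rightarrow> ((nat \<Rightarrow> real) \<Rightarrow> real) \<Rightarrow> real" where
  "Linf_norm n f = Max ((\<lambda>x. \<bar>f x\<bar>) ` cube n)"

definition L2_inner :: "nat \<Rightarrow> ((nat \<Rightarrow> real) \<Rightarrow> real) \<Rightarrow> ((nat \<Rightarrow> real) \<Rightarrow> real) \<Rightarrow> real" where
  "L2_inner n f g = cube_expectation n (\<lambda>x. f x * g x)"

definition D :: "nat \<Rightarrow> ((nat \<Rightarrow> real) \<Rightarrow> real) \<Rightarrow> (nat \<Rightarrow> real) \<Rightarrow> real" where
  "D i f x = (f (x(i := 1)) - f (x(i := -1))) / 2"

text \<open>
  The composition of the operators \<open>D i\<close>, \<open>i \<in> J\<close>; its independence of the order of composition,
  which makes the fold meaningful, is lemma \<open>comp_fun_commute_D\<close>.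
\<close>

definition D_set :: "nat set \<Rightarrow> ((nat \<Rightarrow> real) \<Rightarrow> real) \<Rightarrow> (nat \<Rightarrow> real) \<Rightarrow> real" where
  "D_set J f = Finite_Set.fold D f J"

definition level :: "nat \<Rightarrow> nat \<Rightarrow> nat set set" where
  "level n k = {J. J \<subseteq> {1..n} \<and> card J = k}"

definition nabla_abs :: "nat \<Rightarrow> nat \<Rightarrow> ((nat \<Rightarrow> real) \<Rightarrow> real) \<Rightarrow> (nat \<Rightarrow> real) \<Rightarrow> real" where
  "nabla_abs n k f x = sqrt (\<Sum>J\<in>level n k. (D_set J f x)\<^sup>2)"

definition nabla_null :: "nat \<Rightarrow> nat \<Rightarrow> ((nat \<Rightarrow> real) \<Rightarrow> real) set" where
  "nabla_null n k = {g. \<forall>J\<in>level n k. \<forall>x\<in>cube n. D_set J g x = 0}"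

text \<open>
  The component of \<open>f\<close> orthogonal to the null space. Extensionality pins down the values off the
  cube; existence and uniqueness are shown in lemma \<open>orth_part_eq\<close>.
\<close>

definition orth_part :: "nat \<Rightarrow> nat \<Rightarrow> ((nat \<Rightarrow> real) \<Rightarrow> real) \<Rightarrow> (nat \<Rightarrow> real) \<Rightarrow> real" where
  "orth_part n k f = (THE h. h \<in> extensional (cube n) \<and>
     (\<forall>g\<in>nabla_null n k. L2_inner n h g = 0) \<and> (\<lambda>x. f x - h x) \<in> nabla_null n k)"

definition W_ge :: "nat \<Rightarrow> nat \<Rightarrow> ((nat \<Rightarrow> real) \<Rightarrow> real) \<Rightarrow> real" where
  "W_ge n k f = (Lp_norm n 2 (orth_part n k f))\<^sup>2"

text \<open>
  Degenerate arguments are harmless: if the sum of the squared norms of the \<open>D_set J f\<close> over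
  \<open>level n k\<close> vanishes, then so does \<open>W_ge n k f\<close>. For \<open>k = 0\<close> the division by \<open>k\<close> yields \<open>0\<close>,
  so that a bracket \<open>1 + q / (2 * k * (2 - q)) * ln_plus y\<close> is \<open>1\<close>, as is its power with exponent \<open>0\<close>.
\<close>

definition ln_plus :: "real \<Rightarrow> real" where
  "ln_plus x = max (ln x) 0"

text \<open>
  The supremum is a maximum when \<open>1 \<le> p < 2\<close>. At \<open>x = 0\<close> the quotient is \<open>0\<close> because division by zero
  yields \<open>0\<close>; for these \<open>p\<close> this is its continuous extension.
\<close>

definition M_const :: "real \<Rightarrow> real" where
  "M_const p = p * 2 powr (- p / 2) * (SUP x\<in>{0..}. (1 - exp (- x)) / x powr (p / 2))"

definition C_const :: "real \<Rightarrow> real \<Rightarrow> real" where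
  "C_const p q = (2 / (2 - q) * M_const p powr (- 2 / p)
     + p * q / (2 * exp 1 * (2 - p) * (2 - q))) powr (- p / 2)"


subsection \<open>Well-definedness, and the Fourier description of \<open>W_ge\<close>\<close>

lemma comp_fun_commute_D: "comp_fun_commute D"
proof
  fix i j
  show "D j \<circ> D i = D i \<circ> D j"
    by (cases "i = j") (auto simp: fun_eq_iff D_def fun_upd_twist field_simps)
qed

lemma D_set_empty [simp]: "D_set {} f = f"
  by (simp add: D_set_def)

lemma D_set_insert: "finite J \<Longrightarrow> i \<notin> J \<Longrightarrow> D_set (insert i J) f = D i (D_set J f)"
  unfolding D_set_def
  by (rule comp_fun_commute_on.fold_insert[OF comp_fun_commute_D[unfolded comp_fun_commute_def']]) auto

lemma finite_cube [simp]: "finite (cube n)"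
  and cube_nonempty [simp]: "cube n \<noteq> {}"
  and card_cube: "card (cube n) = 2 ^ n"
  by (auto simp: cube_def PiE_eq_empty_iff card_PiE numeral_2_eq_2 intro!: finite_PiE)

lemma cube_expectation_eq: "cube_expectation n f = (\<Sum>x\<in>cube n. f x) / 2 ^ n"
  by (simp add: cube_expectation_def integral_pmf_of_set card_cube)

lemma cube_upd: "x \<in> cube n \<Longrightarrow> i \<in> {1..n} \<Longrightarrow> a \<in> {-1, 1} \<Longrightarrow> x(i := a) \<in> cube n"
  by (auto simp: cube_def PiE_iff extensional_def)

lemma D_set_cong:
  assumes "J \<subseteq> {1..n}" "\<And>x. x \<in> cube n \<Longrightarrow> f x = g x" "x \<in> cube n"
  shows "D_set J f x = D_set J g x"
proof -
  have "finite J"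
    using assms(1) finite_subset by blast
  then have "\<forall>x\<in>cube n. D_set J f x = D_set J g x"
    using assms(1)
    by (induction J) (use assms(2) in \<open>auto simp: D_set_insert D_def cube_upd\<close>)
  with assms(3) show ?thesis by blast
qed

definition character :: "nat set \<Rightarrow> (nat \<Rightarrow> real) \<Rightarrow> real" where
  "character S x = (\<Prod>i\<in>S. x i)"

definition fourier_coeff :: "nat \<Rightarrow> ((nat \<Rightarrow> real) \<Rightarrow> real) \<Rightarrow> nat set \<Rightarrow> real" where
  "fourier_coeff n f S = cube_expectation n (\<lambda>x. f x * character S x)"

lemma D_linear: "D i (\<lambda>x. \<Sum>S\<in>A. c S * g S x) = (\<lambda>x. \<Sum>S\<in>A. c S * D i (g S) x)"
  by (simp add: fun_eq_iff D_def sum_subtractf[symmetric] sum_divide_distrib algebra_simps)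

lemma D_set_linear:
  "finite J \<Longrightarrow> D_set J (\<lambda>x. \<Sum>S\<in>A. c S * g S x) = (\<lambda>x. \<Sum>S\<in>A. c S * D_set J (g S) x)"
  by (induction J rule: finite_induct) (simp_all add: D_set_insert D_linear)

lemma D_character:
  assumes "finite S"
  shows "D i (character S) = (\<lambda>x. if i \<in> S then character (S - {i}) x else 0)"
proof
  fix x
  show "D i (character S) x = (if i \<in> S then character (S - {i}) x else 0)"
  proof (cases "i \<in> S")
    case True
    have "character S (x(i := a)) = a * character (S - {i}) x" for a
    proof -
      have "character S (x(i := a)) = a * (\<Prod>j\<in>S - {i}. (x(i := a)) j)"
        using assms True by (simp add: character_def prod.remove)
      also have "(\<Prod>j\<in>S - {i}. (x(i := a)) j) = character (S - {i}) x"
        unfolding character_def by (intro prod.cong) auto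
      finally show ?thesis .
    qed
    with True show ?thesis by (simp add: D_def)
  next
    case False
    then have "character S (x(i := a)) = character S x" for a
      unfolding character_def by (intro prod.cong) auto
    with False show ?thesis by (simp add: D_def)
  qed
qed

lemma D_set_character:
  assumes "finite S" "finite J"
  shows "D_set J (character S) = (\<lambda>x. if J \<subseteq> S then character (S - J) x else 0)"
  using assms(2)
proof (induction J rule: finite_induct)
  case (insert i J)
  show ?case
  proof (cases "J \<subseteq> S")
    case True
    then have "D_set J (character S) = character (S - J)"
      using insert by simp
    then show ?thesis
      using insert True assms(1) by (auto simp: D_set_insert D_character Diff_insert2[symmetric] Diff_insert[symmetric])
  next
    case False
    then have "D_set J (character S) = (\<lambda>x. 0)"
      using insert by simp
    then show ?thesis
      using insert False by (auto simp: D_set_insert D_def)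
  qed
qed simp

lemma expectation_character_mult:
  assumes "S \<subseteq> {1..n}" "T \<subseteq> {1..n}"
  shows "cube_expectation n (\<lambda>x. character S x * character T x) = (if S = T then 1 else 0)"
proof -
  define w where "w = (\<lambda>i (y::real). (if i \<in> S then y else 1) * (if i \<in> T then y else 1))"
  have split: "character A x = (\<Prod>i\<in>{1..n}. if i \<in> A then x i else 1)"
    if "A \<subseteq> {1..n}" for A x
    using that by (simp add: character_def prod.If_cases Int_absorb1)
  have "(\<Sum>x\<in>cube n. character S x * character T x) = (\<Sum>x\<in>cube n. \<Prod>i\<in>{1..n}. w i (x i))"
    by (simp add: split[OF assms(1)] split[OF assms(2)] w_def prod.distrib del: One_nat_def)
  also have "\<dots> = (\<Prod>i\<in>{1..n}. \<Sum>y\<in>{-1, 1}. w i y)"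
    unfolding cube_def by (rule prod_sum_PiE[symmetric]) auto
  also have "\<dots> = (if S = T then 2 ^ n else 0)"
  proof (cases "S = T")
    case True
    then have "(\<Sum>y\<in>{-1, 1}. w i y) = 2" for i
      by (simp add: w_def)
    with True show ?thesis by simp
  next
    case False
    then obtain i where i: "i \<in> {1..n}" "i \<in> S \<longleftrightarrow> i \<notin> T"
      using assms by blast
    then have "(\<Sum>y\<in>{-1, 1}. w i y) = 0"
      by (auto simp: w_def)
    with i False show ?thesis
      by (auto intro!: prod_zero)
  qed
  finally show ?thesis by (simp add: cube_expectation_eq)
qed

lemma sum_character_mult:
  assumes "x \<in> cube n" "y \<in> cube n"
  shows "(\<Sum>S\<in>Pow {1..n}. character S x * character S y) = (if x = y then 2 ^ n else 0)"
proof -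
  have vals: "x i \<in> {-1, 1}" "y i \<in> {-1, 1}" if "i \<in> {1..n}" for i
    using assms that by (auto simp: cube_def PiE_iff)
  have "(\<Sum>S\<in>Pow {1..n}. character S x * character S y) = (\<Prod>i\<in>{1..n}. x i * y i + 1)"
    by (simp add: prod_add character_def prod.distrib)
  also have "\<dots> = (if x = y then 2 ^ n else 0)"
  proof (cases "x = y")
    case True
    have "(\<Prod>i\<in>{1..n}. x i * x i + 1) = (\<Prod>i\<in>{1..n}. 2)"
      by (intro prod.cong) (use vals in force)+
    with True show ?thesis by simp
  next
    case False
    then obtain i where i: "i \<in> {1..n}" "x i \<noteq> y i"
      using assms unfolding cube_def by (meson PiE_ext)
    then have "x i * y i + 1 = 0"
      using vals[of i] by auto
    with i False show ?thesis
      by (auto intro!: prod_zero bexI[of _ i])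
  qed
  finally show ?thesis .
qed

lemma fourier_expansion:
  assumes "x \<in> cube n"
  shows "f x = (\<Sum>S\<in>Pow {1..n}. fourier_coeff n f S * character S x)"
proof -
  have "(\<Sum>S\<in>Pow {1..n}. fourier_coeff n f S * character S x)
      = (\<Sum>S\<in>Pow {1..n}. \<Sum>y\<in>cube n. f y * (character S y * character S x) / 2 ^ n)"
    unfolding fourier_coeff_def cube_expectation_eq sum_divide_distrib sum_distrib_right
    by (intro sum.cong refl) (simp add: mult_ac)
  also have "\<dots> = (\<Sum>y\<in>cube n. \<Sum>S\<in>Pow {1..n}. f y * (character S y * character S x) / 2 ^ n)"
    by (rule sum.swap)
  also have "\<dots> = (\<Sum>y\<in>cube n. f y * (\<Sum>S\<in>Pow {1..n}. character S y * character S x) / 2 ^ n)"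
    by (simp add: sum_divide_distrib sum_distrib_left)
  also have "\<dots> = (\<Sum>y\<in>cube n. if y = x then f y else 0)"
    by (intro sum.cong) (simp_all add: sum_character_mult assms del: One_nat_def)
  also have "\<dots> = f x"
    using assms by simp
  finally show ?thesis by simp
qed

lemma fourier_coeff_cong:
  "(\<And>x. x \<in> cube n \<Longrightarrow> f x = g x) \<Longrightarrow> fourier_coeff n f S = fourier_coeff n g S"
  by (simp add: fourier_coeff_def cube_expectation_eq)

lemma L2_inner_sum_left:
  "L2_inner n (\<lambda>x. \<Sum>S\<in>A. c S * character S x) g = (\<Sum>S\<in>A. c S * fourier_coeff n g S)"
proof -
  have "L2_inner n (\<lambda>x. \<Sum>S\<in>A. c S * character S x) g
      = (\<Sum>x\<in>cube n. \<Sum>S\<in>A. c S * (g x * character S x) / 2 ^ n)"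
    unfolding L2_inner_def cube_expectation_eq sum_distrib_right sum_divide_distrib
    by (intro sum.cong refl) (simp add: mult_ac)
  also have "\<dots> = (\<Sum>S\<in>A. \<Sum>x\<in>cube n. c S * (g x * character S x) / 2 ^ n)"
    by (rule sum.swap)
  also have "\<dots> = (\<Sum>S\<in>A. c S * fourier_coeff n g S)"
    by (simp add: fourier_coeff_def cube_expectation_eq sum_divide_distrib sum_distrib_left)
  finally show ?thesis .
qed

lemma fourier_coeff_sum:
  assumes "A \<subseteq> Pow {1..n}" "S \<subseteq> {1..n}"
  shows "fourier_coeff n (\<lambda>x. \<Sum>T\<in>A. c T * character T x) S = (if S \<in> A then c S else 0)"
proof -
  have fin: "finite A" using assms(1) finite_subset by blast
  have "fourier_coeff n (\<lambda>x. \<Sum>T\<in>A. c T * character T x) S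
      = (\<Sum>T\<in>A. c T * fourier_coeff n (character S) T)"
    by (simp add: fourier_coeff_def L2_inner_def L2_inner_sum_left[unfolded L2_inner_def])
  also have "\<dots> = (\<Sum>T\<in>A. if T = S then c T else 0)"
    using assms by (intro sum.cong refl) (subst fourier_coeff_def, subst expectation_character_mult, auto)
  also have "\<dots> = (if S \<in> A then c S else 0)"
    using fin by simp
  finally show ?thesis .
qed

lemma D_set_expansion:
  assumes "J \<subseteq> {1..n}" "x \<in> cube n"
  shows "D_set J f x
    = (\<Sum>S\<in>Pow {1..n}. fourier_coeff n f S * (if J \<subseteq> S then character (S - J) x else 0))"
proof -
  have fin: "finite J" using assms(1) finite_subset by blast
  have "D_set J f x = D_set J (\<lambda>x. \<Sum>S\<in>Pow {1..n}. fourier_coeff n f S * character S x) x"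
    using assms by (intro D_set_cong[of J n]) (auto simp del: One_nat_def intro: fourier_expansion)
  also have "\<dots> = (\<Sum>S\<in>Pow {1..n}. fourier_coeff n f S * D_set J (character S) x)"
    by (simp add: D_set_linear fin)
  also have "\<dots> = (\<Sum>S\<in>Pow {1..n}. fourier_coeff n f S * (if J \<subseteq> S then character (S - J) x else 0))"
    using fin by (intro sum.cong refl) (auto simp: D_set_character finite_subset)
  finally show ?thesis .
qed

lemma nabla_null_iff:
  "g \<in> nabla_null n k \<longleftrightarrow> (\<forall>S\<subseteq>{1..n}. k \<le> card S \<longrightarrow> fourier_coeff n g S = 0)"
proof
  assume g: "g \<in> nabla_null n k"
  show "\<forall>S\<subseteq>{1..n}. k \<le> card S \<longrightarrow> fourier_coeff n g S = 0"
  proof (intro allI impI)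
    fix S assume S: "S \<subseteq> {1..n}" "k \<le> card S"
    then obtain J where J: "J \<subseteq> S" "card J = k"
      using obtain_subset_with_card_n by blast
    define A where "A = (\<lambda>T. T - J) ` {T. J \<subseteq> T \<and> T \<subseteq> {1..n}}"
    have A: "A \<subseteq> Pow {1..n}" "S - J \<in> A"
      using S J by (auto simp: A_def)
    have inj: "inj_on (\<lambda>T. T - J) {T. J \<subseteq> T \<and> T \<subseteq> {1..n}}"
      by (auto simp: inj_on_def)
    have "D_set J g x = (\<Sum>T\<in>A. fourier_coeff n g (T \<union> J) * character T x)" if "x \<in> cube n" for x
    proof -
      have "D_set J g x
          = (\<Sum>T\<in>Pow {1..n}. fourier_coeff n g T * (if J \<subseteq> T then character (T - J) x else 0))"
        using that S J by (intro D_set_expansion) auto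
      also have "\<dots> = (\<Sum>T\<in>{T. J \<subseteq> T \<and> T \<subseteq> {1..n}}. fourier_coeff n g T * character (T - J) x)"
        by (rule sum.mono_neutral_cong_right) auto
      also have "\<dots> = (\<Sum>T\<in>A. fourier_coeff n g (T \<union> J) * character T x)"
        unfolding A_def using inj
        by (subst sum.reindex) (auto simp: Un_absorb1 Un_absorb2 intro!: sum.cong)
      finally show ?thesis .
    qed
    then have "fourier_coeff n (D_set J g) (S - J) = fourier_coeff n g ((S - J) \<union> J)"
      using A fourier_coeff_sum[of A n "S - J" "\<lambda>T. fourier_coeff n g (T \<union> J)"]
        fourier_coeff_cong[of n "D_set J g"] S by auto
    moreover have "fourier_coeff n (D_set J g) (S - J) = 0"
      using g S J by (simp add: nabla_null_def level_def fourier_coeff_def cube_expectation_eq)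
    ultimately show "fourier_coeff n g S = 0"
      using J by (simp add: Un_absorb2)
  qed
next
  assume g: "\<forall>S\<subseteq>{1..n}. k \<le> card S \<longrightarrow> fourier_coeff n g S = 0"
  have "D_set J g x = 0" if "J \<in> level n k" "x \<in> cube n" for J x
  proof -
    have "k \<le> card S" if "J \<subseteq> S" "S \<subseteq> {1..n}" for S
      using card_mono[of S J] that \<open>J \<in> level n k\<close> finite_subset[of S "{1..n}"]
      by (auto simp: level_def)
    then show ?thesis
      using that g by (subst D_set_expansion[of J n]) (auto simp: level_def intro!: sum.neutral)
  qed
  then show "g \<in> nabla_null n k"
    by (simp add: nabla_null_def)
qed

lemma orth_part_eq:
  "orth_part n k f = restrict
     (\<lambda>x. \<Sum>S | S \<subseteq> {1..n} \<and> k \<le> card S. fourier_coeff n f S * character S x) (cube n)"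
    (is "_ = restrict ?h _")
  unfolding orth_part_def
proof (rule the_equality)
  let ?A = "{S. S \<subseteq> {1..n} \<and> k \<le> card S}"
  let ?H = "restrict ?h (cube n)"
  have orth: "\<forall>g\<in>nabla_null n k. L2_inner n ?H g = 0"
  proof
    fix g assume "g \<in> nabla_null n k"
    then have g: "\<forall>S\<in>?A. fourier_coeff n g S = 0"
      by (simp add: nabla_null_iff)
    have "L2_inner n ?H g = L2_inner n ?h g"
      by (simp add: L2_inner_def cube_expectation_eq)
    also have "\<dots> = 0"
      using g by (simp add: L2_inner_sum_left)
    finally show "L2_inner n ?H g = 0" .
  qed
  have "fourier_coeff n ?H S = fourier_coeff n f S" if "S \<in> ?A" for S
  proof -
    have "fourier_coeff n ?H S = fourier_coeff n ?h S"
      by (rule fourier_coeff_cong) simp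
    also have "\<dots> = fourier_coeff n f S"
      using that by (subst fourier_coeff_sum) auto
    finally show ?thesis .
  qed
  moreover have "fourier_coeff n (\<lambda>x. f x - ?H x) S = fourier_coeff n f S - fourier_coeff n ?H S" for S
    by (simp add: fourier_coeff_def cube_expectation_eq left_diff_distrib sum_subtractf
        diff_divide_distrib del: restrict_apply)
  ultimately have null: "(\<lambda>x. f x - ?H x) \<in> nabla_null n k"
    by (simp add: nabla_null_iff del: restrict_apply)
  show "?H \<in> extensional (cube n) \<and> (\<forall>g\<in>nabla_null n k. L2_inner n ?H g = 0) \<and>
      (\<lambda>x. f x - ?H x) \<in> nabla_null n k"
    using orth null by (simp del: restrict_apply)
  fix h
  assume h: "h \<in> extensional (cube n) \<and> (\<forall>g\<in>nabla_null n k. L2_inner n h g = 0) \<and>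
      (\<lambda>x. f x - h x) \<in> nabla_null n k"
  define d where "d = (\<lambda>x. h x - ?H x)"
  have "fourier_coeff n d S = fourier_coeff n (\<lambda>x. f x - ?H x) S - fourier_coeff n (\<lambda>x. f x - h x) S" for S
    by (simp add: d_def fourier_coeff_def cube_expectation_eq left_diff_distrib sum_subtractf
        diff_divide_distrib del: restrict_apply)
  with h null have d: "d \<in> nabla_null n k"
    by (simp add: nabla_null_iff del: restrict_apply)
  have "L2_inner n d d = L2_inner n h d - L2_inner n ?H d"
    unfolding d_def
    by (simp add: L2_inner_def cube_expectation_eq left_diff_distrib sum_subtractf
        diff_divide_distrib del: restrict_apply)
  also have "\<dots> = 0"
    using h orth d by simp
  finally have "(\<Sum>x\<in>cube n. d x * d x) = 0"
    by (simp add: L2_inner_def cube_expectation_eq)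
  then have "d x = 0" if "x \<in> cube n" for x
    using that by (subst (asm) sum_nonneg_eq_0_iff) auto
  then show "h = ?H"
    using h by (intro extensionalityI[of _ "cube n"]) (auto simp: d_def)
qed

lemma W_ge_fourier:
  "W_ge n k f = (\<Sum>S | S \<subseteq> {1..n} \<and> k \<le> card S. (fourier_coeff n f S)\<^sup>2)"
proof -
  let ?A = "{S. S \<subseteq> {1..n} \<and> k \<le> card S}"
  let ?h = "\<lambda>x. \<Sum>S\<in>?A. fourier_coeff n f S * character S x"
  have "(\<Sum>x\<in>cube n. \<bar>orth_part n k f x\<bar> powr 2) = (\<Sum>x\<in>cube n. ?h x * ?h x)"
    by (intro sum.cong) (simp_all add: orth_part_eq power2_eq_square abs_mult_self_eq)
  then have "cube_expectation n (\<lambda>x. \<bar>orth_part n k f x\<bar> powr 2) = L2_inner n ?h ?h"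
    by (simp add: cube_expectation_eq L2_inner_def)
  also have "\<dots> = (\<Sum>S\<in>?A. fourier_coeff n f S * fourier_coeff n ?h S)"
    by (rule L2_inner_sum_left)
  also have "\<dots> = (\<Sum>S\<in>?A. (fourier_coeff n f S)\<^sup>2)"
    by (intro sum.cong refl, subst fourier_coeff_sum) (auto simp: power2_eq_square)
  finally have eq: "cube_expectation n (\<lambda>x. \<bar>orth_part n k f x\<bar> powr 2) = (\<Sum>S\<in>?A. (fourier_coeff n f S)\<^sup>2)" .
  then show ?thesis
    by (simp add: W_ge_def Lp_norm_def powr_half_sqrt sum_nonneg)
qed

end

theory Submission
  imports Defs
begin

text \<open>
  Write \<open>a = q / (2 (2 - q))\<close>, \<open>W\<close> for the Fourier weight of \<open>f\<close> on degrees at least \<open>k\<close>, and \<open>B\<close>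
  for the sum of the squared \<open>L\<^sup>q\<close> norms of the derivatives \<open>D_set J f\<close> of order \<open>k\<close>.

  \<^emph>\<open>The second moment.\<close> For \<open>q < 2\<close> the logarithmic Sobolev inequality of the cube bounds the
  Dirichlet energy of a function \<open>g\<close> from below by \<open>a x ln (x / y)\<close>, where \<open>x\<close> and \<open>y\<close> are its
  squared \<open>L\<^sup>2\<close> and \<open>L\<^sup>q\<close> norms. Applied to all the functions obtained from the \<open>D_set J f\<close> by noise
  with parameter \<open>sqrt s\<close>, which does not increase \<open>y\<close>, it gives
  \<open>s \<psi>' \<ge> a \<psi> ln (\<psi> / B)\<close> for the polynomial \<open>\<psi>\<close> in \<open>s\<close> whose coefficient of degree \<open>d - k\<close> is
  \<open>d choose k\<close> times the weight of \<open>f\<close> on degree \<open>d\<close>. Averaging with the densities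
  \<open>j (1 - s)\<^bsup>j-1\<^esup>\<close>, and using convexity of \<open>x ln x\<close>, turns this into
  \<open>j (M (j - 1) - M j) \<ge> a (M j) ln (M j / B)\<close>, where \<open>M j\<close> is the average of \<open>\<psi>\<close>
  (\<open>avg_energy_log_sobolev\<close>). Since \<open>1 / (d choose k)\<close> is exactly the Beta moment belonging to \<open>j = k\<close>,
  the chain \<open>M 0, \<dots>, M k\<close> starts at the second moment of the gradient and ends at \<open>W\<close>; each of its
  \<open>k\<close> steps contributes a factor at least \<open>1 + a / k * ln (W / B)\<close> when \<open>W \<ge> B\<close>.

  \<^emph>\<open>Bounded functions.\<close> Two bounds on the high-degree weight surviving after noise for time \<open>t / k\<close>
  are played off against each other. The step \<open>j = k\<close> above is a differential inequality along the
  noise semigroup, and integrating it (\<open>spectral_decay\<close>) shows that much of the weight is lost when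
  \<open>W / B\<close> is large. Conversely, for \<open>\<bar>f\<bar> \<le> 1\<close>, Bessel's inequality in the biased product measure that
  defines the noise at a point bounds the gradient of the damped function uniformly
  (\<open>local_bessel\<close>). Interpolating this with the contraction of the noise bounds the weighted sum
  with coefficients \<open>(d choose k) * exp (- u d)\<close> by a multiple of \<open>K\<close>, the \<open>p\<close>-th moment of the gradient
  (\<open>damped_weight_le\<close>), and integrating in \<open>u\<close> limits the loss (\<open>high_degree_mass_le\<close>). Together they
  bound \<open>K\<close> from below (\<open>gradient_moment_lower_bound\<close>), with the constant \<open>M_const p\<close> appearing from
  the optimal choice of \<open>t\<close>.

  This yields the bracket with \<open>ln (W / B)\<close> in place of \<open>ln (1 / B)\<close>. The missing \<open>ln (1 / W)\<close> is
  recovered by applying the same bound a second time, with \<open>q = p\<close> and \<open>B\<close> replaced by the squared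
  \<open>L\<^sup>p\<close> norm of the whole gradient, which is \<open>K\<close> to the power \<open>2 / p\<close>: this expresses \<open>ln (1 / W)\<close>
  through \<open>ln (K / W)\<close> and a logarithm that is again under control. Both uses are added up in
  \<open>trade_off_of_logarithms\<close>, and the elementary bound \<open>ln X \<le> X / e\<close> accounts for the second summand
  of \<open>C_const\<close>.
\<close>

section \<open>The logarithmic Sobolev inequality on the cube\<close>

definition xlogx :: "real \<Rightarrow> real" where
  "xlogx x = x * ln x"

lemma xlogx_0 [simp]: "xlogx 0 = 0" by (simp add: xlogx_def)

lemma ln_two_over_one_plus_square_le:
  fixes r :: real
  assumes "0 \<le> r" "r \<le> 1"
  shows "ln (2 / (1 + r\<^sup>2)) \<le> 1 - r"
proof -
  have "ln ((1 + 1\<^sup>2) / 2) + 1 - 1 \<le> ln ((1 + r\<^sup>2) / 2) + 1 - r"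
  proof (rule DERIV_nonpos_imp_nonincreasing[OF assms(2)])
    fix x :: real
    have pos: "1 + x\<^sup>2 > 0" by (simp add: add_pos_nonneg)
    have "((\<lambda>r. ln ((1 + r\<^sup>2) / 2) + 1 - r) has_real_derivative 2 * x / (1 + x\<^sup>2) - 1) (at x)"
      using pos by (auto intro!: derivative_eq_intros simp: field_simps)
    moreover have "2 * x / (1 + x\<^sup>2) - 1 \<le> 0"
      using sum_squares_bound[of x 1] pos by (simp add: field_simps)
    ultimately show "\<exists>y. ((\<lambda>r. ln ((1 + r\<^sup>2) / 2) + 1 - r) has_real_derivative y) (at x) \<and> y \<le> 0"
      by blast
  qed
  moreover have "ln (2 / (1 + r\<^sup>2)) = - ln ((1 + r\<^sup>2) / 2)"
    by (simp add: ln_div add_pos_nonneg)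
  ultimately show ?thesis by simp
qed

text \<open>
  Both sides agree at \<open>y = 1\<close>, and the derivative of the difference is
  \<open>y - 1 - y ln (2 y\<^sup>2 / (y\<^sup>2 + 1))\<close>, which the previous lemma, at \<open>r = 1 / y\<close>, shows to be nonnegative.
\<close>

lemma two_point_normalised:
  fixes y :: real
  assumes "1 \<le> y"
  shows "(xlogx (y\<^sup>2) + xlogx 1) / 2 - xlogx ((y\<^sup>2 + 1) / 2) \<le> (y - 1)\<^sup>2 / 2"
proof -
  let ?F = "\<lambda>y::real. (y - 1)\<^sup>2 / 2 - (xlogx (y\<^sup>2) + xlogx 1) / 2 + xlogx ((y\<^sup>2 + 1) / 2)"
  have "?F 1 \<le> ?F y"
  proof (rule DERIV_nonneg_imp_nondecreasing[OF assms])
    fix x :: real assume x: "1 \<le> x"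
    then have pos: "x\<^sup>2 + 1 > 0" "x > 0" by (auto simp: add_nonneg_pos)
    have "(?F has_real_derivative (x - 1 - x * ln (x\<^sup>2) + x * ln ((x\<^sup>2 + 1) / 2))) (at x)"
      unfolding xlogx_def using pos
      by (auto intro!: derivative_eq_intros simp: power2_eq_square) (simp add: field_simps power2_eq_square)
    moreover have "x - 1 - x * ln (x\<^sup>2) + x * ln ((x\<^sup>2 + 1) / 2) \<ge> 0"
    proof -
      have "ln (2 / (1 + (1 / x)\<^sup>2)) \<le> 1 - 1 / x"
        using x by (intro ln_two_over_one_plus_square_le) auto
      moreover have "2 / (1 + (1 / x)\<^sup>2) = x\<^sup>2 / ((x\<^sup>2 + 1) / 2)"
        using pos by (simp add: field_simps)
      ultimately have "ln (x\<^sup>2 / ((x\<^sup>2 + 1) / 2)) \<le> 1 - 1 / x" by simp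
      also have "ln (x\<^sup>2 / ((x\<^sup>2 + 1) / 2)) = ln (x\<^sup>2) - ln ((x\<^sup>2 + 1) / 2)"
        using pos by (intro ln_divide_pos) auto
      finally have "x * (ln (x\<^sup>2) - ln ((x\<^sup>2 + 1) / 2)) \<le> x * (1 - 1 / x)"
        using pos by (intro mult_left_mono) auto
      then show ?thesis using pos by (simp add: algebra_simps)
    qed
    ultimately show "\<exists>z. (?F has_real_derivative z) (at x) \<and> z \<ge> 0" by blast
  qed
  then show ?thesis by (simp add: xlogx_def)
qed

lemma xlogx_scale: "c > 0 \<Longrightarrow> x \<ge> 0 \<Longrightarrow> xlogx (c * x) = c * xlogx x + xlogx c * x"
  by (cases "x = 0") (auto simp: xlogx_def ln_mult algebra_simps)

text \<open>
  Homogeneity and symmetry reduce this to one variable, except when one of the two values vanishes.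
\<close>

lemma two_point_log_sobolev:
  fixes \<alpha> \<beta> :: real
  assumes "0 \<le> \<alpha>" "0 \<le> \<beta>"
  shows "(xlogx (\<alpha>\<^sup>2) + xlogx (\<beta>\<^sup>2)) / 2 - xlogx ((\<alpha>\<^sup>2 + \<beta>\<^sup>2) / 2) \<le> (\<alpha> - \<beta>)\<^sup>2 / 2"
proof -
  have *: "(xlogx (\<alpha>\<^sup>2) + xlogx (\<beta>\<^sup>2)) / 2 - xlogx ((\<alpha>\<^sup>2 + \<beta>\<^sup>2) / 2) \<le> (\<alpha> - \<beta>)\<^sup>2 / 2"
    if "0 \<le> \<beta>" "\<beta> \<le> \<alpha>" for \<alpha> \<beta> :: real
  proof (cases "\<beta> = 0")
    case True
    show ?thesis
    proof (cases "\<alpha> = 0")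
      case False
      have "ln (2::real) \<le> 1" using ln_le_minus_one[of "2::real"] by simp
      then have "\<alpha>\<^sup>2 * ln 2 \<le> \<alpha>\<^sup>2" by (simp add: mult_left_le)
      then show ?thesis
        using True False by (simp add: xlogx_def ln_div algebra_simps)
    qed (use True in simp)
  next
    case False
    with that have b: "\<beta> > 0" by simp
    define y where "y = \<alpha> / \<beta>"
    have y: "1 \<le> y" "\<alpha> = \<beta> * y" using b that by (auto simp: y_def)
    have e: "\<alpha>\<^sup>2 = \<beta>\<^sup>2 * y\<^sup>2" "(\<alpha>\<^sup>2 + \<beta>\<^sup>2) / 2 = \<beta>\<^sup>2 * ((y\<^sup>2 + 1) / 2)"
      by (auto simp: y algebra_simps)
    have "(xlogx (\<alpha>\<^sup>2) + xlogx (\<beta>\<^sup>2)) / 2 - xlogx ((\<alpha>\<^sup>2 + \<beta>\<^sup>2) / 2)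
       = \<beta>\<^sup>2 * ((xlogx (y\<^sup>2) + xlogx 1) / 2 - xlogx ((y\<^sup>2 + 1) / 2))"
    proof -
      have "xlogx (\<beta>\<^sup>2 * y\<^sup>2) = \<beta>\<^sup>2 * xlogx (y\<^sup>2) + xlogx (\<beta>\<^sup>2) * y\<^sup>2"
        and "xlogx (\<beta>\<^sup>2 * ((y\<^sup>2 + 1) / 2))
          = \<beta>\<^sup>2 * xlogx ((y\<^sup>2 + 1) / 2) + xlogx (\<beta>\<^sup>2) * ((y\<^sup>2 + 1) / 2)"
        using b by (intro xlogx_scale; simp)+
      then show ?thesis
        unfolding e(2) unfolding e(1) by (simp add: xlogx_def field_simps)
    qed
    also have "\<dots> \<le> \<beta>\<^sup>2 * ((y - 1)\<^sup>2 / 2)"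
      by (intro mult_left_mono two_point_normalised y) auto
    also have "\<dots> = (\<alpha> - \<beta>)\<^sup>2 / 2"
      by (simp add: y power2_eq_square algebra_simps)
    finally show ?thesis .
  qed
  show ?thesis
  proof (cases "\<beta> \<le> \<alpha>")
    case False
    then show ?thesis using *[of \<alpha> \<beta>] *[of \<beta> \<alpha>] assms
      by (simp add: add.commute power2_commute)
  qed (use * assms in auto)
qed

lemma sum_cube_Suc:
  "(\<Sum>x\<in>cube (Suc n). F x) = (\<Sum>x\<in>cube n. F (x(Suc n := 1))) + (\<Sum>x\<in>cube n. F (x(Suc n := - 1)))"
proof -
  have ins: "{1..Suc n} = insert (Suc n) {1..n}" by auto
  have "cube (Suc n) = (\<lambda>(b, x). x(Suc n := b)) ` ({-1, 1} \<times> cube n)"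
    unfolding cube_def ins by (subst PiE_insert_eq) simp
  moreover have "inj_on (\<lambda>(b, x). x(Suc n := b)) ({-1, 1} \<times> cube n)"
    unfolding cube_def by (rule inj_combinator) simp
  ultimately have "(\<Sum>x\<in>cube (Suc n). F x) = (\<Sum>(b, x)\<in>{-1, 1} \<times> cube n. F (x(Suc n := b)))"
    by (simp add: sum.reindex case_prod_unfold)
  also have "\<dots> = (\<Sum>b\<in>{-1, 1}. \<Sum>x\<in>cube n. F (x(Suc n := b)))"
    by (rule sum.cartesian_product[symmetric])
  finally show ?thesis by (simp add: add.commute)
qed

lemma cube_expectation_Suc:
  "cube_expectation (Suc n) F =
    (cube_expectation n (\<lambda>x. F (x(Suc n := 1))) + cube_expectation n (\<lambda>x. F (x(Suc n := - 1)))) / 2"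
  by (simp add: cube_expectation_eq sum_cube_Suc add_divide_distrib)

lemma cube_expectation_nonneg:
  "(\<And>x. x \<in> cube n \<Longrightarrow> 0 \<le> F x) \<Longrightarrow> 0 \<le> cube_expectation n F"
  by (simp add: cube_expectation_eq sum_nonneg)

lemma cube_expectation_mono:
  "(\<And>x. x \<in> cube n \<Longrightarrow> F x \<le> G x) \<Longrightarrow> cube_expectation n F \<le> cube_expectation n G"
  by (simp add: cube_expectation_eq divide_right_mono sum_mono)

lemma cube_expectation_add:
  "cube_expectation n (\<lambda>x. F x + G x) = cube_expectation n F + cube_expectation n G"
  by (simp add: cube_expectation_eq sum.distrib add_divide_distrib)

lemma cube_expectation_diff:
  "cube_expectation n (\<lambda>x. F x - G x) = cube_expectation n F - cube_expectation n G"
  by (simp add: cube_expectation_eq sum_subtractf diff_divide_distrib)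

lemma cube_expectation_cmult:
  "cube_expectation n (\<lambda>x. c * F x) = c * cube_expectation n F"
  by (simp add: cube_expectation_eq sum_distrib_left[symmetric])

lemma cube_expectation_sum:
  "cube_expectation n (\<lambda>x. \<Sum>i\<in>A. F i x) = (\<Sum>i\<in>A. cube_expectation n (F i))"
proof -
  have "(\<Sum>x\<in>cube n. \<Sum>i\<in>A. F i x) = (\<Sum>i\<in>A. \<Sum>x\<in>cube n. F i x)"
    by (rule sum.swap)
  then show ?thesis by (simp add: cube_expectation_eq sum_divide_distrib)
qed

lemma cube_expectation_const [simp]: "cube_expectation n (\<lambda>x. c) = c"
  by (simp add: cube_expectation_eq card_cube)

lemma cube_expectation_cong:
  "(\<And>x. x \<in> cube n \<Longrightarrow> F x = G x) \<Longrightarrow> cube_expectation n F = cube_expectation n G"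
  by (simp add: cube_expectation_eq)

lemma cube_expectation_eq_0_iff:
  "(\<And>x. x \<in> cube n \<Longrightarrow> 0 \<le> F x) \<Longrightarrow> cube_expectation n F = 0 \<longleftrightarrow> (\<forall>x\<in>cube n. F x = 0)"
  by (simp add: cube_expectation_eq sum_nonneg_eq_0_iff)

text \<open>
  This passes from the two \<open>L\<^sup>2\<close> norms on the halves of the cube, to which the two-point inequality
  applies, to the derivative in the last direction.
\<close>

lemma L2_reverse_triangle:
  "(sqrt (cube_expectation n (\<lambda>x. (g x)\<^sup>2)) - sqrt (cube_expectation n (\<lambda>x. (h x)\<^sup>2)))\<^sup>2
    \<le> cube_expectation n (\<lambda>x. (g x - h x)\<^sup>2)"
proof -
  let ?G = "cube_expectation n (\<lambda>x. (g x)\<^sup>2)" and ?H = "cube_expectation n (\<lambda>x. (h x)\<^sup>2)"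
  have nn: "?G \<ge> 0" "?H \<ge> 0" by (auto intro: cube_expectation_nonneg)
  have "(\<Sum>x\<in>cube n. g x * h x)\<^sup>2 \<le> (\<Sum>x\<in>cube n. (g x)\<^sup>2) * (\<Sum>x\<in>cube n. (h x)\<^sup>2)"
    by (rule Cauchy_Schwarz_ineq_sum)
  then have "(cube_expectation n (\<lambda>x. g x * h x))\<^sup>2 \<le> ?G * ?H"
    by (simp add: cube_expectation_eq power_divide power2_eq_square divide_right_mono)
  then have "cube_expectation n (\<lambda>x. g x * h x) \<le> sqrt (?G * ?H)"
    by (rule real_le_rsqrt)
  moreover have "cube_expectation n (\<lambda>x. (g x - h x)\<^sup>2)
      = ?G + ?H - 2 * cube_expectation n (\<lambda>x. g x * h x)"
    unfolding cube_expectation_cmult[symmetric] cube_expectation_add[symmetric]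
      cube_expectation_diff[symmetric]
    by (simp add: power2_diff algebra_simps)
  ultimately show ?thesis
    using nn by (simp add: power2_diff real_sqrt_mult)
qed

text \<open>
  Induction on the dimension. The entropy splits into the average entropy over the two halves of the
  cube and the two-point entropy of the second moments \<open>m 1\<close>, \<open>m (-1)\<close> of the halves. The induction
  hypothesis bounds the former, the two-point inequality at the square roots of the second moments the
  latter.
\<close>

theorem log_sobolev:
  "cube_expectation n (\<lambda>x. xlogx ((g x)\<^sup>2)) - xlogx (cube_expectation n (\<lambda>x. (g x)\<^sup>2))
    \<le> 2 * (\<Sum>i\<in>{1..n}. cube_expectation n (\<lambda>x. (D i g x)\<^sup>2))"
proof (induction n arbitrary: g)
  case 0
  have "cube 0 = {\<lambda>x. undefined}" by (simp add: cube_def)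
  then show ?case by (simp add: cube_expectation_eq)
next
  case (Suc n)
  define h where "h b x = g (x(Suc n := b))" for b :: real and x
  define m where "m b = cube_expectation n (\<lambda>x. (h b x)\<^sup>2)" for b
  define E where "E b = cube_expectation n (\<lambda>x. xlogx ((h b x)\<^sup>2))" for b
  define e where "e b = (\<Sum>i\<in>{1..n}. cube_expectation n (\<lambda>x. (D i (h b) x)\<^sup>2))" for b
  have IH: "E b - xlogx (m b) \<le> 2 * e b" for b
    unfolding E_def m_def e_def by (rule Suc.IH)
  have m0: "m b \<ge> 0" for b unfolding m_def by (intro cube_expectation_nonneg) simp
  have Dh: "D i g (x(Suc n := b)) = D i (h b) x" if "i \<in> {1..n}" for i b x
    using that by (simp add: D_def h_def fun_upd_twist)
  have old: "(\<Sum>i\<in>{1..n}. cube_expectation (Suc n) (\<lambda>x. (D i g x)\<^sup>2)) = (e 1 + e (-1)) / 2"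
  proof -
    have "(\<Sum>i\<in>{1..n}. cube_expectation (Suc n) (\<lambda>x. (D i g x)\<^sup>2))
      = (\<Sum>i\<in>{1..n}. (cube_expectation n (\<lambda>x. (D i (h 1) x)\<^sup>2) + cube_expectation n (\<lambda>x. (D i (h (-1)) x)\<^sup>2)) / 2)"
      by (intro sum.cong refl) (simp only: cube_expectation_Suc Dh)
    then show ?thesis
      by (simp add: e_def sum.distrib sum_divide_distrib add_divide_distrib)
  qed
  have new: "cube_expectation (Suc n) (\<lambda>x. (D (Suc n) g x)\<^sup>2)
      = cube_expectation n (\<lambda>x. (h 1 x - h (-1) x)\<^sup>2) / 4"
    unfolding cube_expectation_Suc by (simp add: D_def h_def power_divide cube_expectation_eq sum_divide_distrib mult.commute)
  have "(xlogx ((sqrt (m 1))\<^sup>2) + xlogx ((sqrt (m (-1)))\<^sup>2)) / 2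
      - xlogx (((sqrt (m 1))\<^sup>2 + (sqrt (m (-1)))\<^sup>2) / 2) \<le> (sqrt (m 1) - sqrt (m (-1)))\<^sup>2 / 2"
    by (intro two_point_log_sobolev) (simp_all add: m0)
  then have "(xlogx (m 1) + xlogx (m (-1))) / 2 - xlogx ((m 1 + m (-1)) / 2)
      \<le> (sqrt (m 1) - sqrt (m (-1)))\<^sup>2 / 2"
    using m0 by simp
  also have "\<dots> \<le> cube_expectation n (\<lambda>x. (h 1 x - h (-1) x)\<^sup>2) / 2"
    unfolding m_def by (intro divide_right_mono L2_reverse_triangle) simp
  finally have "(E 1 + E (-1)) / 2 - xlogx ((m 1 + m (-1)) / 2)
    \<le> 2 * ((e 1 + e (-1)) / 2 + cube_expectation (Suc n) (\<lambda>x. (D (Suc n) g x)\<^sup>2))"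
    using IH[of 1] IH[of "-1"] unfolding new by argo
  moreover have "(\<Sum>i\<in>{1..Suc n}. cube_expectation (Suc n) (\<lambda>x. (D i g x)\<^sup>2))
    = (e 1 + e (-1)) / 2 + cube_expectation (Suc n) (\<lambda>x. (D (Suc n) g x)\<^sup>2)"
    using old by (simp del: One_nat_def)
  moreover have "cube_expectation (Suc n) (\<lambda>x. xlogx ((g x)\<^sup>2)) = (E 1 + E (-1)) / 2"
    "cube_expectation (Suc n) (\<lambda>x. (g x)\<^sup>2) = (m 1 + m (-1)) / 2"
    by (simp_all add: cube_expectation_Suc E_def m_def h_def)
  ultimately show ?case by (simp only:)
qed

text \<open>
  Relative to the density \<open>g\<^sup>2 / x\<close>, the \<open>q\<close>-th moment of \<open>g\<close> is an exponential moment of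
  \<open>(q - 2) / 2 * ln (g\<^sup>2)\<close>, so Jensen's inequality bounds it from below through the entropy. This gives
  the entropy bound \<open>q / (2 - q) * x * ln (x / y)\<close> with \<open>y\<close> the squared \<open>L\<^sup>q\<close> norm. The statement replaces
  \<open>x ln (x / y)\<close> by its tangent planes \<open>x ln c + x - c y\<close>, which are linear in \<open>x\<close> and \<open>y\<close>; so they can
  be summed over several functions and averaged, and \<open>c\<close> chosen at the very end. This also covers
  \<open>x = 0\<close>.
\<close>

lemma entropy_ge_log_norm_ratio:
  fixes q :: real and n :: nat and g :: "(nat \<Rightarrow> real) \<Rightarrow> real"
  assumes q: "1 \<le> q" "q < 2" and c: "0 < c"
  defines "x \<equiv> cube_expectation n (\<lambda>x. (g x)\<^sup>2)"
  shows "q / (2 - q) * (x * ln c + x - c * (Lp_norm n q g)\<^sup>2)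
    \<le> cube_expectation n (\<lambda>x. xlogx ((g x)\<^sup>2)) - xlogx x"
proof -
  define m where "m = cube_expectation n (\<lambda>x. \<bar>g x\<bar> powr q)"
  have m0: "m \<ge> 0" unfolding m_def by (intro cube_expectation_nonneg) simp
  have x0: "x \<ge> 0" unfolding x_def by (intro cube_expectation_nonneg) simp
  have N: "Lp_norm n q g = m powr (1 / q)" by (simp add: Lp_norm_def m_def)
  show ?thesis
  proof (cases "x = 0")
    case True
    then have "\<forall>x\<in>cube n. (g x)\<^sup>2 = 0"
      unfolding x_def by (subst (asm) cube_expectation_eq_0_iff) auto
    then have "cube_expectation n (\<lambda>x. xlogx ((g x)\<^sup>2)) = 0"
      by (simp add: cube_expectation_eq)
    moreover have "q / (2 - q) * (c * (Lp_norm n q g)\<^sup>2) \<ge> 0" using q c by simp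
    ultimately show ?thesis using True by simp
  next
    case False
    with x0 have x: "x > 0" by simp
    have m: "m > 0"
    proof (rule ccontr)
      assume "\<not> m > 0"
      with m0 have "m = 0" by simp
      then have "\<forall>x\<in>cube n. \<bar>g x\<bar> powr q = 0"
        unfolding m_def by (subst (asm) cube_expectation_eq_0_iff) auto
      then have "x = 0" by (simp add: x_def cube_expectation_eq)
      with x show False by simp
    qed
    \<comment> \<open>Jensen's inequality for the probability density \<open>g\<^sup>2 / x\<close>, via the tangent to the exponential.\<close>
    have point: "m / x * ((1 - ln (m / x)) * (g y)\<^sup>2 - (2 - q) / 2 * xlogx ((g y)\<^sup>2)) \<le> \<bar>g y\<bar> powr q" for y
    proof (cases "g y = 0")
      case False
      define G where "G = \<bar>g y\<bar>"
      have G: "G > 0" "(g y)\<^sup>2 = G\<^sup>2" using False by (auto simp: G_def)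
      have pw: "G powr q = G\<^sup>2 * G powr (q - 2)"
        using G by (simp flip: powr_numeral powr_add)
      have "ln (G powr (q - 2) * (x / m)) \<le> G powr (q - 2) * (x / m) - 1"
        using G x m by (intro ln_le_minus_one) simp
      moreover have "ln (G powr (q - 2) * (x / m)) = (q - 2) * ln G - ln (m / x)"
        using G x m by (simp add: ln_mult ln_div ln_powr)
      ultimately have "1 + (q - 2) * ln G - ln (m / x) \<le> G powr (q - 2) * (x / m)"
        by simp
      then have "m / x * G\<^sup>2 * (1 + (q - 2) * ln G - ln (m / x)) \<le> m / x * G\<^sup>2 * (G powr (q - 2) * (x / m))"
        using x m by (intro mult_left_mono) auto
      also have "\<dots> = G powr q" using x m by (simp add: pw)
      finally have "m / x * (G\<^sup>2 * (1 + (q - 2) * ln G - ln (m / x))) \<le> G powr q" by (simp add: mult.assoc)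
      moreover have "G\<^sup>2 * (1 + (q - 2) * ln G - ln (m / x)) = (1 - ln (m / x)) * G\<^sup>2 - (2 - q) / 2 * xlogx (G\<^sup>2)"
        using G by (simp add: xlogx_def ln_realpow field_simps)
      ultimately show ?thesis unfolding G(2) G_def[symmetric] by simp
    qed simp
    define Q where "Q = cube_expectation n (\<lambda>x. xlogx ((g x)\<^sup>2))"
    have "m / x * ((1 - ln (m / x)) * x - (2 - q) / 2 * Q) \<le> m"
    proof -
      have "cube_expectation n (\<lambda>y. m / x * ((1 - ln (m / x)) * (g y)\<^sup>2 - (2 - q) / 2 * xlogx ((g y)\<^sup>2))) \<le> m"
        unfolding m_def using point[unfolded m_def] by (intro cube_expectation_mono) simp
      then show ?thesis
        by (simp only: cube_expectation_cmult cube_expectation_diff Q_def x_def)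
    qed
    then have "m * ((1 - ln (m / x)) * x - (2 - q) / 2 * Q) \<le> m * x"
      using x by (simp add: pos_divide_le_eq)
    then have "(1 - ln (m / x)) * x - (2 - q) / 2 * Q \<le> x"
      using m by (simp only: mult_le_cancel_left_pos)
    then have "x * (ln x - ln m) \<le> (2 - q) / 2 * Q"
      using x m by (simp add: ln_div left_diff_distrib right_diff_distrib) argo
    then have Q: "2 / (2 - q) * (x * (ln x - ln m)) \<le> Q"
      using q by (simp add: field_simps)
    define N where "N = (Lp_norm n q g)\<^sup>2"
    have lnN: "ln N = 2 / q * ln m" and N0: "N > 0"
      using m q by (simp_all add: N_def Lp_norm_def m_def[symmetric] ln_realpow ln_powr)
    have "ln (c * N / x) \<le> c * N / x - 1"
      using c N0 x by (intro ln_le_minus_one) simp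
    then have "x * (ln c + ln N - ln x) \<le> x * (c * N / x - 1)"
      using c N0 x by (intro mult_left_mono) (simp_all add: ln_mult ln_div)
    then have "x * ln c + x - c * N \<le> x * (ln x - ln N)"
      using x by (simp add: algebra_simps)
    then have "q / (2 - q) * (x * ln c + x - c * N) \<le> q / (2 - q) * (x * (ln x - ln N))"
      using q by (intro mult_left_mono) auto
    also have "\<dots> = 2 / (2 - q) * (x * (ln x - ln m)) - xlogx x"
    proof -
      define u v r where "u = q / (2 - q)" and "v = 2 / q * ln m" and "r = 2 / (2 - q)"
      have u: "u = r - 1" using q by (simp add: u_def r_def field_simps)
      have uv: "u * v = r * ln m" using q by (simp add: u_def v_def r_def)
      have "u * (x * (ln x - v)) = u * (x * ln x) - x * (u * v)" by (simp add: algebra_simps)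
      also have "\<dots> = r * (x * (ln x - ln m)) - x * ln x" unfolding uv unfolding u by (simp add: algebra_simps)
      finally show ?thesis by (simp add: u_def v_def r_def lnN xlogx_def)
    qed
    also have "\<dots> \<le> Q - xlogx x" using Q by simp
    finally show ?thesis by (simp add: N_def Q_def)
  qed
qed

section \<open>Fourier weights of derivatives\<close>

lemma parseval_inner:
  "cube_expectation n (\<lambda>x. g x * h x) = (\<Sum>T\<in>Pow {1..n}. fourier_coeff n g T * fourier_coeff n h T)"
proof -
  have "cube_expectation n (\<lambda>x. g x * h x)
      = L2_inner n (\<lambda>x. \<Sum>T\<in>Pow {1..n}. fourier_coeff n g T * character T x) h"
    unfolding L2_inner_def by (rule cube_expectation_cong) (subst fourier_expansion[of _ n g], auto)
  also have "\<dots> = (\<Sum>T\<in>Pow {1..n}. fourier_coeff n g T * fourier_coeff n h T)"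
    by (rule L2_inner_sum_left)
  finally show ?thesis .
qed

lemma parseval: "cube_expectation n (\<lambda>x. (g x)\<^sup>2) = (\<Sum>T\<in>Pow {1..n}. (fourier_coeff n g T)\<^sup>2)"
  using parseval_inner[of n g g] by (simp add: power2_eq_square)

lemma fourier_coeff_linear:
  "fourier_coeff n (\<lambda>x. \<Sum>S\<in>A. c S * g S x) T = (\<Sum>S\<in>A. c S * fourier_coeff n (g S) T)"
  unfolding fourier_coeff_def
  by (simp add: sum_distrib_right cube_expectation_sum mult.assoc cube_expectation_cmult)

lemma fourier_coeff_character:
  "S \<subseteq> {1..n} \<Longrightarrow> T \<subseteq> {1..n} \<Longrightarrow> fourier_coeff n (character S) T = (if S = T then 1 else 0)"
  unfolding fourier_coeff_def by (rule expectation_character_mult)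

lemma fourier_coeff_D_set:
  assumes "J \<subseteq> {1..n}" "T \<subseteq> {1..n}"
  shows "fourier_coeff n (D_set J f) T = (if T \<inter> J = {} then fourier_coeff n f (T \<union> J) else 0)"
proof -
  have "fourier_coeff n (D_set J f) T = fourier_coeff n (\<lambda>x. \<Sum>S\<in>Pow {1..n}.
      fourier_coeff n f S * (if J \<subseteq> S then character (S - J) x else 0)) T"
    using assms by (intro fourier_coeff_cong D_set_expansion)
  also have "\<dots> = (\<Sum>S\<in>Pow {1..n}. fourier_coeff n f S *
      fourier_coeff n (\<lambda>x. if J \<subseteq> S then character (S - J) x else 0) T)"
    by (rule fourier_coeff_linear)
  also have "\<dots> = (\<Sum>S\<in>Pow {1..n}. if S = T \<union> J \<and> T \<inter> J = {} then fourier_coeff n f S else 0)"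
  proof (intro sum.cong refl)
    fix S assume S: "S \<in> Pow {1..n}"
    have "fourier_coeff n (\<lambda>x. if J \<subseteq> S then character (S - J) x else 0) T
        = (if J \<subseteq> S \<and> S - J = T then 1 else 0)"
    proof (cases "J \<subseteq> S")
      case True
      have "fourier_coeff n (character (S - J)) T = (if S - J = T then 1 else 0)"
        using S assms by (intro fourier_coeff_character) auto
      then show ?thesis using True by simp
    qed (simp add: fourier_coeff_def cube_expectation_eq)
    moreover have "J \<subseteq> S \<and> S - J = T \<longleftrightarrow> S = T \<union> J \<and> T \<inter> J = {}" by blast
    ultimately show "fourier_coeff n f S * fourier_coeff n (\<lambda>x. if J \<subseteq> S then character (S - J) x else 0) T
        = (if S = T \<union> J \<and> T \<inter> J = {} then fourier_coeff n f S else 0)" by simp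
  qed
  also have "\<dots> = (if T \<inter> J = {} then fourier_coeff n f (T \<union> J) else 0)"
  proof (cases "T \<inter> J = {}")
    case True
    have "(\<Sum>S\<in>Pow {1..n}. if S = T \<union> J then fourier_coeff n f S else 0) = fourier_coeff n f (T \<union> J)"
      using assms by (subst sum.delta) auto
    with True show ?thesis by simp
  qed simp
  finally show ?thesis .
qed

lemma finite_level [simp]: "finite (level n k)"
  by (rule finite_subset[of _ "Pow {1..n}"]) (auto simp: level_def)

text \<open>
  Differentiation along \<open>J\<close> shifts the Fourier coefficients from \<open>S\<close> to \<open>S - J\<close> for \<open>S \<supseteq> J\<close>, and a set
  \<open>S\<close> contains \<open>card S choose k\<close> sets of size \<open>k\<close>. Every spectral identity for the derivatives of
  order \<open>k\<close> is an instance, by the choice of the multiplier \<open>h\<close>.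
\<close>

lemma sum_level_fourier:
  "(\<Sum>J\<in>level n k. \<Sum>T\<in>Pow {1..n}. (fourier_coeff n (D_set J f) T)\<^sup>2 * h (card T))
    = (\<Sum>S\<in>Pow {1..n}. real (card S choose k) * (fourier_coeff n f S)\<^sup>2 * h (card S - k))"
proof -
  have "(\<Sum>T\<in>Pow {1..n}. (fourier_coeff n (D_set J f) T)\<^sup>2 * h (card T))
      = (\<Sum>S\<in>Pow {1..n}. if J \<subseteq> S then (fourier_coeff n f S)\<^sup>2 * h (card S - k) else 0)"
    if J: "J \<in> level n k" for J
  proof -
    have Jn: "J \<subseteq> {1..n}" "card J = k" "finite J"
      using J finite_subset by (auto simp: level_def)
    have "(\<Sum>T\<in>Pow {1..n}. (fourier_coeff n (D_set J f) T)\<^sup>2 * h (card T))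
      = (\<Sum>T\<in>{T. T \<subseteq> {1..n} \<and> T \<inter> J = {}}. (fourier_coeff n f (T \<union> J))\<^sup>2 * h (card T))"
      using Jn by (intro sum.mono_neutral_cong_right) (auto simp: fourier_coeff_D_set simp del: One_nat_def)
    also have "\<dots> = (\<Sum>S\<in>{S. S \<subseteq> {1..n} \<and> J \<subseteq> S}. (fourier_coeff n f S)\<^sup>2 * h (card S - k))"
      using Jn
      by (intro sum.reindex_bij_witness[of _ "\<lambda>S. S - J" "\<lambda>T. T \<union> J"])
        (auto simp: Un_absorb2 card_Un_disjoint Int_commute finite_subset card_Diff_subset)
    also have "\<dots> = (\<Sum>S\<in>Pow {1..n}. if J \<subseteq> S then (fourier_coeff n f S)\<^sup>2 * h (card S - k) else 0)"
      by (intro sum.mono_neutral_cong_left) auto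
    finally show ?thesis .
  qed
  then have "(\<Sum>J\<in>level n k. \<Sum>T\<in>Pow {1..n}. (fourier_coeff n (D_set J f) T)\<^sup>2 * h (card T))
    = (\<Sum>J\<in>level n k. \<Sum>S\<in>Pow {1..n}. if J \<subseteq> S then (fourier_coeff n f S)\<^sup>2 * h (card S - k) else 0)"
    by simp
  also have "\<dots> = (\<Sum>S\<in>Pow {1..n}. \<Sum>J\<in>level n k. if J \<subseteq> S then (fourier_coeff n f S)\<^sup>2 * h (card S - k) else 0)"
    by (rule sum.swap)
  also have "\<dots> = (\<Sum>S\<in>Pow {1..n}. real (card S choose k) * (fourier_coeff n f S)\<^sup>2 * h (card S - k))"
  proof (intro sum.cong refl)
    fix S assume S: "S \<in> Pow {1..n}"
    then have fin: "finite S" using finite_subset by auto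
    have "{J \<in> level n k. J \<subseteq> S} = {J. J \<subseteq> S \<and> card J = k}"
      using S by (auto simp: level_def)
    then have "card {J \<in> level n k. J \<subseteq> S} = card S choose k"
      using n_subsets[OF fin] by simp
    then show "(\<Sum>J\<in>level n k. if J \<subseteq> S then (fourier_coeff n f S)\<^sup>2 * h (card S - k) else 0)
      = real (card S choose k) * (fourier_coeff n f S)\<^sup>2 * h (card S - k)"
      by (simp add: sum.inter_filter[symmetric])
  qed
  finally show ?thesis .
qed

lemma energy_fourier:
  "(\<Sum>i\<in>{1..n}. cube_expectation n (\<lambda>x. (D i g x)\<^sup>2))
    = (\<Sum>T\<in>Pow {1..n}. real (card T) * (fourier_coeff n g T)\<^sup>2)"
proof -
  have lev: "level n 1 = (\<lambda>i. {i}) ` {1..n}"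
    by (auto simp: level_def card_1_singleton_iff image_iff)
  have "(\<Sum>i\<in>{1..n}. cube_expectation n (\<lambda>x. (D i g x)\<^sup>2))
      = (\<Sum>J\<in>level n 1. \<Sum>T\<in>Pow {1..n}. (fourier_coeff n (D_set J g) T)\<^sup>2 * 1)"
    unfolding lev by (subst sum.reindex) (auto simp: D_set_insert parseval simp del: One_nat_def)
  also have "\<dots> = (\<Sum>T\<in>Pow {1..n}. real (card T) * (fourier_coeff n g T)\<^sup>2)"
    by (subst sum_level_fourier) simp
  finally show ?thesis .
qed

section \<open>The noise operator\<close>

definition noise :: "nat \<Rightarrow> real \<Rightarrow> ((nat \<Rightarrow> real) \<Rightarrow> real) \<Rightarrow> (nat \<Rightarrow> real) \<Rightarrow> real" where
  "noise n \<rho> g x = (\<Sum>S\<in>Pow {1..n}. \<rho> ^ card S * fourier_coeff n g S * character S x)"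

definition noise_kernel :: "nat \<Rightarrow> real \<Rightarrow> (nat \<Rightarrow> real) \<Rightarrow> (nat \<Rightarrow> real) \<Rightarrow> real" where
  "noise_kernel n \<rho> x y = (\<Prod>i\<in>{1..n}. (1 + \<rho> * x i * y i) / 2)"

lemma fourier_coeff_noise:
  "T \<subseteq> {1..n} \<Longrightarrow> fourier_coeff n (noise n \<rho> g) T = \<rho> ^ card T * fourier_coeff n g T"
  unfolding noise_def by (subst fourier_coeff_sum) auto

lemma noise_kernel_expansion:
  "noise_kernel n \<rho> x y = (\<Sum>S\<in>Pow {1..n}. \<rho> ^ card S * character S x * character S y) / 2 ^ n"
proof -
  have "(\<Prod>i\<in>{1..n}. \<rho> * x i * y i + 1) = (\<Sum>S\<in>Pow {1..n}. \<rho> ^ card S * character S x * character S y)"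
    by (simp add: prod_add character_def prod.distrib)
  then show ?thesis
    by (simp add: noise_kernel_def prod_dividef add.commute)
qed

lemma noise_eq_kernel: "noise n \<rho> g x = (\<Sum>y\<in>cube n. noise_kernel n \<rho> x y * g y)"
proof -
  have "(\<Sum>y\<in>cube n. noise_kernel n \<rho> x y * g y)
      = (\<Sum>y\<in>cube n. \<Sum>S\<in>Pow {1..n}. \<rho> ^ card S * character S x * (g y * character S y / 2 ^ n))"
    unfolding noise_kernel_expansion sum_divide_distrib sum_distrib_right
    by (intro sum.cong refl) (simp add: mult_ac)
  also have "\<dots> = (\<Sum>S\<in>Pow {1..n}. \<Sum>y\<in>cube n. \<rho> ^ card S * character S x * (g y * character S y / 2 ^ n))"
    by (rule sum.swap)
  also have "\<dots> = noise n \<rho> g x"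
    unfolding noise_def fourier_coeff_def cube_expectation_eq sum_divide_distrib sum_distrib_left
      sum_distrib_right
    by (intro sum.cong refl) (simp add: mult_ac)
  finally show ?thesis by simp
qed

lemma cube_coord: "x \<in> cube n \<Longrightarrow> i \<in> {1..n} \<Longrightarrow> x i = 1 \<or> x i = - 1"
  by (auto simp: cube_def PiE_iff)

lemma noise_kernel_nonneg:
  assumes "x \<in> cube n" "y \<in> cube n" "0 \<le> \<rho>" "\<rho> \<le> 1"
  shows "0 \<le> noise_kernel n \<rho> x y"
  unfolding noise_kernel_def
proof (intro prod_nonneg)
  fix i assume "i \<in> {1..n}"
  then show "0 \<le> (1 + \<rho> * x i * y i) / 2"
    using assms cube_coord[of x n i] cube_coord[of y n i] by auto
qed

text \<open>
  Sums of products over the cube factorise, so expectations under the noise kernel, which is a product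
  measure, can be computed one coordinate at a time.
\<close>

lemma sum_prod_cube:
  fixes w :: "nat \<Rightarrow> real \<Rightarrow> real"
  shows "(\<Sum>y\<in>cube n. \<Prod>i\<in>{1..n}. w i (y i)) = (\<Prod>i\<in>{1..n}. w i (-1) + w i 1)"
proof -
  have "(\<Prod>i\<in>{1..n}. \<Sum>b\<in>{-1, 1}. w i b) = (\<Sum>y\<in>cube n. \<Prod>i\<in>{1..n}. w i (y i))"
    unfolding cube_def by (rule prod_sum_PiE) auto
  then show ?thesis by simp
qed

lemma sum_noise_kernel: "(\<Sum>y\<in>cube n. noise_kernel n \<rho> x y) = 1"
  unfolding noise_kernel_def
  by (subst sum_prod_cube[where w = "\<lambda>i b. (1 + \<rho> * x i * b) / 2"]) (simp add: field_simps)

lemma cube_expectation_noise: "cube_expectation n (noise n \<rho> g) = cube_expectation n g"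
proof -
  have *: "fourier_coeff n h {} = cube_expectation n h" for h
    by (simp add: fourier_coeff_def character_def)
  show ?thesis using fourier_coeff_noise[of "{}" n \<rho> g] by (simp add: *)
qed

lemma noise_mono:
  assumes "x \<in> cube n" "0 \<le> \<rho>" "\<rho> \<le> 1" "\<And>y. y \<in> cube n \<Longrightarrow> g y \<le> h y"
  shows "noise n \<rho> g x \<le> noise n \<rho> h x"
  unfolding noise_eq_kernel using assms by (intro sum_mono mult_left_mono noise_kernel_nonneg) auto

lemma convex_on_powr_nonneg:
  assumes "1 \<le> (p::real)"
  shows "convex_on {0..} (\<lambda>x::real. x powr p)"
proof (rule convex_on_linorderI)
  fix t x y :: real
  assume t: "0 < t" "t < 1" and xy: "x \<in> {0..}" "y \<in> {0..}" "x < y"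
  show "((1 - t) *\<^sub>R x + t *\<^sub>R y) powr p \<le> (1 - t) * x powr p + t * y powr p"
  proof (cases "x = 0")
    case True
    have "t powr p \<le> t powr 1" using t assms by (intro powr_mono') auto
    then have "t powr p * y powr p \<le> t * y powr p" using t by (intro mult_right_mono) auto
    then show ?thesis using True t xy by (simp add: powr_mult)
  next
    case False
    then show ?thesis using convex_onD[OF powr_convex[OF assms], of t x y] t xy by simp
  qed
qed simp

lemma noise_powr_le:
  assumes x: "x \<in> cube n" and \<rho>: "0 \<le> \<rho>" "\<rho> \<le> 1" and p: "1 \<le> p"
    and g: "\<And>y. y \<in> cube n \<Longrightarrow> 0 \<le> g y"
  shows "(noise n \<rho> g x) powr p \<le> noise n \<rho> (\<lambda>y. g y powr p) x"
proof -
  have "(\<Sum>y\<in>cube n. noise_kernel n \<rho> x y *\<^sub>R g y) powr p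
      \<le> (\<Sum>y\<in>cube n. noise_kernel n \<rho> x y * g y powr p)"
    by (rule convex_on_sum[OF _ _ convex_on_powr_nonneg[OF p]])
      (auto simp: sum_noise_kernel g intro: noise_kernel_nonneg x \<rho>)
  then show ?thesis by (simp add: noise_eq_kernel)
qed

lemma abs_noise_le:
  assumes "x \<in> cube n" "0 \<le> \<rho>" "\<rho> \<le> 1"
  shows "\<bar>noise n \<rho> g x\<bar> \<le> noise n \<rho> (\<lambda>y. \<bar>g y\<bar>) x"
  unfolding noise_eq_kernel
  by (rule order.trans[OF sum_abs]) (use assms in \<open>simp add: abs_mult noise_kernel_nonneg\<close>)

lemma expectation_noise_powr_le:
  assumes \<rho>: "0 \<le> \<rho>" "\<rho> \<le> 1" and p: "1 \<le> p" and g: "\<And>y. y \<in> cube n \<Longrightarrow> 0 \<le> g y"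
  shows "cube_expectation n (\<lambda>x. noise n \<rho> g x powr p) \<le> cube_expectation n (\<lambda>x. g x powr p)"
proof -
  have "cube_expectation n (\<lambda>x. noise n \<rho> g x powr p)
      \<le> cube_expectation n (\<lambda>x. noise n \<rho> (\<lambda>y. g y powr p) x)"
    using assms by (intro cube_expectation_mono noise_powr_le)
  then show ?thesis using cube_expectation_noise[of n \<rho> "\<lambda>y. g y powr p"] by simp
qed

lemma Lp_norm_noise_le:
  assumes \<rho>: "0 \<le> \<rho>" "\<rho> \<le> 1" and p: "1 \<le> p"
  shows "Lp_norm n p (noise n \<rho> g) \<le> Lp_norm n p g"
proof -
  have "cube_expectation n (\<lambda>x. \<bar>noise n \<rho> g x\<bar> powr p)
      \<le> cube_expectation n (\<lambda>x. noise n \<rho> (\<lambda>y. \<bar>g y\<bar>) x powr p)"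
    using assms by (intro cube_expectation_mono powr_mono2 abs_noise_le) auto
  also have "\<dots> \<le> cube_expectation n (\<lambda>x. \<bar>g x\<bar> powr p)"
    using assms by (intro expectation_noise_powr_le) auto
  finally show ?thesis
    unfolding Lp_norm_def using p by (intro powr_mono2 cube_expectation_nonneg) auto
qed

section \<open>Beta averages of the energy of the derivatives\<close>

lemma beta_moment:
  assumes "1 \<le> j"
  shows "((\<lambda>s::real. real j * (1 - s) ^ (j - 1) * s ^ e) has_integral 1 / real ((e + j) choose j)) {0..1}"
proof -
  obtain i where j: "j = Suc i" using assms by (cases j) auto
  have "Beta (real e + 1) (real i + 1) = fact e * fact i / fact (e + j)"
  proof -
    have G: "Gamma (real m + 1) = fact m" for m
      using Gamma_fact[of m, where ?'a = real] by (simp add: add.commute)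
    have "real e + 1 + (real i + 1) = real (e + j) + 1" by (simp add: j)
    then show ?thesis unfolding Beta_def by (simp only: G)
  qed
  moreover have "real ((e + j) choose j) = fact (e + j) / (fact j * fact e)"
    by (subst binomial_fact) auto
  ultimately have B: "real j * Beta (real e + 1) (real i + 1) = 1 / real ((e + j) choose j)"
    by (simp add: j field_simps)
  have "((\<lambda>t. t powr (real e + 1 - 1) * (1 - t) powr (real i + 1 - 1)) has_integral
      Beta (real e + 1) (real i + 1)) {0..1}"
    by (rule has_integral_Beta_real) auto
  then have "((\<lambda>t. real j * (t powr (real e) * (1 - t) powr (real i))) has_integral
      1 / real ((e + j) choose j)) {0..1}"
    unfolding B[symmetric] by (intro has_integral_mult_right) simp
  then show ?thesis
  proof (rule has_integral_spike_finite[of "{0, 1}", rotated 2])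
    fix x :: real assume "x \<in> {0..1} - {0, 1}"
    then have "0 < x" "x < 1" by auto
    then show "real j * (1 - x) ^ (j - 1) * x ^ e = real j * (x powr real e * (1 - x) powr real i)"
      by (simp add: powr_realpow j)
  qed simp
qed

text \<open>
  The probability density \<open>j * (1 - s) ^ (j - 1)\<close> turns \<open>s ^ e\<close> into the reciprocal of a binomial
  coefficient.
\<close>

lemma beta_average_mono:
  assumes "finite U" "1 \<le> j"
    and le: "\<And>s. 0 \<le> s \<Longrightarrow> s \<le> 1 \<Longrightarrow> \<beta> \<le> (\<Sum>i\<in>U. b i * s ^ e i)"
  shows "\<beta> \<le> (\<Sum>i\<in>U. b i / real ((e i + j) choose j))"
proof (rule has_integral_le)
  show "((\<lambda>s::real. \<beta> * (real j * (1 - s) ^ (j - 1) * s ^ 0)) has_integral \<beta>) {0..1}"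
    using has_integral_mult_right[OF beta_moment[OF assms(2), of 0], of \<beta>] by simp
  show "((\<lambda>s. \<Sum>i\<in>U. b i * (real j * (1 - s) ^ (j - 1) * s ^ e i)) has_integral
      (\<Sum>i\<in>U. b i / real ((e i + j) choose j))) {0..1}"
  proof (rule has_integral_sum[OF assms(1)])
    fix i
    show "((\<lambda>s. b i * (real j * (1 - s) ^ (j - 1) * s ^ e i)) has_integral
        b i / real ((e i + j) choose j)) {0..1}"
      using has_integral_mult_right[OF beta_moment[OF assms(2), of "e i"], of "b i"] by simp
  qed
  fix s :: real assume s: "s \<in> {0..1}"
  have "\<beta> * (real j * (1 - s) ^ (j - 1)) \<le> (\<Sum>i\<in>U. b i * s ^ e i) * (real j * (1 - s) ^ (j - 1))"
    using s le by (intro mult_right_mono) auto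
  also have "\<dots> = (\<Sum>i\<in>U. b i * (real j * (1 - s) ^ (j - 1) * s ^ e i))"
    unfolding sum_distrib_right by (intro sum.cong refl) (simp add: mult_ac)
  finally show "\<beta> * (real j * (1 - s) ^ (j - 1) * s ^ 0) \<le> (\<Sum>i\<in>U. b i * (real j * (1 - s) ^ (j - 1) * s ^ e i))"
    by simp
qed

text \<open>
  The logarithmic Sobolev inequality for the functions \<open>noise n (sqrt s) (D_set J f)\<close>, summed over \<open>J\<close>.
  Noise multiplies the squared Fourier coefficient at \<open>T\<close> by \<open>s ^ card T\<close> and contracts the \<open>L\<^sup>q\<close> norm.
\<close>

lemma log_sobolev_derivatives:
  fixes q :: real
  assumes q: "1 \<le> q" "q < 2" and c: "0 < c" and s: "0 \<le> s" "s \<le> 1"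
    and B: "(\<Sum>J\<in>level n k. (Lp_norm n q (D_set J f))\<^sup>2) \<le> B"
  shows "q / (2 * (2 - q)) * ((ln c + 1) *
        (\<Sum>S\<in>Pow {1..n}. real (card S choose k) * (fourier_coeff n f S)\<^sup>2 * s ^ (card S - k)) - c * B)
    \<le> (\<Sum>S\<in>Pow {1..n}. real (card S choose k) * (fourier_coeff n f S)\<^sup>2 *
        (real (card S - k) * s ^ (card S - k)))"
proof -
  define a where "a = q / (2 * (2 - q))"
  have a: "a \<ge> 0" using q by (simp add: a_def)
  define g where "g J = noise n (sqrt s) (D_set J f)" for J
  define x where "x J = cube_expectation n (\<lambda>y. (g J y)\<^sup>2)" for J
  have fg: "(fourier_coeff n (g J) T)\<^sup>2 = (fourier_coeff n (D_set J f) T)\<^sup>2 * s ^ card T" if "T \<subseteq> {1..n}" for J T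
  proof -
    have "(sqrt s ^ card T)\<^sup>2 = (sqrt s ^ 2) ^ card T" by (simp only: power_mult[symmetric] mult.commute)
    with that s show ?thesis by (simp add: g_def fourier_coeff_noise power_mult_distrib)
  qed
  have each: "a * (x J * ln c + x J - c * (Lp_norm n q (D_set J f))\<^sup>2)
      \<le> (\<Sum>T\<in>Pow {1..n}. (fourier_coeff n (D_set J f) T)\<^sup>2 * (real (card T) * s ^ card T))" for J
  proof -
    have "Lp_norm n q (g J) \<le> Lp_norm n q (D_set J f)"
      unfolding g_def using s q by (intro Lp_norm_noise_le) auto
    then have "(Lp_norm n q (g J))\<^sup>2 \<le> (Lp_norm n q (D_set J f))\<^sup>2"
      by (intro power_mono) (auto simp: Lp_norm_def)
    then have "a * (x J * ln c + x J - c * (Lp_norm n q (D_set J f))\<^sup>2)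
        \<le> a * (x J * ln c + x J - c * (Lp_norm n q (g J))\<^sup>2)"
      using a c by (intro mult_left_mono diff_left_mono) auto
    also have "\<dots> = q / (2 - q) * (x J * ln c + x J - c * (Lp_norm n q (g J))\<^sup>2) / 2"
      using q by (simp add: a_def field_simps)
    also have "\<dots> \<le> (\<Sum>i\<in>{1..n}. cube_expectation n (\<lambda>y. (D i (g J) y)\<^sup>2))"
    proof -
      have half: "u / 2 \<le> v" if "u \<le> 2 * v" for u v :: real using that by simp
      show ?thesis
        unfolding x_def
        by (rule half, rule order.trans[OF entropy_ge_log_norm_ratio[OF q c] log_sobolev])
    qed
    also have "\<dots> = (\<Sum>T\<in>Pow {1..n}. real (card T) * (fourier_coeff n (g J) T)\<^sup>2)"
      by (rule energy_fourier)
    also have "\<dots> = (\<Sum>T\<in>Pow {1..n}. (fourier_coeff n (D_set J f) T)\<^sup>2 * (real (card T) * s ^ card T))"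
      using fg by (intro sum.cong refl) auto
    finally show ?thesis .
  qed
  have xs: "(\<Sum>J\<in>level n k. x J)
      = (\<Sum>S\<in>Pow {1..n}. real (card S choose k) * (fourier_coeff n f S)\<^sup>2 * s ^ (card S - k))" (is "_ = ?P")
  proof -
    have "(\<Sum>J\<in>level n k. x J) = (\<Sum>J\<in>level n k. \<Sum>T\<in>Pow {1..n}. (fourier_coeff n (D_set J f) T)\<^sup>2 * s ^ card T)"
      unfolding x_def parseval using fg by (intro sum.cong refl) auto
    then show ?thesis by (simp only: sum_level_fourier)
  qed
  have "a * ((ln c + 1) * ?P - c * B)
      \<le> a * ((ln c + 1) * ?P - c * (\<Sum>J\<in>level n k. (Lp_norm n q (D_set J f))\<^sup>2))"
    using a c B by (intro mult_left_mono diff_left_mono) auto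
  also have "\<dots> = (\<Sum>J\<in>level n k. a * (x J * ln c + x J - c * (Lp_norm n q (D_set J f))\<^sup>2))"
    unfolding xs[symmetric] sum_distrib_left sum_subtractf[symmetric]
    by (intro sum.cong refl) (simp add: algebra_simps)
  also have "\<dots> \<le> (\<Sum>J\<in>level n k. \<Sum>T\<in>Pow {1..n}. (fourier_coeff n (D_set J f) T)\<^sup>2 * (real (card T) * s ^ card T))"
    by (intro sum_mono each)
  also have "\<dots> = (\<Sum>S\<in>Pow {1..n}. real (card S choose k) * (fourier_coeff n f S)\<^sup>2 *
        (real (card S - k) * s ^ (card S - k)))"
    by (rule sum_level_fourier)
  finally show ?thesis by (simp add: a_def)
qed

text \<open>
  The average, over \<open>s\<close> with density \<open>j * (1 - s) ^ (j - 1)\<close>, of the total squared \<open>L\<^sup>2\<close> norm of the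
  derivatives of order \<open>k\<close>, damped by noise with parameter \<open>sqrt (r * s)\<close>. At \<open>j = 0\<close> the density degenerates to the
  point \<open>s = 1\<close>.
\<close>

definition avg_energy :: "nat \<Rightarrow> nat \<Rightarrow> nat \<Rightarrow> ((nat \<Rightarrow> real) \<Rightarrow> real) \<Rightarrow> real \<Rightarrow> real" where
  "avg_energy n k j f r = (\<Sum>S\<in>Pow {1..n}. real (card S choose k) * (fourier_coeff n f S)\<^sup>2
      * r ^ (card S - k) / real ((card S - k + j) choose j))"

text \<open>
  The inequality \<open>log_sobolev_derivatives\<close> at \<open>r * s\<close> in place of \<open>s\<close> is averaged over \<open>s\<close>. Taking
  \<open>c = avg_energy n k j f r / B\<close> means using the tangent at the average, as in Jensen's inequality.
\<close>

lemma avg_energy_log_sobolev: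
  fixes q :: real
  assumes q: "1 \<le> q" "q < 2" and j: "1 \<le> j" and r: "0 \<le> r" "r \<le> 1"
    and B: "(\<Sum>J\<in>level n k. (Lp_norm n q (D_set J f))\<^sup>2) \<le> B" "0 < B" and M: "0 < avg_energy n k j f r"
  shows "q / (2 * (2 - q)) * (avg_energy n k j f r * ln (avg_energy n k j f r / B))
    \<le> (\<Sum>S\<in>Pow {1..n}. real (card S choose k) * (fourier_coeff n f S)\<^sup>2
      * (real (card S - k) * r ^ (card S - k)) / real ((card S - k + j) choose j))"
proof -
  define a where "a = q / (2 * (2 - q))"
  define m where "m = avg_energy n k j f r"
  define c where "c = m / B"
  have c: "c > 0" using M B by (simp add: c_def m_def)
  define w where "w S = real (card S choose k) * (fourier_coeff n f S)\<^sup>2" for S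
  have "- a * c * B \<le> (\<Sum>S\<in>Pow {1..n}. (w S * (real (card S - k) - a * (ln c + 1)) * r ^ (card S - k)) * t ^ (card S - k))"
    if t: "0 \<le> t" "t \<le> 1" for t
  proof -
    have "0 \<le> r * t" "r * t \<le> 1" using r t by (auto intro: mult_le_one)
    from log_sobolev_derivatives[OF q c this B(1)]
    have "a * ((ln c + 1) * (\<Sum>S\<in>Pow {1..n}. w S * (r * t) ^ (card S - k)) - c * B)
      \<le> (\<Sum>S\<in>Pow {1..n}. w S * (real (card S - k) * (r * t) ^ (card S - k)))"
      unfolding w_def a_def .
    moreover have "(\<Sum>S\<in>Pow {1..n}. (w S * (real (card S - k) - a * (ln c + 1)) * r ^ (card S - k)) * t ^ (card S - k))
      = (\<Sum>S\<in>Pow {1..n}. w S * (real (card S - k) * (r * t) ^ (card S - k)))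
        - a * (ln c + 1) * (\<Sum>S\<in>Pow {1..n}. w S * (r * t) ^ (card S - k))"
      unfolding sum_distrib_left sum_subtractf[symmetric]
      by (intro sum.cong refl) (simp add: power_mult_distrib algebra_simps)
    ultimately show ?thesis by (simp add: algebra_simps)
  qed
  then have "- a * c * B \<le> (\<Sum>S\<in>Pow {1..n}. (w S * (real (card S - k) - a * (ln c + 1)) * r ^ (card S - k))
      / real ((card S - k + j) choose j))"
    by (intro beta_average_mono[OF _ j]) auto
  also have "\<dots> = (\<Sum>S\<in>Pow {1..n}. w S * (real (card S - k) * r ^ (card S - k)) / real ((card S - k + j) choose j))
      - a * (ln c + 1) * m"
    unfolding m_def avg_energy_def w_def[symmetric] sum_distrib_left sum_subtractf[symmetric]
    by (intro sum.cong refl) (simp add: diff_divide_distrib[symmetric] algebra_simps)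
  finally have "a * (ln c + 1) * m - a * c * B
    \<le> (\<Sum>S\<in>Pow {1..n}. w S * (real (card S - k) * r ^ (card S - k)) / real ((card S - k + j) choose j))"
    by simp
  moreover have "a * (ln c + 1) * m - a * c * B = a * (m * ln (m / B))"
    using B by (simp add: c_def algebra_simps)
  ultimately show ?thesis by (simp add: m_def w_def a_def)
qed

section \<open>The lower bound in the second moment\<close>

text \<open>
  At \<open>j = k\<close> the binomial factors cancel on every degree \<open>d \<ge> k\<close>.
\<close>

lemma avg_energy_full:
  "avg_energy n k k f r = (\<Sum>S | S \<subseteq> {1..n} \<and> k \<le> card S. (fourier_coeff n f S)\<^sup>2 * r ^ (card S - k))"
  unfolding avg_energy_def
  by (intro sum.mono_neutral_cong_right) (auto simp: not_le binomial_eq_0)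

lemma avg_energy_full_1: "avg_energy n k k f 1 = W_ge n k f"
  by (simp add: avg_energy_full W_ge_fourier)

lemma Lp_norm_2_sq: "(Lp_norm n 2 g)\<^sup>2 = cube_expectation n (\<lambda>x. (g x)\<^sup>2)"
proof -
  have "cube_expectation n (\<lambda>x. (g x)\<^sup>2) \<ge> 0" by (intro cube_expectation_nonneg) simp
  then show ?thesis by (simp add: Lp_norm_def powr_half_sqrt)
qed

lemma nabla_abs_sq: "(nabla_abs n k f x)\<^sup>2 = (\<Sum>J\<in>level n k. (D_set J f x)\<^sup>2)"
  by (simp add: nabla_abs_def sum_nonneg)

lemma nabla_abs_nonneg [simp]: "0 \<le> nabla_abs n k f x"
  by (simp add: nabla_abs_def sum_nonneg)

lemma avg_energy_0: "avg_energy n k 0 f 1 = (Lp_norm n 2 (nabla_abs n k f))\<^sup>2"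
proof -
  have "(Lp_norm n 2 (nabla_abs n k f))\<^sup>2 = (\<Sum>J\<in>level n k. \<Sum>T\<in>Pow {1..n}. (fourier_coeff n (D_set J f) T)\<^sup>2 * 1)"
    by (simp add: Lp_norm_2_sq nabla_abs_sq cube_expectation_sum parseval)
  also have "\<dots> = avg_energy n k 0 f 1"
    by (subst sum_level_fourier) (simp add: avg_energy_def)
  finally show ?thesis by simp
qed

lemma avg_energy_ge_W:
  assumes "j \<le> k"
  shows "W_ge n k f \<le> avg_energy n k j f 1"
  unfolding avg_energy_full_1[symmetric] avg_energy_def
proof (intro sum_mono)
  fix S :: "nat set"
  let ?e = "card S - k"
  have "(?e + j choose j) \<le> (?e + k choose k)"
    using assms binomial_right_mono[of "?e + j" "?e + k" ?e]
      binomial_symmetric[of j "?e + j"] binomial_symmetric[of k "?e + k"] by simp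
  then show "real (card S choose k) * (fourier_coeff n f S)\<^sup>2 * 1 ^ ?e / real (?e + k choose k)
      \<le> real (card S choose k) * (fourier_coeff n f S)\<^sup>2 * 1 ^ ?e / real (?e + j choose j)"
    by (intro divide_left_mono) (auto intro!: mult_pos_pos)
qed

text \<open>
  Hence at \<open>r = 1\<close> the energy on the right of \<open>avg_energy_log_sobolev\<close> is a difference of two
  consecutive averages.
\<close>

lemma avg_energy_diff:
  assumes "1 \<le> j"
  shows "real j * (avg_energy n k (j - 1) f 1 - avg_energy n k j f 1)
    = (\<Sum>S\<in>Pow {1..n}. real (card S choose k) * (fourier_coeff n f S)\<^sup>2
      * (real (card S - k) * 1 ^ (card S - k)) / real ((card S - k + j) choose j))"
proof -
  obtain i where j: "j = Suc i" using assms by (cases j) auto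
  have "real (Suc i) * (w / real (e + i choose i) - w / real (e + Suc i choose Suc i))
      = w * real e / real (e + Suc i choose Suc i)" for e and w :: real
  proof -
    have "Suc i * (Suc (e + i) choose Suc i) = Suc (e + i) * (e + i choose i)"
      by (rule Suc_times_binomial)
    then have eq: "real (Suc i) * real (e + Suc i choose Suc i) = real (Suc (e + i)) * real (e + i choose i)"
      unfolding of_nat_mult[symmetric] of_nat_eq_iff by (simp only: add_Suc_right)
    define P Q where "P = real (e + Suc i choose Suc i)" and "Q = real (e + i choose i)"
    have pos: "P > 0" "Q > 0" unfolding P_def Q_def of_nat_0_less_iff by (intro zero_less_binomial; simp)+
    have "real (Suc i) * (w / Q) = real (Suc (e + i)) * w / P"
    proof -
      have "real (Suc i) * w * P = real (Suc (e + i)) * w * Q"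
        using eq[folded P_def Q_def] by (metis mult.assoc mult.commute)
      then show ?thesis using pos by (simp add: frac_eq_eq del: of_nat_Suc)
    qed
    then have "real (Suc i) * (w / Q - w / P) = w * real e / P"
      by (simp add: right_diff_distrib) (simp add: diff_divide_distrib[symmetric] add_divide_distrib[symmetric] algebra_simps)
    then show ?thesis by (simp only: P_def Q_def)
  qed
  then show ?thesis
    unfolding avg_energy_def j sum_subtractf[symmetric] sum_distrib_left
    by (intro sum.cong refl) simp
qed

lemma W_ge_nonneg: "0 \<le> W_ge n k f"
  by (simp add: W_ge_def)

text \<open>
  A vanishing gradient of order \<open>k\<close> leaves no weight on degrees at least \<open>k\<close>; therefore all the
  logarithms below have positive arguments when \<open>W_ge n k f\<close> is positive.
\<close>

lemma W_ge_eq_0I: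
  assumes "\<And>J x. J \<in> level n k \<Longrightarrow> x \<in> cube n \<Longrightarrow> D_set J f x = 0"
  shows "W_ge n k f = 0"
proof -
  have "f \<in> nabla_null n k" using assms by (simp add: nabla_null_def)
  then show ?thesis unfolding W_ge_fourier nabla_null_iff by (auto intro!: sum.neutral)
qed

lemma Lp_norm_eq_0_iff: "Lp_norm n p g = 0 \<longleftrightarrow> (\<forall>x\<in>cube n. g x = 0)"
  unfolding Lp_norm_def powr_eq_0_iff by (subst cube_expectation_eq_0_iff) auto

lemma Lp_norm_nonneg [simp]: "0 \<le> Lp_norm n p g"
  by (simp add: Lp_norm_def)

lemma sum_Lp_norm_pos:
  assumes "0 < W_ge n k f"
  shows "0 < (\<Sum>J\<in>level n k. (Lp_norm n q (D_set J f))\<^sup>2)"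
proof (rule ccontr)
  assume "\<not> ?thesis"
  then have "(\<Sum>J\<in>level n k. (Lp_norm n q (D_set J f))\<^sup>2) = 0"
    using sum_nonneg[of "level n k" "\<lambda>J. (Lp_norm n q (D_set J f))\<^sup>2"] by simp
  then have "W_ge n k f = 0"
    by (intro W_ge_eq_0I) (simp add: sum_nonneg_eq_0_iff Lp_norm_eq_0_iff)
  with assms show False by simp
qed

text \<open>
  Let \<open>W > B\<close>, the other case being trivial. Descending from \<open>j = k\<close>, where the average is \<open>W\<close>, to \<open>j = 0\<close>, where it is the second moment of the
  gradient, each step multiplies by at least \<open>1 + a / j * ln (W / B) \<ge> 1 + a / k * ln (W / B)\<close>.
\<close>

theorem L2_gradient_lower_bound:
  fixes q :: real
  assumes q: "1 \<le> q" "q < 2"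
  shows "W_ge n k f * (1 + q / (2 * real k * (2 - q)) *
      ln_plus (W_ge n k f / (\<Sum>J\<in>level n k. (Lp_norm n q (D_set J f))\<^sup>2))) ^ k
    \<le> (Lp_norm n 2 (nabla_abs n k f))\<^sup>2"
proof -
  define W where "W = W_ge n k f"
  define B where "B = (\<Sum>J\<in>level n k. (Lp_norm n q (D_set J f))\<^sup>2)"
  define a where "a = q / (2 * (2 - q))"
  define b where "b = 1 + a / real k * ln_plus (W / B)"
  have a: "a > 0" using q by (simp add: a_def)
  have b: "b \<ge> 1" using a by (simp add: b_def ln_plus_def)
  have ge: "W * b ^ i \<le> avg_energy n k (k - i) f 1" if "i \<le> k" for i
    using that
  proof (induction i)
    case 0
    then show ?case by (simp add: avg_energy_full_1 W_def)
  next
    case (Suc i)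
    define j where "j = k - i"
    define M where "M = avg_energy n k j f 1"
    have j: "1 \<le> j" "j \<le> k" "k - Suc i = j - 1" using Suc.prems by (auto simp: j_def)
    have IH: "W * b ^ i \<le> M" using Suc by (simp add: M_def j_def)
    have MW: "W \<le> M" unfolding W_def M_def by (rule avg_energy_ge_W[OF j(2)])
    show ?case
    proof (cases "ln_plus (W / B) = 0")
      case True
      then have "b = 1" by (simp add: b_def)
      then show ?thesis using avg_energy_ge_W[of "k - Suc i" k n f] Suc.prems by (simp add: W_def)
    next
      case False
      then have ln: "ln (W / B) > 0" by (simp add: ln_plus_def max_def split: if_splits)
      then have W: "W > 0" using W_ge_nonneg[of n k f] by (cases "W = 0") (auto simp: W_def)
      then have B: "B > 0" unfolding W_def B_def by (rule sum_Lp_norm_pos)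
      have M0: "M > 0" using W MW by simp
      have "a * (M * ln (M / B)) \<le> real j * (avg_energy n k (j - 1) f 1 - M)"
        unfolding M_def avg_energy_diff[OF j(1)] a_def
        using B M0 by (intro avg_energy_log_sobolev[OF q j(1)]) (auto simp: B_def M_def)
      moreover have "ln (W / B) \<le> ln (M / B)"
        using W B MW by (simp add: divide_right_mono)
      then have "a * (M * ln (W / B)) \<le> a * (M * ln (M / B))"
        using a M0 by simp
      ultimately have "a * (M * ln (W / B)) / real j \<le> avg_energy n k (j - 1) f 1 - M"
        using j by (simp add: divide_le_eq mult.commute)
      moreover have "a * (M * ln (W / B)) / real k \<le> a * (M * ln (W / B)) / real j"
        using j a M0 ln by (intro divide_left_mono) auto
      ultimately have "M * b \<le> avg_energy n k (j - 1) f 1"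
        using ln by (simp add: b_def ln_plus_def algebra_simps)
      moreover have "W * b ^ i * b \<le> M * b" using IH b by (intro mult_right_mono) auto
      ultimately show ?thesis by (simp add: j(3) mult_ac)
    qed
  qed
  have "W * b ^ k \<le> (Lp_norm n 2 (nabla_abs n k f))\<^sup>2"
    using ge[of k] by (simp add: avg_energy_0)
  moreover have "b = 1 + q / (2 * real k * (2 - q)) * ln_plus (W / B)"
    by (simp add: b_def a_def mult_ac)
  ultimately show ?thesis by (simp add: W_def B_def)
qed

section \<open>Decay of the high-degree weight under noise\<close>

text \<open>
  With \<open>M u = avg_energy n k k f (exp (- u))\<close>, the logarithmic Sobolev inequality at \<open>j = k\<close> reads
  \<open>- M' \<ge> a M ln (M / B)\<close>, so \<open>exp (a u) * ln (M u / B)\<close> is nonincreasing.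
\<close>

lemma spectral_decay:
  fixes q :: real
  assumes q: "1 \<le> q" "q < 2" and k: "1 \<le> k" and v: "0 \<le> v"
    and B: "(\<Sum>J\<in>level n k. (Lp_norm n q (D_set J f))\<^sup>2) \<le> B" "0 < B" and W: "0 < W_ge n k f"
  shows "avg_energy n k k f (exp (- v))
    \<le> W_ge n k f * exp (- ln (W_ge n k f / B) * (1 - exp (- (q / (2 * (2 - q)) * v))))"
proof -
  define a where "a = q / (2 * (2 - q))"
  define U where "U = {S. S \<subseteq> {1..n} \<and> k \<le> card S}"
  have finU: "finite U" by (rule finite_subset[of _ "Pow {1..n}"]) (auto simp: U_def)
  define M where "M u = (\<Sum>S\<in>U. (fourier_coeff n f S)\<^sup>2 * exp (- u) ^ (card S - k))" for u :: real
  have M: "avg_energy n k k f (exp (- u)) = M u" for u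
    by (simp add: avg_energy_full M_def U_def)
  have M0: "M 0 = W_ge n k f" using M[of 0] by (simp add: avg_energy_full_1)
  obtain S0 where S0: "S0 \<in> U" "fourier_coeff n f S0 \<noteq> 0"
  proof -
    have "\<exists>S\<in>U. fourier_coeff n f S \<noteq> 0"
      using W unfolding W_ge_fourier U_def[symmetric] by (auto intro: ccontr)
    then show thesis using that by blast
  qed
  have Mpos: "M u > 0" for u
    unfolding M_def using S0 finU by (intro sum_pos2[of _ S0]) auto
  define E where "E u = (\<Sum>S\<in>U. (fourier_coeff n f S)\<^sup>2 * (real (card S - k) * exp (- u) ^ (card S - k)))" for u :: real
  have lsi: "a * (M u * ln (M u / B)) \<le> E u" if "0 \<le> u" for u
  proof -
    have "a * (M u * ln (M u / B)) \<le> (\<Sum>S\<in>Pow {1..n}. real (card S choose k) * (fourier_coeff n f S)\<^sup>2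
      * (real (card S - k) * exp (- u) ^ (card S - k)) / real ((card S - k + k) choose k))"
      using avg_energy_log_sobolev[OF q k _ _ B, of "exp (- u)"] that Mpos[of u] by (simp add: M a_def)
    also have "\<dots> = E u"
      unfolding E_def by (intro sum.mono_neutral_cong_right) (auto simp: U_def not_le binomial_eq_0)
    finally show ?thesis .
  qed
  have dM: "(M has_real_derivative - E u) (at u)" for u
    unfolding M_def E_def sum_negf[symmetric]
  proof (intro DERIV_sum)
    fix S
    have "((\<lambda>u. (fourier_coeff n f S)\<^sup>2 * exp (real (card S - k) * - u)) has_real_derivative
       - ((fourier_coeff n f S)\<^sup>2 * (real (card S - k) * exp (real (card S - k) * - u)))) (at u)"
      by (auto intro!: derivative_eq_intros)
    then show "((\<lambda>u. (fourier_coeff n f S)\<^sup>2 * exp (- u) ^ (card S - k)) has_real_derivative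
       - ((fourier_coeff n f S)\<^sup>2 * (real (card S - k) * exp (- u) ^ (card S - k)))) (at u)"
      by (simp only: exp_of_nat_mult)
  qed
  have "ln (M v / B) * exp (a * v) \<le> ln (M 0 / B) * exp (a * 0)"
  proof (rule DERIV_nonpos_imp_nonincreasing[OF v])
    fix u :: real assume u: "0 \<le> u"
    have "((\<lambda>u. ln (M u / B) * exp (a * u)) has_real_derivative
        (- E u / M u + a * ln (M u / B)) * exp (a * u)) (at u)"
      using dM[of u] Mpos[of u] B(2)
      by (auto intro!: derivative_eq_intros simp: algebra_simps)
    moreover have "- E u / M u + a * ln (M u / B) \<le> 0"
      using lsi[OF u] Mpos[of u] by (simp add: field_simps)
    ultimately show "\<exists>y. ((\<lambda>u. ln (M u / B) * exp (a * u)) has_real_derivative y) (at u) \<and> y \<le> 0"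
      by (meson exp_ge_zero mult_nonpos_nonneg)
  qed
  then have "ln (M v / B) * exp (a * v) * exp (- (a * v)) \<le> ln (W_ge n k f / B) * exp (- (a * v))"
    by (intro mult_right_mono) (auto simp: M0)
  then have "ln (M v / B) \<le> ln (W_ge n k f / B) * exp (- (a * v))"
    by (simp add: mult.assoc flip: exp_add)
  then have "M v / B \<le> exp (ln (W_ge n k f / B) * exp (- (a * v)))"
    using Mpos[of v] B by (metis divide_pos_pos exp_le_cancel_iff exp_ln)
  also have "\<dots> = W_ge n k f / B * exp (- ln (W_ge n k f / B) * (1 - exp (- (a * v))))"
  proof -
    have "ln (W_ge n k f / B) * exp (- (a * v))
        = ln (W_ge n k f / B) + - ln (W_ge n k f / B) * (1 - exp (- (a * v)))" by (simp add: algebra_simps)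
    then show ?thesis using W B by (simp only: exp_add) simp
  qed
  finally have "M v \<le> W_ge n k f * exp (- ln (W_ge n k f / B) * (1 - exp (- (a * v))))"
    using B by (simp add: divide_le_eq)
  then show ?thesis by (simp add: M a_def)
qed

section \<open>A local Bessel inequality for the derivatives\<close>

text \<open>
  Under \<open>noise_kernel n \<rho> x\<close> the products \<open>x i * y i\<close> are independent signs with mean \<open>\<rho>\<close>, so these
  functions of \<open>y\<close> are orthogonal.
\<close>

definition biased_char :: "real \<Rightarrow> (nat \<Rightarrow> real) \<Rightarrow> nat set \<Rightarrow> (nat \<Rightarrow> real) \<Rightarrow> real" where
  "biased_char \<rho> x J y = (\<Prod>i\<in>J. x i * y i - \<rho>)"

lemma prod_if_subset:
  fixes w :: "nat \<Rightarrow> real"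
  shows "J \<subseteq> {1..n} \<Longrightarrow> (\<Prod>i\<in>{1..n}. if i \<in> J then w i else 1) = (\<Prod>i\<in>J. w i)"
  by (simp add: prod.If_cases Int_absorb1)

lemma noise_kernel_biased_character:
  assumes x: "x \<in> cube n" and J: "J \<subseteq> {1..n}" and S: "S \<subseteq> {1..n}"
  shows "(\<Sum>y\<in>cube n. noise_kernel n \<rho> x y * (character S y * biased_char \<rho> x J y))
    = (if J \<subseteq> S then (1 - \<rho>\<^sup>2) ^ card J * character J x * (\<rho> ^ card (S - J) * character (S - J) x) else 0)"
proof -
  define w where "w i b = (1 + \<rho> * x i * b) / 2 * ((if i \<in> S then b else 1) * (if i \<in> J then x i * b - \<rho> else 1))"
    for i and b :: real
  have "noise_kernel n \<rho> x y * (character S y * biased_char \<rho> x J y) = (\<Prod>i\<in>{1..n}. w i (y i))" for y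
    unfolding noise_kernel_def character_def biased_char_def w_def
    by (subst prod_if_subset[OF S, symmetric], subst prod_if_subset[OF J, symmetric])
      (simp only: prod.distrib)
  then have "(\<Sum>y\<in>cube n. noise_kernel n \<rho> x y * (character S y * biased_char \<rho> x J y))
      = (\<Prod>i\<in>{1..n}. w i (-1) + w i 1)"
    by (simp only: sum_prod_cube)
  also have "\<dots> = (\<Prod>i\<in>{1..n}. (if i \<in> J then (1 - \<rho>\<^sup>2) * x i * (if i \<in> S then 1 else 0) else 1)
      * (if i \<in> S - J then \<rho> * x i else 1))"
  proof (intro prod.cong refl)
    fix i assume "i \<in> {1..n}"
    then have "x i = 1 \<or> x i = - 1" by (rule cube_coord[OF x])
    then show "w i (-1) + w i 1 = (if i \<in> J then (1 - \<rho>\<^sup>2) * x i * (if i \<in> S then 1 else 0) else 1)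
      * (if i \<in> S - J then \<rho> * x i else 1)"
      by (auto simp: w_def field_simps power2_eq_square)
  qed
  also have "\<dots> = (\<Prod>i\<in>{1..n}. if i \<in> J then (1 - \<rho>\<^sup>2) * x i * (if i \<in> S then 1 else 0) else 1)
      * (\<Prod>i\<in>{1..n}. if i \<in> S - J then \<rho> * x i else 1)"
    by (rule prod.distrib)
  also have "\<dots> = (\<Prod>i\<in>J. (1 - \<rho>\<^sup>2) * x i * (if i \<in> S then 1 else 0)) * (\<Prod>i\<in>S - J. \<rho> * x i)"
    using S by (subst prod_if_subset[OF J], subst prod_if_subset) auto
  also have "\<dots> = (if J \<subseteq> S then (1 - \<rho>\<^sup>2) ^ card J * character J x * (\<rho> ^ card (S - J) * character (S - J) x) else 0)"
  proof (cases "J \<subseteq> S")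
    case True
    then have "(\<Prod>i\<in>J. (1 - \<rho>\<^sup>2) * x i * (if i \<in> S then 1 else 0)) = (\<Prod>i\<in>J. (1 - \<rho>\<^sup>2) * x i)"
      by (intro prod.cong) auto
    with True show ?thesis by (simp add: prod.distrib character_def)
  next
    case False
    then obtain i where "i \<in> J" "i \<notin> S" by blast
    moreover have "finite J" using J finite_subset by blast
    ultimately show ?thesis using False by (auto intro!: prod_zero)
  qed
  finally show ?thesis .
qed

lemma biased_char_orthogonal:
  assumes x: "x \<in> cube n" and J: "J \<subseteq> {1..n}" and J': "J' \<subseteq> {1..n}"
  shows "(\<Sum>y\<in>cube n. noise_kernel n \<rho> x y * (biased_char \<rho> x J y * biased_char \<rho> x J' y))
    = (if J = J' then (1 - \<rho>\<^sup>2) ^ card J else 0)"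
proof -
  define w where "w i b = (1 + \<rho> * x i * b) / 2 *
      ((if i \<in> J then x i * b - \<rho> else 1) * (if i \<in> J' then x i * b - \<rho> else 1))" for i and b :: real
  have "noise_kernel n \<rho> x y * (biased_char \<rho> x J y * biased_char \<rho> x J' y) = (\<Prod>i\<in>{1..n}. w i (y i))" for y
    unfolding noise_kernel_def biased_char_def w_def
    by (subst prod_if_subset[OF J, symmetric], subst prod_if_subset[OF J', symmetric])
      (simp only: prod.distrib)
  then have "(\<Sum>y\<in>cube n. noise_kernel n \<rho> x y * (biased_char \<rho> x J y * biased_char \<rho> x J' y))
      = (\<Prod>i\<in>{1..n}. w i (-1) + w i 1)"
    by (simp only: sum_prod_cube)
  also have "\<dots> = (\<Prod>i\<in>{1..n}. if i \<in> J \<and> i \<in> J' then 1 - \<rho>\<^sup>2 else if i \<in> J \<or> i \<in> J' then 0 else 1)"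
  proof (intro prod.cong refl)
    fix i assume "i \<in> {1..n}"
    then have "x i = 1 \<or> x i = - 1" by (rule cube_coord[OF x])
    then show "w i (-1) + w i 1 = (if i \<in> J \<and> i \<in> J' then 1 - \<rho>\<^sup>2 else if i \<in> J \<or> i \<in> J' then 0 else 1)"
      by (auto simp: w_def field_simps power2_eq_square)
  qed
  also have "\<dots> = (if J = J' then (1 - \<rho>\<^sup>2) ^ card J else 0)"
  proof (cases "J = J'")
    case True
    then show ?thesis using prod_if_subset[OF J, of "\<lambda>i. 1 - \<rho>\<^sup>2"] by (simp cong: if_cong)
  next
    case False
    then obtain i where "i \<in> {1..n}" "(i \<in> J) \<noteq> (i \<in> J')" using J J' by blast
    then show ?thesis using False by (auto intro!: prod_zero)
  qed
  finally show ?thesis .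
qed

text \<open>
  The coefficients of \<open>f\<close> in the biased orthogonal system at \<open>x\<close> are, up to sign and scaling, the values
  at \<open>x\<close> of the damped derivatives.
\<close>

lemma noise_derivative_as_coefficient:
  assumes x: "x \<in> cube n" and J: "J \<subseteq> {1..n}"
  shows "(\<Sum>y\<in>cube n. noise_kernel n \<rho> x y * (f y * biased_char \<rho> x J y))
    = (1 - \<rho>\<^sup>2) ^ card J * character J x * noise n \<rho> (D_set J f) x"
proof -
  have fin: "finite J" using J finite_subset by blast
  have "(\<Sum>y\<in>cube n. noise_kernel n \<rho> x y * (f y * biased_char \<rho> x J y))
      = (\<Sum>y\<in>cube n. \<Sum>S\<in>Pow {1..n}. fourier_coeff n f S * (noise_kernel n \<rho> x y * (character S y * biased_char \<rho> x J y)))"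
  proof (intro sum.cong refl)
    fix y assume y: "y \<in> cube n"
    show "noise_kernel n \<rho> x y * (f y * biased_char \<rho> x J y)
      = (\<Sum>S\<in>Pow {1..n}. fourier_coeff n f S * (noise_kernel n \<rho> x y * (character S y * biased_char \<rho> x J y)))"
      unfolding fourier_expansion[OF y, of f] sum_distrib_left sum_distrib_right
      by (intro sum.cong refl) (simp add: mult_ac)
  qed
  also have "\<dots> = (\<Sum>S\<in>Pow {1..n}. fourier_coeff n f S *
      (\<Sum>y\<in>cube n. noise_kernel n \<rho> x y * (character S y * biased_char \<rho> x J y)))"
    by (subst sum.swap) (simp only: sum_distrib_left)
  also have "\<dots> = (\<Sum>S\<in>Pow {1..n}. fourier_coeff n f S *
      (if J \<subseteq> S then (1 - \<rho>\<^sup>2) ^ card J * character J x * (\<rho> ^ card (S - J) * character (S - J) x) else 0))"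
    by (intro sum.cong refl) (simp add: noise_kernel_biased_character[OF x J] del: One_nat_def)
  also have "\<dots> = (\<Sum>S\<in>{S. S \<subseteq> {1..n} \<and> J \<subseteq> S}. (1 - \<rho>\<^sup>2) ^ card J * character J x *
      (\<rho> ^ card (S - J) * fourier_coeff n f S * character (S - J) x))"
    by (intro sum.mono_neutral_cong_right) auto
  also have "\<dots> = (\<Sum>T\<in>{T. T \<subseteq> {1..n} \<and> T \<inter> J = {}}. (1 - \<rho>\<^sup>2) ^ card J * character J x *
      (\<rho> ^ card T * fourier_coeff n f (T \<union> J) * character T x))"
    using J by (intro sum.reindex_bij_witness[of _ "\<lambda>T. T \<union> J" "\<lambda>S. S - J"]) (auto simp: Un_absorb2)
  also have "\<dots> = (\<Sum>T\<in>Pow {1..n}. (1 - \<rho>\<^sup>2) ^ card J * character J x *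
      (\<rho> ^ card T * fourier_coeff n (D_set J f) T * character T x))"
    using J by (intro sum.mono_neutral_cong_left) (auto simp: fourier_coeff_D_set simp del: One_nat_def)
  also have "\<dots> = (1 - \<rho>\<^sup>2) ^ card J * character J x * noise n \<rho> (D_set J f) x"
    by (simp add: noise_def sum_distrib_left)
  finally show ?thesis .
qed

text \<open>
  Bessel's inequality for \<open>f\<close> and the biased characters of order \<open>k\<close> in the measure
  \<open>noise_kernel n \<rho> x\<close>.
\<close>

lemma local_bessel:
  assumes x: "x \<in> cube n" and \<rho>: "0 \<le> \<rho>" "\<rho> \<le> 1"
  shows "(1 - \<rho>\<^sup>2) ^ k * (\<Sum>J\<in>level n k. (noise n \<rho> (D_set J f) x)\<^sup>2) \<le> noise n \<rho> (\<lambda>y. (f y)\<^sup>2) x"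
proof -
  define K where "K = noise_kernel n \<rho> x"
  define c where "c J = character J x * noise n \<rho> (D_set J f) x" for J
  define e where "e = biased_char \<rho> x"
  define N where "N = (1 - \<rho>\<^sup>2) ^ k"
  have K0: "K y \<ge> 0" if "y \<in> cube n" for y
    unfolding K_def using x that \<rho> by (intro noise_kernel_nonneg)
  have lv: "J \<subseteq> {1..n}" "card J = k" if "J \<in> level n k" for J using that by (auto simp: level_def)
  have fe: "(\<Sum>y\<in>cube n. K y * (f y * e J y)) = N * c J" if "J \<in> level n k" for J
    using noise_derivative_as_coefficient[OF x lv(1)[OF that]] lv(2)[OF that]
    by (simp add: K_def e_def N_def c_def)
  have ee: "(\<Sum>y\<in>cube n. K y * (e J y * e J' y)) = (if J = J' then N else 0)"
    if "J \<in> level n k" "J' \<in> level n k" for J J'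
    using biased_char_orthogonal[OF x lv(1)[OF that(1)] lv(1)[OF that(2)]] lv(2)[OF that(1)]
    by (auto simp: K_def e_def N_def)
  have c2: "(c J)\<^sup>2 = (noise n \<rho> (D_set J f) x)\<^sup>2" if "J \<in> level n k" for J
  proof -
    have "(character J x)\<^sup>2 = (\<Prod>i\<in>J. (x i)\<^sup>2)" by (simp add: character_def prod_power_distrib)
    also have "\<dots> = 1" using cube_coord[OF x] lv(1)[OF that] by (intro prod.neutral) force
    finally show ?thesis by (simp add: c_def power_mult_distrib)
  qed
  define h where "h y = (\<Sum>J\<in>level n k. c J * e J y)" for y
  have fh: "(\<Sum>y\<in>cube n. K y * (f y * h y)) = N * (\<Sum>J\<in>level n k. (c J)\<^sup>2)"
  proof -
    have "(\<Sum>y\<in>cube n. K y * (f y * h y)) = (\<Sum>y\<in>cube n. \<Sum>J\<in>level n k. c J * (K y * (f y * e J y)))"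
      unfolding h_def sum_distrib_left by (intro sum.cong refl) (simp add: mult_ac)
    also have "\<dots> = (\<Sum>J\<in>level n k. c J * (\<Sum>y\<in>cube n. K y * (f y * e J y)))"
      by (subst sum.swap) (simp only: sum_distrib_left)
    also have "\<dots> = (\<Sum>J\<in>level n k. c J * (N * c J))" using fe by simp
    finally show ?thesis by (simp add: sum_distrib_left power2_eq_square mult_ac)
  qed
  have hh: "(\<Sum>y\<in>cube n. K y * (h y * h y)) = N * (\<Sum>J\<in>level n k. (c J)\<^sup>2)"
  proof -
    have "(\<Sum>y\<in>cube n. K y * (h y * h y))
        = (\<Sum>y\<in>cube n. \<Sum>J\<in>level n k. \<Sum>J'\<in>level n k. c J * c J' * (K y * (e J y * e J' y)))"
      unfolding h_def sum_product unfolding sum_distrib_left by (intro sum.cong refl) (simp add: mult_ac)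
    also have "\<dots> = (\<Sum>J\<in>level n k. \<Sum>J'\<in>level n k. \<Sum>y\<in>cube n. c J * c J' * (K y * (e J y * e J' y)))"
      by (subst sum.swap, intro sum.cong refl, rule sum.swap)
    also have "\<dots> = (\<Sum>J\<in>level n k. \<Sum>J'\<in>level n k. if J = J' then c J * c J' * N else 0)"
      unfolding sum_distrib_left[symmetric] by (intro sum.cong refl) (simp add: ee)
    finally show ?thesis by (simp add: sum_distrib_left power2_eq_square mult_ac)
  qed
  have "0 \<le> (\<Sum>y\<in>cube n. K y * (f y - h y)\<^sup>2)"
    by (intro sum_nonneg mult_nonneg_nonneg K0) auto
  also have "\<dots> = (\<Sum>y\<in>cube n. K y * (f y)\<^sup>2) - 2 * (\<Sum>y\<in>cube n. K y * (f y * h y)) + (\<Sum>y\<in>cube n. K y * (h y * h y))"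
    unfolding sum_distrib_left sum_subtractf[symmetric] sum.distrib[symmetric]
    by (intro sum.cong refl) (simp add: power2_eq_square algebra_simps)
  finally have "N * (\<Sum>J\<in>level n k. (c J)\<^sup>2) \<le> (\<Sum>y\<in>cube n. K y * (f y)\<^sup>2)"
    unfolding fh hh by simp
  then show ?thesis
    using c2 by (simp add: N_def K_def noise_eq_kernel)
qed

section \<open>Bounded functions and lower moments of the gradient\<close>

lemma young_powr:
  fixes p a b :: real
  assumes "1 \<le> p" "0 \<le> a" "0 \<le> b"
  shows "a * b powr (p - 1) \<le> a powr p / p + (1 - 1 / p) * b powr p"
proof (cases "p = 1")
  case True
  then show ?thesis using assms by (cases "b = 0") auto
next
  case False
  then have p: "p > 1" using assms by simp
  have "a * b powr (p - 1) \<le> a powr p / p + (b powr (p - 1)) powr (p / (p - 1)) / (p / (p - 1))"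
    using p assms by (intro Youngs_inequality) (auto simp: field_simps)
  also have "(b powr (p - 1)) powr (p / (p - 1)) = b powr p"
    using p by (simp add: powr_powr)
  also have "b powr p / (p / (p - 1)) = (1 - 1 / p) * b powr p"
    using p by (simp add: field_simps)
  finally show ?thesis .
qed

text \<open>
  The norm of an average of vectors is at most the average of their norms; the proof tests against the
  vector \<open>v\<close> itself.
\<close>

lemma noise_gradient_le:
  assumes x: "x \<in> cube n" and \<rho>: "0 \<le> \<rho>" "\<rho> \<le> 1"
  shows "sqrt (\<Sum>J\<in>level n k. (noise n \<rho> (D_set J f) x)\<^sup>2) \<le> noise n \<rho> (nabla_abs n k f) x"
proof -
  define v where "v J = noise n \<rho> (D_set J f) x" for J
  define V where "V = sqrt (\<Sum>J\<in>level n k. (v J)\<^sup>2)"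
  have V0: "V \<ge> 0" by (simp add: V_def sum_nonneg)
  have V2: "V * V = (\<Sum>J\<in>level n k. (v J)\<^sup>2)"
    by (simp add: V_def sum_nonneg)
  have "V * V = (\<Sum>J\<in>level n k. \<Sum>y\<in>cube n. noise_kernel n \<rho> x y * (v J * D_set J f y))"
    unfolding V2 power2_eq_square
    by (subst (2) v_def) (simp add: noise_eq_kernel sum_distrib_left mult_ac)
  also have "\<dots> = (\<Sum>y\<in>cube n. noise_kernel n \<rho> x y * (\<Sum>J\<in>level n k. v J * D_set J f y))"
    by (subst sum.swap) (simp only: sum_distrib_left)
  also have "\<dots> \<le> (\<Sum>y\<in>cube n. noise_kernel n \<rho> x y * (V * nabla_abs n k f y))"
  proof (intro sum_mono mult_left_mono noise_kernel_nonneg x \<rho>)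
    fix y
    have "(\<Sum>J\<in>level n k. v J * D_set J f y)\<^sup>2
      \<le> (\<Sum>J\<in>level n k. (v J)\<^sup>2) * (\<Sum>J\<in>level n k. (D_set J f y)\<^sup>2)"
      by (rule Cauchy_Schwarz_ineq_sum)
    also have "\<dots> = (V * nabla_abs n k f y)\<^sup>2"
      by (simp add: power_mult_distrib nabla_abs_sq V_def sum_nonneg)
    finally show "(\<Sum>J\<in>level n k. v J * D_set J f y) \<le> V * nabla_abs n k f y"
      by (rule power2_le_imp_le) (simp add: V0)
  qed
  also have "\<dots> = V * noise n \<rho> (nabla_abs n k f) x"
    by (simp add: noise_eq_kernel sum_distrib_left mult_ac)
  finally have le: "V * V \<le> V * noise n \<rho> (nabla_abs n k f) x" .
  have "0 \<le> noise n \<rho> (nabla_abs n k f) x"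
    unfolding noise_eq_kernel by (intro sum_nonneg mult_nonneg_nonneg noise_kernel_nonneg x \<rho>) auto
  with le V0 have "V \<le> noise n \<rho> (nabla_abs n k f) x"
    by (cases "V = 0") auto
  then show ?thesis by (simp add: V_def v_def)
qed

lemma Linf_normD: "x \<in> cube n \<Longrightarrow> \<bar>f x\<bar> \<le> Linf_norm n f"
  unfolding Linf_norm_def by (intro Max_ge) auto

text \<open>
  The left-hand side is the inner product of the gradient with its damped version. Pointwise, the
  length \<open>V\<close> of the latter is bounded by \<open>N = (2 * u) powr (- k / 2)\<close>, by the local Bessel inequality and
  \<open>\<bar>f\<bar> \<le> 1\<close>, and by the damped length \<open>noise n \<rho> G\<close> of the gradient. Interpolating with exponents
  \<open>2 - p\<close> and \<open>p - 1\<close> leaves the mean of \<open>G * (noise n \<rho> G) powr (p - 1)\<close>, which Young's inequality and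
  the contraction of the noise bound by the \<open>p\<close>-th moment of \<open>G\<close>.
\<close>

lemma damped_weight_le:
  assumes f: "Linf_norm n f \<le> 1" and u: "0 < u" and p: "1 \<le> p" "p < (2::real)"
  shows "(\<Sum>S\<in>Pow {1..n}. real (card S choose k) * (fourier_coeff n f S)\<^sup>2 * exp (- u) ^ card S)
    \<le> (2 * u) powr (- (real k * (2 - p) / 2)) * cube_expectation n (\<lambda>x. nabla_abs n k f x powr p)"
proof -
  define \<rho> where "\<rho> = exp (- u)"
  have \<rho>: "0 < \<rho>" "\<rho> < 1" using u by (auto simp: \<rho>_def)
  define G where "G = nabla_abs n k f"
  define v where "v J = noise n \<rho> (D_set J f)" for J
  define V where "V x = \<rho> ^ k * sqrt (\<Sum>J\<in>level n k. (v J x)\<^sup>2)" for x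
  define N where "N = (2 * u) powr (- (real k / 2))"
  have G0: "G x \<ge> 0" for x by (simp add: G_def)
  have V0: "V x \<ge> 0" for x using \<rho> by (simp add: V_def sum_nonneg)
  have PG0: "noise n \<rho> G x \<ge> 0" if "x \<in> cube n" for x
    unfolding noise_eq_kernel using that \<rho> by (intro sum_nonneg mult_nonneg_nonneg noise_kernel_nonneg G0) auto
  have VN: "V x \<le> N" if x: "x \<in> cube n" for x
  proof -
    have "(f y)\<^sup>2 \<le> 1" if "y \<in> cube n" for y
      using Linf_normD[OF that, of f] f by (simp add: abs_square_le_1)
    then have "noise n \<rho> (\<lambda>y. (f y)\<^sup>2) x \<le> noise n \<rho> (\<lambda>y. 1) x"
      using x \<rho> by (intro noise_mono) auto
    also have "\<dots> = 1" using sum_noise_kernel by (simp add: noise_eq_kernel)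
    finally have le1: "(1 - \<rho>\<^sup>2) ^ k * (\<Sum>J\<in>level n k. (v J x)\<^sup>2) \<le> 1"
      using local_bessel[OF x, where \<rho> = \<rho> and k = k and f = f] \<rho> by (simp add: v_def)
    have r: "(\<rho>\<^sup>2) * (2 * u) \<le> 1 - \<rho>\<^sup>2"
    proof -
      have "\<rho>\<^sup>2 * (1 + 2 * u) \<le> \<rho>\<^sup>2 * exp (2 * u)"
        by (intro mult_left_mono exp_ge_add_one_self) auto
      also have "\<dots> = 1" by (simp add: \<rho>_def power2_eq_square flip: exp_add)
      finally show ?thesis by (simp add: algebra_simps)
    qed
    have "(V x)\<^sup>2 * (2 * u) ^ k = ((\<rho>\<^sup>2) * (2 * u)) ^ k * (\<Sum>J\<in>level n k. (v J x)\<^sup>2)"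
      by (simp add: V_def power_mult_distrib sum_nonneg mult_ac flip: power_mult)
    also have "\<dots> \<le> (1 - \<rho>\<^sup>2) ^ k * (\<Sum>J\<in>level n k. (v J x)\<^sup>2)"
      using r u \<rho> by (intro mult_right_mono power_mono sum_nonneg) auto
    finally have "(V x)\<^sup>2 * (2 * u) ^ k \<le> 1" using le1 by simp
    then have "(V x)\<^sup>2 \<le> 1 / (2 * u) ^ k" using u by (simp add: field_simps)
    also have "\<dots> = N\<^sup>2"
    proof -
      have "N\<^sup>2 = (2 * u) powr (- (real k))"
        using u by (simp add: N_def power2_eq_square flip: powr_add)
      then show ?thesis using u by (simp add: powr_minus powr_realpow field_simps)
    qed
    finally show ?thesis by (rule power2_le_imp_le) (simp add: N_def)
  qed
  have VG: "V x \<le> noise n \<rho> G x" if x: "x \<in> cube n" for x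
  proof -
    have "V x \<le> 1 * sqrt (\<Sum>J\<in>level n k. (v J x)\<^sup>2)"
      unfolding V_def using \<rho> by (intro mult_right_mono power_le_one) (auto simp: sum_nonneg)
    also have "\<dots> \<le> noise n \<rho> G x"
      using noise_gradient_le[OF x, where \<rho> = \<rho> and k = k and f = f] \<rho> by (simp add: v_def G_def)
    finally show ?thesis .
  qed
  have interp: "V x \<le> N powr (2 - p) * noise n \<rho> G x powr (p - 1)" if x: "x \<in> cube n" for x
  proof (cases "V x = 0")
    case False
    then have "V x = V x powr (2 - p) * V x powr (p - 1)"
      using V0[of x] by (simp flip: powr_add)
    also have "\<dots> \<le> N powr (2 - p) * noise n \<rho> G x powr (p - 1)"
      using VN[OF x] VG[OF x] V0[of x] p by (intro mult_mono powr_mono2) auto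
    finally show ?thesis .
  qed simp
  have point: "(\<Sum>J\<in>level n k. D_set J f x * (\<rho> ^ k * v J x)) \<le> G x * V x" for x
  proof -
    have "(\<Sum>J\<in>level n k. D_set J f x * (\<rho> ^ k * v J x))\<^sup>2
      \<le> (\<Sum>J\<in>level n k. (D_set J f x)\<^sup>2) * (\<Sum>J\<in>level n k. (\<rho> ^ k * v J x)\<^sup>2)"
      by (rule Cauchy_Schwarz_ineq_sum)
    also have "(\<Sum>J\<in>level n k. (\<rho> ^ k * v J x)\<^sup>2) = (V x)\<^sup>2"
      by (simp add: V_def power_mult_distrib sum_distrib_left sum_nonneg)
    also have "(\<Sum>J\<in>level n k. (D_set J f x)\<^sup>2) * (V x)\<^sup>2 = (G x * V x)\<^sup>2"
      by (simp add: G_def nabla_abs_sq power_mult_distrib)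
    finally show ?thesis by (rule power2_le_imp_le) (simp add: G0 V0)
  qed
  have Np: "N powr (2 - p) = (2 * u) powr (- (real k * (2 - p) / 2))"
    by (simp add: N_def powr_powr)
  have "(\<Sum>S\<in>Pow {1..n}. real (card S choose k) * (fourier_coeff n f S)\<^sup>2 * \<rho> ^ card S)
      = \<rho> ^ k * (\<Sum>S\<in>Pow {1..n}. real (card S choose k) * (fourier_coeff n f S)\<^sup>2 * \<rho> ^ (card S - k))"
    unfolding sum_distrib_left
  proof (intro sum.cong refl)
    fix S :: "nat set"
    have "k \<le> card S \<or> card S choose k = 0" by (metis binomial_eq_0 not_le)
    then show "real (card S choose k) * (fourier_coeff n f S)\<^sup>2 * \<rho> ^ card S
      = \<rho> ^ k * (real (card S choose k) * (fourier_coeff n f S)\<^sup>2 * \<rho> ^ (card S - k))"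
      by (auto simp: mult_ac simp flip: power_add)
  qed
  also have "\<dots> = \<rho> ^ k * (\<Sum>J\<in>level n k. \<Sum>T\<in>Pow {1..n}. (fourier_coeff n (D_set J f) T)\<^sup>2 * \<rho> ^ card T)"
    by (subst sum_level_fourier) (rule refl)
  also have "\<dots> = (\<Sum>J\<in>level n k. \<rho> ^ k * cube_expectation n (\<lambda>x. D_set J f x * v J x))"
    unfolding sum_distrib_left parseval_inner v_def
    by (intro sum.cong refl) (simp add: fourier_coeff_noise power2_eq_square)
  also have "\<dots> = cube_expectation n (\<lambda>x. \<Sum>J\<in>level n k. D_set J f x * (\<rho> ^ k * v J x))"
    unfolding cube_expectation_sum cube_expectation_cmult[symmetric] by (simp add: mult_ac)
  also have "\<dots> \<le> cube_expectation n (\<lambda>x. N powr (2 - p) *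
      (1 / p * G x powr p + (1 - 1 / p) * noise n \<rho> G x powr p))"
  proof (intro cube_expectation_mono)
    fix x assume x: "x \<in> cube n"
    have "G x * V x \<le> G x * (N powr (2 - p) * noise n \<rho> G x powr (p - 1))"
      by (intro mult_left_mono interp x G0)
    also have "\<dots> = N powr (2 - p) * (G x * noise n \<rho> G x powr (p - 1))" by simp
    also have "\<dots> \<le> N powr (2 - p) * (1 / p * G x powr p + (1 - 1 / p) * noise n \<rho> G x powr p)"
      using young_powr[OF p(1) G0[of x] PG0[OF x]] by (intro mult_left_mono) auto
    finally show "(\<Sum>J\<in>level n k. D_set J f x * (\<rho> ^ k * v J x))
      \<le> N powr (2 - p) * (1 / p * G x powr p + (1 - 1 / p) * noise n \<rho> G x powr p)"
      using point[of x] by linarith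
  qed
  also have "\<dots> = N powr (2 - p) * (1 / p * cube_expectation n (\<lambda>x. G x powr p)
      + (1 - 1 / p) * cube_expectation n (\<lambda>x. noise n \<rho> G x powr p))"
    by (simp only: cube_expectation_cmult cube_expectation_add)
  also have "\<dots> \<le> N powr (2 - p) * (1 / p * cube_expectation n (\<lambda>x. G x powr p)
      + (1 - 1 / p) * cube_expectation n (\<lambda>x. G x powr p))"
    using \<rho> p by (intro mult_left_mono add_left_mono expectation_noise_powr_le G0) auto
  also have "\<dots> = N powr (2 - p) * cube_expectation n (\<lambda>x. G x powr p)"
    by (simp add: algebra_simps)
  finally show ?thesis by (simp add: \<rho>_def G_def Np)
qed

text \<open>
  The tangent to the \<open>k\<close>-th power at \<open>m\<close>.
\<close>

lemma power_tangent:
  fixes m y :: real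
  assumes "0 < m" "0 \<le> y" "1 \<le> k"
  shows "real k * m ^ (k - 1) * y - real (k - 1) * m ^ k \<le> y ^ k"
proof -
  have "1 + real k * (y / m - 1) \<le> (1 + (y / m - 1)) ^ k"
    using assms by (intro Bernoulli_inequality) (auto simp: divide_nonneg_pos)
  then have "m ^ k * (1 + real k * (y / m - 1)) \<le> m ^ k * (y / m) ^ k"
    using assms by (intro mult_left_mono) auto
  also have "\<dots> = y ^ k" using assms by (simp add: power_divide)
  finally have "m ^ k * (1 + real k * (y / m - 1)) \<le> y ^ k" .
  moreover have "m ^ k * (1 + real k * (y / m - 1)) = real k * m ^ (k - 1) * y - real (k - 1) * m ^ k"
    using assms by (cases k) (auto simp: field_simps)
  ultimately show ?thesis by simp
qed

text \<open>
  Let \<open>w u = (2 * u) powr (p / 2 - 1)\<close>, so that \<open>damped_weight_le\<close> bounds a sum by \<open>w u ^ k\<close> times the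
  moment \<open>K\<close>, and let \<open>I\<close> be the antiderivative of \<open>w\<close> vanishing at 0. As
  \<open>card S choose k \<ge> (card S / k) ^ k\<close>, the bound controls the weighted sum of the \<open>k\<close>-th powers of the
  derivatives of \<open>1 - exp (- u * card S / k)\<close>. Integrating the derivatives themselves is a matter of
  Hoelder's inequality with weight \<open>w\<close>. It is replaced here by its linearisation, the tangent to the
  \<open>k\<close>-th power at \<open>m = \<theta> / I t\<close>, which makes the difference \<open>H\<close> of the two sides monotone.
\<close>

lemma high_degree_mass_le:
  assumes f: "Linf_norm n f \<le> 1" and t: "0 < t" and p: "1 \<le> p" "p < (2::real)" and k: "1 \<le> k"
    and W: "0 < W_ge n k f"
  defines "U \<equiv> {S. S \<subseteq> {1..n} \<and> k \<le> card S}"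
  defines "\<theta> \<equiv> (\<Sum>S\<in>U. (fourier_coeff n f S)\<^sup>2 * (1 - exp (- (t * real (card S) / real k)))) / W_ge n k f"
  shows "W_ge n k f * \<theta> ^ k
    \<le> cube_expectation n (\<lambda>x. nabla_abs n k f x powr p) * ((2 * t) powr (p / 2) / p) ^ k"
proof -
  define W where "W = W_ge n k f"
  define c where "c S = (fourier_coeff n f S)\<^sup>2" for S
  define K where "K = cube_expectation n (\<lambda>x. nabla_abs n k f x powr p)"
  define w where "w u = (2 * u) powr (p / 2 - 1)" for u
  define I where "I u = (2 * u) powr (p / 2) / p" for u
  define d where "d S = real (card S) / real k" for S :: "nat set"
  have finU: "finite U" by (rule finite_subset[of _ "Pow {1..n}"]) (auto simp: U_def)
  have Wc: "W = (\<Sum>S\<in>U. c S)" by (simp add: W_def W_ge_fourier U_def c_def)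
  have W0: "W > 0" using W by (simp add: W_def)
  have \<theta>: "W * \<theta> = (\<Sum>S\<in>U. c S * (1 - exp (- t * d S)))"
    using W0 by (simp add: \<theta>_def W_def c_def d_def)
  have I0: "I t > 0" using t p by (simp add: I_def)
  have \<theta>0: "\<theta> \<ge> 0"
    unfolding \<theta>_def using t W0 by (intro divide_nonneg_pos sum_nonneg) (auto simp: W_def)
  have "W * \<theta> ^ k \<le> K * I t ^ k"
  proof (cases "\<theta> = 0")
    case True
    have "K \<ge> 0" unfolding K_def by (intro cube_expectation_nonneg) simp
    then show ?thesis using True k I0 by (simp add: zero_power)
  next
    case False
    \<comment> \<open>the mean slope: the average of \<open>d S * exp (- u * d S) / w u\<close> over \<open>S\<close> and, with density \<open>w\<close>, over \<open>u \<le> t\<close>\<close>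
    define m where "m = \<theta> / I t"
    have m: "m > 0" using False \<theta>0 I0 by (simp add: m_def)
    define H where "H u = K * I u - (\<Sum>S\<in>U. c S * (real k * m ^ (k - 1) * (1 - exp (- u * d S)) - real (k - 1) * m ^ k * I u))" for u
    have "H 0 \<le> H t"
    proof (rule DERIV_nonneg_imp_increasing_open[of 0 t H])
      show "0 \<le> t" using t by simp
      show "continuous_on {0..t} H"
      proof -
        have "continuous_on {0..t} I"
          unfolding I_def using p by (intro continuous_on_divide continuous_on_powr' continuous_intros) auto
        then show ?thesis unfolding H_def by (intro continuous_intros)
      qed
      fix u :: real assume u: "0 < u" "u < t"
      have w0: "w u > 0" using u by (simp add: w_def)
      have dI: "(I has_real_derivative w u) (at u)"
      proof -
        have "((\<lambda>u. (2 * u) powr (p / 2) / p) has_real_derivative (p / 2 * (2 * u) powr (p / 2 - 1) * 2) / p) (at u)"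
          using u by (intro DERIV_cdivide DERIV_fun_powr[where g = "\<lambda>u. 2 * u" and m = 2, simplified])
            (auto intro!: derivative_eq_intros)
        then show ?thesis using p by (simp add: I_def[abs_def] w_def)
      qed
      have "(H has_real_derivative K * w u -
          (\<Sum>S\<in>U. c S * (real k * m ^ (k - 1) * (d S * exp (- u * d S)) - real (k - 1) * m ^ k * w u))) (at u)"
      proof -
        have "((\<lambda>u. 1 - exp (- u * d S)) has_real_derivative d S * exp (- u * d S)) (at u)" for S
          by (auto intro!: derivative_eq_intros)
        then show ?thesis
          unfolding H_def by (intro DERIV_diff DERIV_cmult DERIV_sum dI)
      qed
      moreover have "(\<Sum>S\<in>U. c S * (real k * m ^ (k - 1) * (d S * exp (- u * d S)) - real (k - 1) * m ^ k * w u))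
          \<le> K * w u"
      proof -
        have "(\<Sum>S\<in>U. c S * (real k * m ^ (k - 1) * (d S * exp (- u * d S)) - real (k - 1) * m ^ k * w u))
            = w u * (\<Sum>S\<in>U. c S * (real k * m ^ (k - 1) * (d S * exp (- u * d S) / w u) - real (k - 1) * m ^ k))"
          unfolding sum_distrib_left using w0 by (intro sum.cong refl) (simp add: field_simps)
        also have "\<dots> \<le> w u * (\<Sum>S\<in>U. c S * (d S * exp (- u * d S) / w u) ^ k)"
        proof (intro mult_left_mono sum_mono)
          fix S
          show "real k * m ^ (k - 1) * (d S * exp (- u * d S) / w u) - real (k - 1) * m ^ k
              \<le> (d S * exp (- u * d S) / w u) ^ k"
            using w0 m k by (intro power_tangent) (auto simp: d_def)
        qed (use w0 in \<open>auto simp: c_def\<close>)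
        also have "\<dots> = w u * ((\<Sum>S\<in>U. c S * d S ^ k * exp (- u) ^ card S) / w u ^ k)"
        proof -
          have "exp (- u * d S) ^ k = exp (- u) ^ card S" for S
            using k by (simp add: d_def mult.commute flip: exp_of_nat_mult)
          then show ?thesis
            by (simp add: power_divide power_mult_distrib sum_divide_distrib mult_ac)
        qed
        also have "\<dots> \<le> w u * ((w u ^ k * K) / w u ^ k)"
        proof (intro mult_left_mono divide_right_mono)
          have "(\<Sum>S\<in>U. c S * d S ^ k * exp (- u) ^ card S)
              \<le> (\<Sum>S\<in>U. real (card S choose k) * c S * exp (- u) ^ card S)"
          proof (intro sum_mono mult_right_mono)
            fix S assume "S \<in> U"
            then have "d S ^ k \<le> real (card S choose k)"
              unfolding d_def by (intro binomial_ge_n_over_k_pow_k) (simp add: U_def)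
            then show "c S * d S ^ k \<le> real (card S choose k) * c S"
              unfolding c_def by (subst mult.commute) (intro mult_right_mono, auto)
          qed simp
          also have "\<dots> = (\<Sum>S\<in>Pow {1..n}. real (card S choose k) * c S * exp (- u) ^ card S)"
            by (intro sum.mono_neutral_left) (auto simp: U_def not_le binomial_eq_0)
          also have "\<dots> \<le> (2 * u) powr (- (real k * (2 - p) / 2)) * K"
            unfolding K_def c_def by (rule damped_weight_le[OF f u(1) p])
          also have "(2 * u) powr (- (real k * (2 - p) / 2)) = w u ^ k"
            unfolding w_def using u by (subst powr_realpow[symmetric]) (auto simp: powr_powr algebra_simps diff_divide_distrib)
          finally show "(\<Sum>S\<in>U. c S * d S ^ k * exp (- u) ^ card S) \<le> w u ^ k * K" .
        qed (use w0 in auto)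
        also have "\<dots> = K * w u" using w0 by simp
        finally show ?thesis .
      qed
      ultimately show "\<exists>y. (H has_real_derivative y) (at u) \<and> y \<ge> 0"
        by (intro exI conjI) auto
    qed
    moreover have "H 0 = 0" using p by (simp add: H_def I_def)
    moreover have "(\<Sum>S\<in>U. c S * (real k * m ^ (k - 1) * (1 - exp (- t * d S)) - real (k - 1) * m ^ k * I t))
        = real k * m ^ (k - 1) * (W * \<theta>) - real (k - 1) * m ^ k * I t * W"
      unfolding \<theta> unfolding Wc sum_distrib_left sum_subtractf[symmetric]
      by (intro sum.cong refl) (simp add: algebra_simps)
    ultimately have "real k * m ^ (k - 1) * (W * \<theta>) - real (k - 1) * m ^ k * I t * W \<le> K * I t"
      unfolding H_def by linarith
    moreover have "real k * m ^ (k - 1) * (W * \<theta>) - real (k - 1) * m ^ k * I t * W = m ^ k * W * I t"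
    proof -
      have "m ^ k = m ^ (k - 1) * m" and kk: "real k = real (k - 1) + 1" using k by (cases k; simp)+
      then have "m ^ k * I t = m ^ (k - 1) * \<theta>" using I0 by (simp add: m_def)
      then have "real k * m ^ (k - 1) * (W * \<theta>) = real k * (m ^ k * I t) * W" by (simp only: mult_ac)
      then show ?thesis unfolding kk by (simp add: algebra_simps)
    qed
    ultimately have "m ^ k * W * I t \<le> K * I t" by simp
    then have "m ^ k * W \<le> K" using I0 by simp
    then have "m ^ k * W * I t ^ k \<le> K * I t ^ k" using I0 by (intro mult_right_mono) auto
    moreover have "m ^ k * W * I t ^ k = W * \<theta> ^ k"
      using I0 by (simp add: m_def power_divide)
    ultimately show ?thesis by simp
  qed
  then show ?thesis by (simp add: W_def K_def I_def)
qed

text \<open>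
  The average of \<open>exp (- t * card S / k)\<close> with respect to the Fourier weights is, up to the factor
  \<open>exp (- t)\<close>, the quantity bounded in \<open>spectral_decay\<close> at time \<open>t / k\<close>; concavity of
  \<open>1 - exp (- z)\<close> permits to take the factor \<open>1 / k\<close> out of the exponential.
\<close>

lemma high_degree_mass_ge:
  fixes q :: real
  assumes q: "1 \<le> q" "q < 2" and k: "1 \<le> k" and t: "0 < t" and W: "0 < W_ge n k f"
    and B: "(\<Sum>J\<in>level n k. (Lp_norm n q (D_set J f))\<^sup>2) \<le> B" "0 < B"
  defines "U \<equiv> {S. S \<subseteq> {1..n} \<and> k \<le> card S}"
  shows "1 - exp (- (t + ln_plus (W_ge n k f / B) / real k * (1 - exp (- (q / (2 * (2 - q)) * t)))))
    \<le> (\<Sum>S\<in>U. (fourier_coeff n f S)\<^sup>2 * (1 - exp (- (t * real (card S) / real k)))) / W_ge n k f"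
proof -
  define W where "W = W_ge n k f"
  define a where "a = q / (2 * (2 - q))"
  define L where "L = ln (W / B)"
  have a: "a > 0" using q by (simp add: a_def)
  have W0: "W > 0" using W by (simp add: W_def)
  define c where "c S = (fourier_coeff n f S)\<^sup>2" for S
  have Wc: "W = (\<Sum>S\<in>U. c S)" by (simp add: W_def W_ge_fourier U_def c_def)
  have M: "(\<Sum>S\<in>U. c S * exp (- (t * real (card S) / real k))) = exp (- t) * avg_energy n k k f (exp (- (t / real k)))"
  proof -
    have "exp (- (t * real (card S) / real k)) = exp (- t) * exp (- (t / real k)) ^ (card S - k)" if "S \<in> U" for S
    proof -
      have "- (t * real (card S) / real k) = - t + real (card S - k) * - (t / real k)"
        using that k by (simp add: U_def of_nat_diff field_simps)
      then show ?thesis by (simp only: exp_add exp_of_nat_mult)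
    qed
    then show ?thesis
      unfolding avg_energy_full U_def[symmetric] sum_distrib_left c_def
      by (intro sum.cong refl) simp
  qed
  have "avg_energy n k k f (exp (- (t / real k))) \<le> W * exp (- (ln_plus (W / B) / real k * (1 - exp (- (a * t)))))"
  proof (cases "L \<ge> 0")
    case True
    define r where "r = exp (- (a * t / real k))"
    have "1 + real k * (r - 1) \<le> (1 + (r - 1)) ^ k"
      by (intro Bernoulli_inequality) (simp add: r_def)
    moreover have "r ^ k = exp (- (a * t))"
      using k by (simp add: r_def flip: exp_of_nat_mult)
    ultimately have "1 - exp (- (a * t)) \<le> (1 - r) * real k"
      by (simp add: algebra_simps)
    then have "(1 - exp (- (a * t))) / real k \<le> 1 - r"
      using k by (simp add: pos_divide_le_eq)
    then have "L * ((1 - exp (- (a * t))) / real k) \<le> L * (1 - r)"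
      using True by (intro mult_left_mono)
    moreover have "avg_energy n k k f (exp (- (t / real k))) \<le> W * exp (- L * (1 - r))"
      using spectral_decay[OF q k _ B W, of "t / real k"] t by (simp add: W_def L_def r_def a_def)
    moreover have "exp (- L * (1 - r)) \<le> exp (- (L * ((1 - exp (- (a * t))) / real k)))"
      if "L * ((1 - exp (- (a * t))) / real k) \<le> L * (1 - r)" using that by simp
    ultimately have "avg_energy n k k f (exp (- (t / real k))) \<le> W * exp (- (L * ((1 - exp (- (a * t))) / real k)))"
      using W0 by (meson mult_left_mono order.trans less_imp_le)
    moreover have "ln_plus (W / B) = L" using True by (simp add: ln_plus_def L_def)
    ultimately show ?thesis by simp
  next
    case False
    then have "ln_plus (W / B) = 0" by (simp add: ln_plus_def L_def)
    moreover have "avg_energy n k k f (exp (- (t / real k))) \<le> avg_energy n k k f 1"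
      unfolding avg_energy_full using t by (intro sum_mono mult_left_mono) (auto intro: power_le_one)
    ultimately show ?thesis by (simp add: avg_energy_full_1 W_def)
  qed
  then have "(\<Sum>S\<in>U. c S * exp (- (t * real (card S) / real k)))
      \<le> exp (- t) * (W * exp (- (ln_plus (W / B) / real k * (1 - exp (- (a * t))))))"
    unfolding M by (intro mult_left_mono) auto
  also have "\<dots> = W * exp (- (t + ln_plus (W / B) / real k * (1 - exp (- (a * t)))))"
    by (simp add: exp_add exp_diff exp_minus field_simps)
  finally have "W - W * exp (- (t + ln_plus (W / B) / real k * (1 - exp (- (a * t)))))
      \<le> (\<Sum>S\<in>U. c S * (1 - exp (- (t * real (card S) / real k))))"
    by (simp add: right_diff_distrib sum_subtractf Wc)
  then have "1 - exp (- (t + ln_plus (W / B) / real k * (1 - exp (- (a * t)))))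
      \<le> (\<Sum>S\<in>U. c S * (1 - exp (- (t * real (card S) / real k)))) / W"
    using W0 by (simp add: le_divide_eq algebra_simps)
  then show ?thesis by (simp add: W_def c_def a_def)
qed

lemma gradient_moment_lower_bound:
  fixes p q :: real
  assumes f: "Linf_norm n f \<le> 1" and q: "1 \<le> q" "q < 2" and p: "1 \<le> p" "p < 2"
    and k: "1 \<le> k" and t: "0 < t" and W: "0 < W_ge n k f"
    and B: "(\<Sum>J\<in>level n k. (Lp_norm n q (D_set J f))\<^sup>2) \<le> B" "0 < B"
  shows "W_ge n k f * (1 - exp (- (t + ln_plus (W_ge n k f / B) / real k * (1 - exp (- (q / (2 * (2 - q)) * t)))))) ^ k
    \<le> cube_expectation n (\<lambda>x. nabla_abs n k f x powr p) * ((2 * t) powr (p / 2) / p) ^ k"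
proof -
  have "ln_plus (W_ge n k f / B) / real k * (1 - exp (- (q / (2 * (2 - q)) * t))) \<ge> 0"
    using q t by (intro mult_nonneg_nonneg divide_nonneg_nonneg) (auto simp: ln_plus_def)
  then have "0 \<le> 1 - exp (- (t + ln_plus (W_ge n k f / B) / real k * (1 - exp (- (q / (2 * (2 - q)) * t)))))"
    using t by simp
  then show ?thesis
    using W by (intro order.trans[OF _ high_degree_mass_le[OF f t p k W]] mult_left_mono power_mono
        high_degree_mass_ge[OF q k t W B]) auto
qed

text \<open>
  This is Minkowski's inequality in the sequence space with exponent \<open>2 / p \<ge> 1\<close>, for the functions
  \<open>\<bar>D_set J f\<bar> powr p\<close>. With \<open>G\<close> the length of the gradient, the convex function \<open>z powr (2 / p)\<close> is averaged
  over the ratios \<open>\<bar>D_set J f\<bar> powr p / G powr p\<close> with weights proportional to \<open>G powr p\<close>; the resulting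
  ratios \<open>(D_set J f)\<^sup>2 / G\<^sup>2\<close> sum to 1 over \<open>J\<close>.
\<close>

lemma gradient_norm_Minkowski:
  fixes p :: real
  assumes p: "1 \<le> p" "p < 2"
  shows "(\<Sum>J\<in>level n k. (Lp_norm n p (D_set J f))\<^sup>2) \<le> (Lp_norm n p (nabla_abs n k f))\<^sup>2"
proof -
  define G where "G = nabla_abs n k f"
  define P where "P = {x \<in> cube n. G x > 0}"
  define Z where "Z = (\<Sum>x\<in>P. G x powr p)"
  have G0: "G x \<ge> 0" for x by (simp add: G_def)
  have Dle: "\<bar>D_set J f x\<bar> \<le> G x" if "J \<in> level n k" for J x
  proof -
    have "(D_set J f x)\<^sup>2 \<le> (G x)\<^sup>2"
      unfolding G_def nabla_abs_sq using that by (intro member_le_sum) auto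
    then show ?thesis using G0[of x] by (simp add: abs_le_square_iff[symmetric])
  qed
  have finP: "finite P" by (simp add: P_def)
  have sumP: "(\<Sum>x\<in>cube n. \<bar>D_set J f x\<bar> powr p) = (\<Sum>x\<in>P. \<bar>D_set J f x\<bar> powr p)"
    if "J \<in> level n k" for J
  proof (rule sum.mono_neutral_right)
    show "\<forall>x\<in>cube n - P. \<bar>D_set J f x\<bar> powr p = 0"
    proof
      fix x assume "x \<in> cube n - P"
      then have "G x = 0" using G0[of x] by (auto simp: P_def)
      then show "\<bar>D_set J f x\<bar> powr p = 0" using Dle[OF that, of x] by simp
    qed
  qed (auto simp: P_def)
  have sumG: "(\<Sum>x\<in>cube n. \<bar>G x\<bar> powr p) = Z"
    unfolding Z_def using G0 by (intro sum.mono_neutral_cong_right) (auto simp: P_def less_le)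
  have Z0: "Z \<ge> 0" unfolding Z_def by (intro sum_nonneg) auto
  have normG: "(Lp_norm n p G)\<^sup>2 = (Z / 2 ^ n) powr (2 / p)"
    unfolding Lp_norm_def cube_expectation_eq sumG by (simp add: power2_eq_square flip: powr_add)
  show ?thesis
  proof (cases "P = {}")
    case True
    then have "Lp_norm n p (D_set J f) = 0" if "J \<in> level n k" for J
      unfolding Lp_norm_def cube_expectation_eq sumP[OF that] by simp
    then show ?thesis by simp
  next
    case False
    then have Z: "Z > 0" unfolding Z_def using finP by (intro sum_pos) (auto simp: P_def)
    have "(Lp_norm n p (D_set J f))\<^sup>2
        \<le> (Z / 2 ^ n) powr (2 / p) * (\<Sum>x\<in>P. G x powr p / Z * ((D_set J f x)\<^sup>2 / (G x)\<^sup>2))"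
      if J: "J \<in> level n k" for J
    proof -
      have "(Lp_norm n p (D_set J f))\<^sup>2 = ((\<Sum>x\<in>P. \<bar>D_set J f x\<bar> powr p) / 2 ^ n) powr (2 / p)"
        unfolding Lp_norm_def cube_expectation_eq sumP[OF J] by (simp add: power2_eq_square flip: powr_add)
      also have "(\<Sum>x\<in>P. \<bar>D_set J f x\<bar> powr p) / 2 ^ n
          = Z / 2 ^ n * (\<Sum>x\<in>P. (G x powr p / Z) *\<^sub>R (\<bar>D_set J f x\<bar> powr p / G x powr p))"
        unfolding sum_divide_distrib sum_distrib_left using Z
        by (intro sum.cong refl) (auto simp: P_def)
      also have "\<dots> powr (2 / p) = (Z / 2 ^ n) powr (2 / p) *
          (\<Sum>x\<in>P. (G x powr p / Z) *\<^sub>R (\<bar>D_set J f x\<bar> powr p / G x powr p)) powr (2 / p)"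
        by (rule powr_mult)
      also have "\<dots> \<le> (Z / 2 ^ n) powr (2 / p) *
          (\<Sum>x\<in>P. (G x powr p / Z) * (\<bar>D_set J f x\<bar> powr p / G x powr p) powr (2 / p))"
      proof (intro mult_left_mono convex_on_sum[where C = "{0..}"] convex_on_powr_nonneg finP False)
        show "(\<Sum>x\<in>P. G x powr p / Z) = 1"
          using Z by (simp add: Z_def flip: sum_divide_distrib)
      qed (use p Z0 in auto)
      also have "\<dots> = (Z / 2 ^ n) powr (2 / p) * (\<Sum>x\<in>P. G x powr p / Z * ((D_set J f x)\<^sup>2 / (G x)\<^sup>2))"
      proof -
        have "(\<bar>D_set J f x\<bar> powr p / G x powr p) powr (2 / p) = (D_set J f x)\<^sup>2 / (G x)\<^sup>2" if "x \<in> P" for x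
          using that p by (simp add: P_def powr_divide powr_powr)
        then show ?thesis by simp
      qed
      finally show ?thesis .
    qed
    then have "(\<Sum>J\<in>level n k. (Lp_norm n p (D_set J f))\<^sup>2)
      \<le> (\<Sum>J\<in>level n k. (Z / 2 ^ n) powr (2 / p) * (\<Sum>x\<in>P. G x powr p / Z * ((D_set J f x)\<^sup>2 / (G x)\<^sup>2)))"
      by (rule sum_mono)
    also have "\<dots> = (Z / 2 ^ n) powr (2 / p) * (\<Sum>J\<in>level n k. \<Sum>x\<in>P. G x powr p / Z * ((D_set J f x)\<^sup>2 / (G x)\<^sup>2))"
      by (simp only: sum_distrib_left)
    also have "(\<Sum>J\<in>level n k. \<Sum>x\<in>P. G x powr p / Z * ((D_set J f x)\<^sup>2 / (G x)\<^sup>2))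
        = (\<Sum>x\<in>P. G x powr p / Z * ((\<Sum>J\<in>level n k. (D_set J f x)\<^sup>2) / (G x)\<^sup>2))"
      by (subst sum.swap) (simp only: sum_distrib_left sum_divide_distrib)
    also have "\<dots> = (\<Sum>x\<in>P. G x powr p / Z)"
      unfolding nabla_abs_sq[symmetric] G_def[symmetric] by (intro sum.cong refl) (auto simp: P_def)
    also have "\<dots> = 1" using Z by (simp add: Z_def flip: sum_divide_distrib)
    finally show ?thesis unfolding G_def[symmetric] normG by simp
  qed
qed

section \<open>The constants\<close>

text \<open>
  Expanding the exponential to fourth order suffices on this interval. The inequality serves twice: to
  locate the maximum in \<open>M_const\<close>, and to bound the error of linearising \<open>1 - exp (- z)\<close>.
\<close>

lemma exp_minus_one_ge:
  fixes z :: real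
  assumes "0 \<le> z" "z \<le> 4 / 3"
  shows "z \<le> (1 - 3 * z / 8) * (exp z - 1)"
proof -
  obtain t where "exp z = (\<Sum>m<5. z ^ m / fact m) + exp t / fact 5 * z ^ 5"
    using Maclaurin_exp_le[of z 5] by blast
  moreover have "exp t / fact 5 * z ^ 5 \<ge> 0" using assms by simp
  ultimately have "z + z^2 / 2 + z^3 / 6 + z^4 / 24 \<le> exp z - 1"
    by (simp add: eval_nat_numeral fact_numeral)
  then have "(1 - 3 * z / 8) * (z + z^2 / 2 + z^3 / 6 + z^4 / 24) \<le> (1 - 3 * z / 8) * (exp z - 1)"
    using assms by (intro mult_left_mono) auto
  moreover have "(1 - 3 * z / 8) * (z + z^2 / 2 + z^3 / 6 + z^4 / 24)
      = z + z^2 * (1 / 8 - z / 48 - z^2 / 48 - z^3 / 64)"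
    by (simp add: field_simps eval_nat_numeral)
  moreover have "z^2 \<le> (4/3)^2" "z^3 \<le> (4/3)^3" using assms by (intro power_mono; simp)+
  then have "0 \<le> 1 / 8 - z / 48 - z^2 / 48 - z^3 / 64" using assms by (simp add: eval_nat_numeral)
  then have "0 \<le> z^2 * (1 / 8 - z / 48 - z^2 / 48 - z^3 / 64)" by simp
  ultimately show ?thesis by linarith
qed

lemma one_minus_exp_ge:
  fixes z :: real
  assumes "0 \<le> z" "z \<le> 4 / 3"
  shows "z \<le> (1 + 3 / 4 * z) * (1 - exp (- z))"
proof -
  have "z * exp (- z) \<le> (1 - 3 * z / 8) * (exp z - 1) * exp (- z)"
    by (intro mult_right_mono exp_minus_one_ge assms) simp
  also have "\<dots> = (1 - 3 * z / 8) * (1 - exp (- z))"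
    by (simp add: exp_minus field_simps)
  finally have "z * exp (- z) + z * (1 - exp (- z)) \<le> (1 - 3 * z / 8) * (1 - exp (- z)) + z * (1 - exp (- z))"
    by (rule add_right_mono)
  then have "z \<le> (1 + 5 / 8 * z) * (1 - exp (- z))"
  proof -
    have "(1 - 3 * z / 8) * w + z * w = (1 + 5 / 8 * z) * w" for w :: real by (simp add: field_simps)
    moreover have "z * exp (- z) + z * (1 - exp (- z)) = z" by (simp add: algebra_simps)
    ultimately show "z * exp (- z) + z * (1 - exp (- z)) \<le> (1 - 3 * z / 8) * (1 - exp (- z)) + z * (1 - exp (- z))
      \<Longrightarrow> z \<le> (1 + 5 / 8 * z) * (1 - exp (- z))" by simp
  qed
  also have "\<dots> \<le> (1 + 3 / 4 * z) * (1 - exp (- z))"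
    using assms by (intro mult_right_mono) auto
  finally show ?thesis .
qed

text \<open>
  The quotient decreases where \<open>x \<le> p / 2 * (exp x - 1)\<close>. At \<open>x0 = 4 / 3 * (2 - p)\<close> this is the previous
  inequality, because \<open>p / 2 = 1 - 3 * x0 / 8\<close>; beyond \<open>x0\<close> it persists by convexity.
\<close>

lemma ratio_beyond_maximum:
  fixes p x :: real
  assumes p: "1 \<le> p" "p < 2" and x: "4 / 3 * (2 - p) \<le> x"
  defines "x0 \<equiv> 4 / 3 * (2 - p)"
  shows "(1 - exp (- x)) / x powr (p / 2) \<le> (1 - exp (- x0)) / x0 powr (p / 2)"
proof -
  have x0: "0 < x0" "x0 \<le> 4 / 3" using p by (auto simp: x0_def)
  have half: "p / 2 = 1 - 3 * x0 / 8" by (simp add: x0_def right_diff_distrib diff_divide_distrib)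
  have base: "x0 \<le> p / 2 * (exp x0 - 1)"
    unfolding half using x0 by (intro exp_minus_one_ge) auto
  show ?thesis
  proof (rule DERIV_nonpos_imp_nonincreasing[of x0 x "\<lambda>x. (1 - exp (- x)) / x powr (p / 2)"])
    show "x0 \<le> x" using x by (simp add: x0_def)
    fix y assume y: "x0 \<le> y"
    then have y0: "y > 0" using x0 by simp
    have deriv: "((\<lambda>x. (1 - exp (- x)) / x powr (p / 2)) has_real_derivative
        (exp (- y) * y powr (p / 2) - (1 - exp (- y)) * (p / 2 * y powr (p / 2 - 1))) / (y powr (p / 2) * y powr (p / 2))) (at y)"
      using y0 by (auto intro!: derivative_eq_intros)
    have "y \<le> p / 2 * (exp y - 1)"
    proof -
      define A where "A = p / 2 * exp x0"
      have base': "x0 \<le> A - p / 2" using base by (simp only: A_def right_diff_distrib mult_1_right)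
      have "exp x0 * (1 + (y - x0)) \<le> exp x0 * exp (y - x0)"
        by (intro mult_left_mono exp_ge_add_one_self) auto
      then have "exp x0 * (1 + (y - x0)) \<le> exp y" by (simp flip: exp_add)
      then have "p / 2 * (exp x0 * (1 + (y - x0))) \<le> p / 2 * exp y" using p by (intro mult_left_mono) auto
      then have "A + A * (y - x0) \<le> p / 2 * exp y"
        by (simp only: A_def mult.assoc distrib_left mult_1_right)
      moreover have "1 \<le> A" using base' half x0(1) by linarith
      then have "1 * (y - x0) \<le> A * (y - x0)" using y by (intro mult_right_mono) auto
      ultimately show ?thesis using base' by (simp only: right_diff_distrib mult_1_right)
    qed
    then have "exp (- y) * y \<le> exp (- y) * (p / 2 * (exp y - 1))" by (intro mult_left_mono) auto
    also have "\<dots> = p / 2 * (1 - exp (- y))" by (simp add: exp_minus field_simps)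
    finally have le: "exp (- y) * y \<le> p / 2 * (1 - exp (- y))" .
    have pw: "y powr (p / 2) = y * y powr (p / 2 - 1)" using y0 by (simp add: powr_diff)
    have "exp (- y) * y powr (p / 2) - (1 - exp (- y)) * (p / 2 * y powr (p / 2 - 1))
        = (exp (- y) * y - p / 2 * (1 - exp (- y))) * y powr (p / 2 - 1)"
      by (subst pw) (simp add: algebra_simps)
    also have "\<dots> \<le> 0" using le by (intro mult_nonpos_nonneg) auto
    finally have "(exp (- y) * y powr (p / 2) - (1 - exp (- y)) * (p / 2 * y powr (p / 2 - 1))) / (y powr (p / 2) * y powr (p / 2)) \<le> 0"
      by (intro divide_nonpos_nonneg) auto
    with deriv show "\<exists>d. ((\<lambda>x. (1 - exp (- x)) / x powr (p / 2)) has_real_derivative d) (at y) \<and> d \<le> 0"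
      by blast
  qed
qed

definition M_quotient :: "real \<Rightarrow> real \<Rightarrow> real" where
  "M_quotient p x = p * 2 powr (- p / 2) * ((1 - exp (- x)) / x powr (p / 2))"

lemma M_const_le:
  fixes p V :: real
  assumes p: "1 \<le> p" "p < 2" and V: "\<And>x. 0 < x \<Longrightarrow> x \<le> 4 / 3 * (2 - p) \<Longrightarrow> M_quotient p x \<le> V"
  shows "M_const p \<le> V"
proof -
  define x0 where "x0 = 4 / 3 * (2 - p)"
  define c where "c = p * 2 powr (- p / 2)"
  have c: "c > 0" using p by (simp add: c_def)
  have x0: "x0 > 0" using p by (simp add: x0_def)
  have V': "(1 - exp (- x)) / x powr (p / 2) \<le> V / c" if "0 < x" "x \<le> x0" for x
  proof -
    have "c * ((1 - exp (- x)) / x powr (p / 2)) \<le> V"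
      using V[of x] that by (simp only: M_quotient_def c_def x0_def)
    then show ?thesis using c by (simp only: pos_le_divide_eq mult.commute)
  qed
  have "(SUP x\<in>{0..}. (1 - exp (- x)) / x powr (p / 2)) \<le> V / c"
  proof (rule cSUP_least)
    fix x :: real assume "x \<in> {0..}"
    then consider "x = 0" | "0 < x" "x \<le> x0" | "x0 \<le> x" by fastforce
    then show "(1 - exp (- x)) / x powr (p / 2) \<le> V / c"
    proof cases
      case 1
      have "0 \<le> (1 - exp (- x0)) / x0 powr (p / 2)" using x0 by simp
      also have "\<dots> \<le> V / c" using V'[of x0] x0 by simp
      finally show ?thesis using 1 by simp
    next
      case 3
      then show ?thesis using ratio_beyond_maximum[OF p, of x] V'[of x0] x0 by (simp add: x0_def)
    qed (use V' in auto)
  qed simp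
  then have "c * (SUP x\<in>{0..}. (1 - exp (- x)) / x powr (p / 2)) \<le> V"
    using c by (simp add: field_simps)
  then show ?thesis by (simp add: M_const_def c_def)
qed

lemma M_const_ge:
  fixes p x :: real
  assumes p: "0 < p" "p < 2" and x: "0 \<le> x"
  shows "M_quotient p x \<le> M_const p"
proof -
  have "(1 - exp (- y)) / y powr (p / 2) \<le> 1" if "y \<ge> 0" for y :: real
  proof (cases "y = 0")
    case False
    then have y: "y > 0" using that by simp
    have "1 - exp (- y) \<le> y powr (p / 2)"
    proof (cases "y \<ge> 1")
      case True
      have "1 - exp (- y) \<le> 1" by simp
      also have "1 \<le> y powr (p / 2)" using True p by (intro ge_one_powr_ge_zero) auto
      finally show ?thesis .
    next
      case False
      have "1 - exp (- y) \<le> y" using exp_ge_add_one_self[of "- y"] by linarith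
      also have "y = y powr 1" using y by simp
      also have "\<dots> \<le> y powr (p / 2)" using y False p by (intro powr_mono') auto
      finally show ?thesis .
    qed
    then show ?thesis using y by simp
  qed simp
  then have "(1 - exp (- x)) / x powr (p / 2) \<le> (SUP x\<in>{0..}. (1 - exp (- x)) / x powr (p / 2))"
    using x by (intro cSUP_upper bdd_aboveI2[where M = 1]) auto
  then show ?thesis unfolding M_const_def M_quotient_def using p by (intro mult_left_mono) auto
qed

lemma M_quotient_pos: "0 < p \<Longrightarrow> 0 < x \<Longrightarrow> 0 < M_quotient p x"
  by (simp add: M_quotient_def)

lemma M_const_pos: "0 < p \<Longrightarrow> p < 2 \<Longrightarrow> 0 < M_const p"
  using M_const_ge[of p 1] M_quotient_pos[of p 1] by simp

text \<open>
  An inequality that holds for every \<open>x\<close> in place of the maximiser also holds with the maximum, and by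
  \<open>ratio_beyond_maximum\<close> only small \<open>x\<close> need to be considered. So the maximiser need not be identified.
\<close>

lemma le_with_M_const:
  fixes p A d T :: real
  assumes p: "1 \<le> p" "p < 2" and A: "0 < A"
    and le: "\<And>x. 0 < x \<Longrightarrow> x \<le> 4 / 3 * (2 - p) \<Longrightarrow> T \<le> A * M_quotient p x powr (- 2 / p) + d"
  shows "T \<le> A * M_const p powr (- 2 / p) + d"
proof (cases "T \<le> d")
  case True
  have "0 \<le> A * M_const p powr (- 2 / p)" using A by simp
  then show ?thesis using True by linarith
next
  case False
  define R where "R = (T - d) / A"
  have R: "R > 0" using False A by (simp add: R_def)
  define V where "V = R powr (- p / 2)"
  have V: "V > 0" "V powr (- 2 / p) = R" using R p by (auto simp: V_def powr_powr)
  have "M_const p \<le> V"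
  proof (rule M_const_le[OF p])
    fix x :: real assume x: "0 < x" "x \<le> 4 / 3 * (2 - p)"
    have m: "M_quotient p x > 0" using p x by (intro M_quotient_pos) auto
    have "R \<le> M_quotient p x powr (- 2 / p)"
      using le[OF x] A by (simp add: R_def divide_le_eq algebra_simps)
    then have "(M_quotient p x powr (- 2 / p)) powr (- p / 2) \<le> R powr (- p / 2)"
      using R p by (intro powr_mono2') auto
    then show "M_quotient p x \<le> V" using m p by (simp add: V_def powr_powr)
  qed
  then have "R \<le> M_const p powr (- 2 / p)"
    unfolding V(2)[symmetric] using p by (intro powr_mono2' M_const_pos) auto
  then show ?thesis using A by (simp add: R_def divide_le_eq algebra_simps)
qed

text \<open>
  The base of the power defining \<open>C_const\<close> is at most a constant over \<open>(2 - p) * (2 - q)\<close>, because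
  \<open>M_const p \<ge> 1 / 4\<close>, as the value \<open>x = 1\<close> shows; and \<open>p / 2 \<le> 1\<close>.
\<close>

lemma C_const_lower_bound:
  "\<exists>c > 0. \<forall>p q :: real. 1 \<le> q \<longrightarrow> q \<le> p \<longrightarrow> p < 2 \<longrightarrow> C_const p q \<ge> c * (2 - p) * (2 - q)"
proof -
  define K :: real where "K = 2 * (1/4) powr (- 2) + 2"
  have K: "K \<ge> 1" by (simp add: K_def)
  have "C_const p q \<ge> 1 / K * (2 - p) * (2 - q)" if pq: "1 \<le> q" "q \<le> p" "p < 2" for p q :: real
  proof -
    define d where "d = (2 - p) * (2 - q)"
    have d: "0 < d" "d \<le> 1" using pq by (auto simp: d_def intro: mult_le_one)
    have "1/4 \<le> M_const p"
    proof -
      have "exp (- 1) \<le> (1/2 :: real)"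
        using exp_ge_add_one_self[of "1::real"] by (simp add: exp_minus field_simps)
      moreover have "(2::real) powr (- 1) \<le> 2 powr (- p / 2)" using pq by (intro powr_mono) auto
      then have "1 * (1/2) \<le> p * 2 powr (- p / 2)" using pq by (intro mult_mono) (auto simp: powr_minus)
      ultimately have "1/2 * (1/2) \<le> p * 2 powr (- p / 2) * ((1 - exp (- 1)) / 1 powr (p / 2))"
        by (intro mult_mono) auto
      also have "\<dots> \<le> M_const p" using M_const_ge[of p 1] pq by (simp add: M_quotient_def)
      finally show ?thesis by simp
    qed
    then have "M_const p powr (- 2 / p) \<le> (1/4) powr (- 2 / p)"
      using pq by (intro powr_mono2') auto
    also have "\<dots> \<le> (1/4) powr (- 2)"
      using pq by (intro powr_mono') (auto simp: divide_le_eq)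
    finally have M: "M_const p powr (- 2 / p) \<le> (1/4) powr (- 2)" .
    have "2 / (2 - q) * M_const p powr (- 2 / p) \<le> 2 / d * (1/4) powr (- 2)"
    proof (intro mult_mono M divide_left_mono)
      show "d \<le> 2 - q" unfolding d_def using pq mult_right_mono[of "2 - p" 1 "2 - q"] by simp
      show "0 < (2 - q) * d" using d pq by simp
    qed (use pq d in auto)
    moreover have "p * q / (2 * exp 1 * (2 - p) * (2 - q)) \<le> 2 / d"
    proof -
      have "p * q \<le> 2 * 2" using pq by (intro mult_mono) auto
      moreover have "1 \<le> exp (1::real)" by simp
      ultimately have "p * q / (2 * exp 1 * d) \<le> 4 / (2 * 1 * d)"
        using d pq by (intro frac_le) auto
      then show ?thesis by (simp add: d_def mult.assoc)
    qed
    ultimately have le: "2 / (2 - q) * M_const p powr (- 2 / p) + p * q / (2 * exp 1 * (2 - p) * (2 - q)) \<le> K / d"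
      by (simp add: K_def add_divide_distrib mult_ac)
    have pos: "0 < 2 / (2 - q) * M_const p powr (- 2 / p) + p * q / (2 * exp 1 * (2 - p) * (2 - q))"
      using pq by (intro add_nonneg_pos) auto
    have "d / K = (d / K) powr 1" using d K by simp
    also have "\<dots> \<le> (d / K) powr (p / 2)"
      using d K pq by (intro powr_mono') auto
    also have "\<dots> = (K / d) powr (- p / 2)"
      using d K by (simp add: powr_divide powr_minus field_simps)
    also have "\<dots> \<le> C_const p q"
      unfolding C_const_def using le pos pq by (intro powr_mono2') auto
    finally show ?thesis by (simp add: d_def mult.assoc)
  qed
  moreover have "1 / K > 0" using K by simp
  ultimately show ?thesis by blast
qed

section \<open>The lower bound for bounded functions\<close>

text \<open>
  Let \<open>t = x / Y\<close>. To first order in \<open>t\<close> the hypotheses say \<open>a l \<le> Y - 1\<close> and \<open>b l' \<le> Y - 1\<close>, which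
  add up to the claim with room \<open>2 * a\<close>. The error of the linearisation is a factor
  \<open>1 + 3 / 4 * z\<close> with \<open>z = a * t\<close> and \<open>z = b * t\<close>, respectively, and the constraints on \<open>x\<close>, which is at most
  \<open>4 / 3 * (2 - p)\<close> in the application, keep the total error within this room.
\<close>

lemma trade_off_of_logarithms:
  fixes a b x Y l l' :: real
  assumes a: "0 < a" "a \<le> b" and x: "0 < x" "b * x \<le> 4 / 3" "x * (1 + 2 * b) \<le> 8 / 3" and Y: "0 < Y"
    and l: "0 \<le> l" "0 \<le> l'"
    and h: "x / Y + l * (1 - exp (- (a * (x / Y)))) \<le> x"
    and h': "x / Y + l' * (1 - exp (- (b * (x / Y)))) \<le> x"
  shows "1 \<le> Y" and "1 + a * l + 2 * a * b * l' \<le> (1 + 2 * a) * Y"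
proof -
  define t where "t = x / Y"
  have t: "t > 0" using x Y by (simp add: t_def)
  have xt: "x = t * Y" using Y by (simp add: t_def)
  have "0 \<le> l * (1 - exp (- (a * t)))" using l t a by (intro mult_nonneg_nonneg) auto
  then have "t \<le> x" using h by (simp add: t_def)
  then show Y1: "1 \<le> Y" using t by (simp add: xt)
  have bound: "c * m \<le> (Y - 1) * (1 + 3 / 4 * (c * t))"
    if c: "0 < c" "c \<le> b" and m: "0 \<le> m" "x / Y + m * (1 - exp (- (c * (x / Y)))) \<le> x" for c m
  proof -
    define z where "z = c * t"
    have z0: "0 < z" using c t by (simp add: z_def)
    have "z \<le> b * x" unfolding z_def using c t \<open>t \<le> x\<close> by (intro mult_mono) auto
    then have z: "z \<le> 4 / 3" using x by simp
    have e: "0 < 1 - exp (- z)" using z0 by simp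
    have "m * (1 - exp (- z)) \<le> t * (Y - 1)"
      using m(2) unfolding t_def[symmetric] z_def[symmetric] by (simp add: xt algebra_simps)
    then have "c * (m * (1 - exp (- z))) \<le> c * (t * (Y - 1))" using c by (intro mult_left_mono) auto
    then have "c * m * (1 - exp (- z)) \<le> (Y - 1) * z" by (simp add: z_def mult_ac)
    also have "\<dots> \<le> (Y - 1) * ((1 + 3 / 4 * z) * (1 - exp (- z)))"
      using Y1 z z0 by (intro mult_left_mono one_minus_exp_ge) auto
    finally have "c * m * (1 - exp (- z)) \<le> (Y - 1) * (1 + 3 / 4 * z) * (1 - exp (- z))" by (simp only: mult.assoc)
    then show ?thesis using e by (simp add: z_def)
  qed
  have "a * l \<le> (Y - 1) * (1 + 3 / 4 * (a * t))" by (intro bound a l h)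
  moreover have "2 * a * (b * l') \<le> 2 * a * ((Y - 1) * (1 + 3 / 4 * (b * t)))"
    using a by (intro mult_left_mono bound l h') auto
  moreover have "(Y - 1) * (1 + 3 / 4 * (a * t)) + 2 * a * ((Y - 1) * (1 + 3 / 4 * (b * t)))
      \<le> (1 + 2 * a) * Y - 1"
  proof -
    have "(Y - 1) * t \<le> x" using t by (simp add: xt algebra_simps)
    then have "(Y - 1) * t * (1 + 2 * b) \<le> x * (1 + 2 * b)" using a by (intro mult_right_mono) auto
    then have "(Y - 1) * t * (1 + 2 * b) \<le> 8 / 3" using x by linarith
    then have "3 / 4 * a * ((Y - 1) * t * (1 + 2 * b)) \<le> 3 / 4 * a * (8 / 3)"
      using a by (intro mult_left_mono) auto
    moreover have "(Y - 1) * (1 + 3 / 4 * (a * t)) + 2 * a * ((Y - 1) * (1 + 3 / 4 * (b * t)))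
      = (1 + 2 * a) * (Y - 1) + 3 / 4 * a * ((Y - 1) * t * (1 + 2 * b))" by (simp add: field_simps)
    ultimately show ?thesis by (simp add: algebra_simps)
  qed
  ultimately show "1 + a * l + 2 * a * b * l' \<le> (1 + 2 * a) * Y" by (simp add: mult.assoc)
qed

text \<open>
  Here \<open>X\<close> is the normalised moment for which the claim is that the bracket is at most
  \<open>X * C_const p q powr (- 2 / p)\<close>, with \<open>M_quotient p x\<close> in place of the maximum \<open>M_const p\<close>. For
  \<open>Y = X * M_quotient p x powr (- 2 / p)\<close>, the moment bound at time \<open>t = x / Y\<close> yields the hypotheses of
  \<open>trade_off_of_logarithms\<close> for \<open>B\<close>, and for \<open>B'\<close>, the squared \<open>L\<^sup>p\<close> norm of the gradient.
  The logarithm of \<open>1 / W\<close> is then eliminated by \<open>- ln W / (2 * b) = k * ln X + ln (W / B')\<close>, where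
  \<open>b = p / (2 * (2 - p))\<close>, which holds as \<open>B'\<close> equals \<open>W powr (2 / p) * X ^ k\<close>.
\<close>

lemma bracket_le:
  fixes p q x :: real
  assumes f: "Linf_norm n f \<le> 1" and q: "1 \<le> q" "q \<le> p" and p: "p < 2" and k: "1 \<le> k"
    and W: "0 < W_ge n k f" and x: "0 < x" "x \<le> 4 / 3 * (2 - p)"
  defines "X \<equiv> (cube_expectation n (\<lambda>y. nabla_abs n k f y powr p) / W_ge n k f) powr (2 / (p * real k))"
  shows "1 + q / (2 * real k * (2 - q)) * ln_plus (1 / (\<Sum>J\<in>level n k. (Lp_norm n q (D_set J f))\<^sup>2))
    \<le> 2 / (2 - q) * X * M_quotient p x powr (- 2 / p) + p * q / (2 * exp 1 * (2 - p) * (2 - q)) * X"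
proof -
  have p1: "1 \<le> p" and q2: "q < 2" using q p by auto
  define W where "W = W_ge n k f"
  define B where "B = (\<Sum>J\<in>level n k. (Lp_norm n q (D_set J f))\<^sup>2)"
  define K where "K = cube_expectation n (\<lambda>y. nabla_abs n k f y powr p)"
  define B' where "B' = (Lp_norm n p (nabla_abs n k f))\<^sup>2"
  define a where "a = q / (2 * (2 - q))"
  define b where "b = p / (2 * (2 - p))"
  define m where "m = M_quotient p x"
  define Y where "Y = X * m powr (- 2 / p)"
  define l where "l = ln_plus (W / B) / real k"
  define l' where "l' = ln_plus (W / B') / real k"
  have W0: "W > 0" using W by (simp add: W_def)
  have B0: "B > 0" unfolding B_def by (rule sum_Lp_norm_pos[OF W])
  have B'ge: "(\<Sum>J\<in>level n k. (Lp_norm n p (D_set J f))\<^sup>2) \<le> B'"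
    unfolding B'_def by (rule gradient_norm_Minkowski[OF p1 p])
  have B'0: "B' > 0" using sum_Lp_norm_pos[OF W, of p] B'ge by linarith
  have K: "Lp_norm n p (nabla_abs n k f) = K powr (1 / p)"
    by (simp add: Lp_norm_def K_def)
  have K0: "K > 0"
  proof -
    have "K \<ge> 0" unfolding K_def by (intro cube_expectation_nonneg) simp
    moreover have "K \<noteq> 0" using B'0 by (auto simp: B'_def K)
    ultimately show ?thesis by simp
  qed
  have X0: "X > 0" using K0 W0 by (simp add: X_def K_def W_def)
  have Xk: "(X powr (p / 2)) ^ k = K / W"
  proof -
    have "X powr (p / 2) = (K / W) powr (1 / real k)"
      using p1 by (simp add: X_def K_def W_def powr_powr)
    then have "(X powr (p / 2)) ^ k = ((K / W) powr (1 / real k)) powr real k"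
      using K0 W0 by (subst powr_realpow) auto
    then show ?thesis using K0 W0 k by (simp add: powr_powr)
  qed
  have m0: "m > 0" unfolding m_def using p1 x by (intro M_quotient_pos) auto
  have Y0: "Y > 0" using X0 m0 by (simp add: Y_def)
  have a0: "a > 0" "a \<le> b"
  proof -
    show "a > 0" using q q2 by (simp add: a_def)
    show "a \<le> b" unfolding a_def b_def using q p by (intro frac_le) auto
  qed
  have bx: "b * x \<le> 4 / 3" "x * (1 + 2 * b) \<le> 8 / 3"
  proof -
    have "b * x \<le> b * (4 / 3 * (2 - p))" using x a0 by (intro mult_left_mono) auto
    also have "\<dots> = 2 / 3 * p"
    proof -
      have "p / (2 * d) * (4 / 3 * d) = 2 / 3 * p" if "0 < d" for d using that by (simp add: field_simps)
      then show ?thesis using p by (simp only: b_def diff_gt_0_iff_gt)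
    qed
    finally show "b * x \<le> 4 / 3" using p by linarith
    have "x * (1 + 2 * b) \<le> 4 / 3 * (2 - p) * (1 + 2 * b)" using x a0 by (intro mult_right_mono) auto
    also have "4 / 3 * (2 - p) * (1 + 2 * b) = 8 / 3"
    proof -
      have b: "1 + 2 * b = 2 / (2 - p)" using p by (simp add: b_def field_simps)
      have "4 / 3 * d * (2 / d) = 8 / 3" if "0 < d" for d :: real using that by simp
      then show ?thesis unfolding b using p by (simp only: diff_gt_0_iff_gt)
    qed
    finally show "x * (1 + 2 * b) \<le> 8 / 3" .
  qed
  have t: "x / Y > 0" using x Y0 by simp
  \<comment> \<open>the choice of \<open>Y\<close> makes the right-hand side of the moment bound at time \<open>x / Y\<close> equal to \<open>W (1 - exp (- x)) ^ k\<close>\<close>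
  have rhs: "K * ((2 * (x / Y)) powr (p / 2) / p) ^ k = W * (1 - exp (- x)) ^ k"
  proof -
    have "(2 * (x / Y)) powr (p / 2) = 2 powr (p / 2) * x powr (p / 2) / Y powr (p / 2)"
      by (simp add: powr_mult powr_divide)
    also have "Y powr (p / 2) = X powr (p / 2) / m"
      using X0 m0 p1 by (simp add: Y_def powr_divide powr_powr powr_minus_divide)
    finally have "X powr (p / 2) * ((2 * (x / Y)) powr (p / 2) / p) = 2 powr (p / 2) * x powr (p / 2) * m / p"
      using X0 by simp
    also have "\<dots> = 1 - exp (- x)"
      using p1 x by (simp add: m_def M_quotient_def powr_minus field_simps)
    finally have e: "X powr (p / 2) * ((2 * (x / Y)) powr (p / 2) / p) = 1 - exp (- x)" .
    have "K = W * (X powr (p / 2)) ^ k" using Xk W0 by simp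
    then have "K * ((2 * (x / Y)) powr (p / 2) / p) ^ k = W * (X powr (p / 2) * ((2 * (x / Y)) powr (p / 2) / p)) ^ k"
      by (simp only: power_mult_distrib mult.assoc)
    then show ?thesis by (simp only: e)
  qed
  have decay: "x / Y + ln_plus (W / C) / real k * (1 - exp (- (r / (2 * (2 - r)) * (x / Y)))) \<le> x"
    if r: "1 \<le> r" "r < 2" and C: "(\<Sum>J\<in>level n k. (Lp_norm n r (D_set J f))\<^sup>2) \<le> C" "0 < C" for r C
  proof -
    define s where "s = x / Y + ln_plus (W / C) / real k * (1 - exp (- (r / (2 * (2 - r)) * (x / Y))))"
    have "W * (1 - exp (- s)) ^ k \<le> W * (1 - exp (- x)) ^ k"
      using gradient_moment_lower_bound[OF f r p1 p k t W C]
      unfolding rhs[symmetric] by (simp only: s_def W_def K_def)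
    then have "(1 - exp (- s)) ^ k \<le> (1 - exp (- x)) ^ k" using W0 by simp
    then have "1 - exp (- s) \<le> 1 - exp (- x)"
      using k x power_less_imp_less_base by (metis (no_types, opaque_lifting) diff_ge_0_iff_ge exp_le_one_iff
          less_imp_le neg_le_0_iff_le not_le power_strict_mono zero_less_one le_less_trans)
    then show ?thesis by (simp add: s_def)
  qed
  have "0 \<le> l" "0 \<le> l'" by (simp_all add: l_def l'_def ln_plus_def)
  note T = trade_off_of_logarithms[OF a0 x(1) bx Y0 this]
  have hl: "x / Y + l * (1 - exp (- (a * (x / Y)))) \<le> x"
    unfolding l_def a_def by (rule decay[OF q(1) q2 _ B0]) (simp add: B_def)
  have hl': "x / Y + l' * (1 - exp (- (b * (x / Y)))) \<le> x"
    unfolding l'_def b_def by (rule decay[OF p1 p B'ge B'0])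
  have Y1: "1 \<le> Y" and main: "1 + a * l + 2 * a * b * l' \<le> (1 + 2 * a) * Y"
    using T[OF hl hl'] by auto
  have tp: "1 + 2 * a = 2 / (2 - q)" using q2 by (simp add: a_def field_simps)
  have lnX: "ln X \<le> X / exp 1"
  proof -
    have "ln (X / exp 1) \<le> X / exp 1 - 1" using X0 by (intro ln_le_minus_one) simp
    then show ?thesis using X0 by (simp add: ln_div)
  qed
  have "1 + a * (ln_plus (1 / B) / real k) \<le> (1 + 2 * a) * Y + 2 * a * b * (X / exp 1)"
  proof (cases "B < 1")
    case False
    then have "ln_plus (1 / B) = 0" using B0 by (simp add: ln_plus_def ln_div)
    moreover have "1 * 1 \<le> (1 + 2 * a) * Y" using Y1 a0 by (intro mult_mono) auto
    moreover have "0 \<le> 2 * a * b * (X / exp 1)" using a0 X0 by simp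
    ultimately show ?thesis by simp
  next
    case True
    have "ln (1 / B) = ln (W / B) - ln W" using W0 B0 by (simp add: ln_div)
    moreover have "ln (1 / B) > 0" using True B0 by simp
    ultimately have 1: "ln_plus (1 / B) / real k \<le> l - ln W / real k"
      by (simp add: l_def ln_plus_def diff_divide_distrib[symmetric] divide_right_mono)
    \<comment> \<open>\<open>B'\<close> is a power of \<open>K\<close>, and \<open>X\<close> one of \<open>K / W\<close>: eliminating \<open>K\<close> determines \<open>ln W\<close>\<close>
    have "ln B' = 2 / p * ln K"
      using K0 by (simp add: B'_def K ln_realpow ln_powr)
    moreover have "ln X = 2 / (p * real k) * (ln K - ln W)"
      using K0 W0 by (simp add: X_def K_def[symmetric] W_def[symmetric] ln_powr ln_div)
    then have "real k * ln X = 2 / p * (ln K - ln W)" using k p1 by simp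
    then have "2 / p * ln K = real k * ln X + 2 / p * ln W" by (simp add: right_diff_distrib)
    ultimately have "ln (W / B') = ln W - real k * ln X - 2 / p * ln W"
      using W0 B'0 by (simp add: ln_div)
    moreover have "2 / p * ln W = ln W + ln W / (2 * b)"
      using p p1 by (simp add: b_def field_simps)
    ultimately have "- ln W / (2 * b) = real k * ln X + ln (W / B')" by simp
    also have "\<dots> \<le> real k * ln X + real k * l'"
      using k by (simp add: l'_def ln_plus_def)
    also have "\<dots> \<le> real k * (X / exp 1) + real k * l'"
      using lnX by (intro add_right_mono mult_left_mono) auto
    finally have "- ln W / (2 * b) \<le> real k * (X / exp 1 + l')" by (simp only: distrib_left)
    moreover have "0 < 2 * b" using a0 by simp
    ultimately have "- ln W \<le> real k * (X / exp 1 + l') * (2 * b)" by (simp only: pos_divide_le_eq)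
    then have "- ln W \<le> 2 * b * (X / exp 1 + l') * real k" by (simp only: mult_ac)
    moreover have "0 < real k" using k by simp
    ultimately have "- ln W / real k \<le> 2 * b * (X / exp 1 + l')" by (simp only: pos_divide_le_eq)
    with 1 have "ln_plus (1 / B) / real k \<le> l + 2 * b * (X / exp 1 + l')" by simp
    then have "a * (ln_plus (1 / B) / real k) \<le> a * (l + 2 * b * (X / exp 1 + l'))"
      using a0 by (intro mult_left_mono) auto
    also have "\<dots> = a * l + 2 * a * b * l' + 2 * a * b * (X / exp 1)" by (simp add: algebra_simps)
    finally show ?thesis using main by linarith
  qed
  also have "2 * a * b * (X / exp 1) = p * q / (2 * exp 1 * (2 - p) * (2 - q)) * X"
  proof -
    have "2 * (q / (2 * u)) * (p / (2 * v)) * (X / exp 1) = p * q / (2 * exp 1 * v * u) * X" for u v :: real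
      by (simp add: mult_ac)
    then show ?thesis unfolding a_def b_def .
  qed
  also have "a * (ln_plus (1 / B) / real k) = q / (2 * real k * (2 - q)) * ln_plus (1 / B)"
    by (simp add: a_def mult_ac)
  finally show ?thesis
    unfolding tp Y_def B_def m_def by (simp only: mult.assoc)
qed

text \<open>
  For \<open>k = 0\<close> the claim is \<open>f\<^sup>2 \<le> \<bar>f\<bar> powr p\<close>; for \<open>k \<ge> 1\<close> it is \<open>bracket_le\<close> at the maximum over \<open>x\<close>,
  raised to the power \<open>k * p / 2\<close>.
\<close>

theorem bounded_gradient_lower_bound:
  fixes p q :: real
  assumes f: "Linf_norm n f \<le> 1" and q: "1 \<le> q" "q \<le> p" and p: "p < 2"
  shows "C_const p q ^ k * W_ge n k f * (1 + q / (2 * real k * (2 - q)) *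
      ln_plus (1 / (\<Sum>J\<in>level n k. (Lp_norm n q (D_set J f))\<^sup>2))) powr (real k * p / 2)
    \<le> Lp_norm n p (nabla_abs n k f) powr p"
proof -
  have p1: "1 \<le> p" and q2: "q < 2" using q p by auto
  define T where "T = 1 + q / (2 * real k * (2 - q)) *
      ln_plus (1 / (\<Sum>J\<in>level n k. (Lp_norm n q (D_set J f))\<^sup>2))"
  define W where "W = W_ge n k f"
  define K where "K = cube_expectation n (\<lambda>y. nabla_abs n k f y powr p)"
  have K0: "K \<ge> 0" unfolding K_def by (intro cube_expectation_nonneg) simp
  have lhs: "Lp_norm n p (nabla_abs n k f) powr p = K"
    using K0 p1 by (simp add: Lp_norm_def K_def powr_powr)
  have T1: "T \<ge> 1" using q q2 by (simp add: T_def ln_plus_def)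
  consider "W = 0" | "k = 0" | "W > 0" "1 \<le> k"
    using W_ge_nonneg[of n k f] unfolding W_def by linarith
  then have "C_const p q ^ k * W * T powr (real k * p / 2) \<le> K"
  proof cases
    case 1
    then show ?thesis using K0 by simp
  next
    case 2
    have lev: "level n 0 = {{}}" by (auto simp: level_def finite_subset)
    have "W = cube_expectation n (\<lambda>x. (f x)\<^sup>2)"
      using 2 avg_energy_0[of n 0 f] by (simp add: W_def avg_energy_full_1 Lp_norm_2_sq nabla_abs_sq lev)
    also have "\<dots> \<le> K"
      unfolding K_def
    proof (intro cube_expectation_mono)
      fix x assume "x \<in> cube n"
      then have "\<bar>f x\<bar> \<le> 1" using Linf_normD[of x n f] f by simp
      then have "\<bar>f x\<bar> powr 2 \<le> \<bar>f x\<bar> powr p" using p by (intro powr_mono') auto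
      then show "(f x)\<^sup>2 \<le> nabla_abs n k f x powr p" using 2 by (simp add: nabla_abs_def lev)
    qed
    finally show ?thesis using 2 T1 by simp
  next
    case 3
    define X where "X = (K / W) powr (2 / (p * real k))"
    define d where "d = p * q / (2 * exp 1 * (2 - p) * (2 - q))"
    define Ci where "Ci = 2 / (2 - q) * M_const p powr (- 2 / p) + d"
    have W: "0 < W_ge n k f" using 3 by (simp add: W_def)
    have d0: "d > 0" using p p1 q q2 by (simp add: d_def)
    have Ci0: "Ci > 0" using d0 q2 by (auto simp: Ci_def intro!: add_nonneg_pos)
    have X0: "X > 0"
    proof -
      have "T \<le> 2 / (2 - q) * X * M_quotient p (4 / 3 * (2 - p)) powr (- 2 / p) + d * X"
        unfolding T_def X_def K_def W_def d_def using p
        by (intro bracket_le[OF f q p 3(2) W]) auto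
      then have "X \<noteq> 0" using T1 by auto
      then show ?thesis by (simp add: X_def)
    qed
    have "T \<le> 2 / (2 - q) * X * M_const p powr (- 2 / p) + d * X"
    proof (rule le_with_M_const[OF p1 p])
      show "0 < 2 / (2 - q) * X" using q2 X0 by simp
      fix x :: real assume "0 < x" "x \<le> 4 / 3 * (2 - p)"
      then show "T \<le> 2 / (2 - q) * X * M_quotient p x powr (- 2 / p) + d * X"
        unfolding T_def X_def K_def W_def d_def by (rule bracket_le[OF f q p 3(2) W])
    qed
    then have "T \<le> Ci * X" by (simp add: Ci_def algebra_simps)
    then have "T powr (real k * p / 2) \<le> (Ci * X) powr (real k * p / 2)"
      using T1 p1 by (intro powr_mono2) auto
    also have "\<dots> = Ci powr (real k * p / 2) * X powr (real k * p / 2)" by (simp add: powr_mult)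
    also have "X powr (real k * p / 2) = K / W"
      using 3 p1 K0 by (simp add: X_def powr_powr)
    finally have Tle: "T powr (real k * p / 2) \<le> Ci powr (real k * p / 2) * (K / W)" .
    have Cp: "C_const p q ^ k = Ci powr (- (real k * p / 2))"
    proof -
      have "C_const p q = Ci powr (- p / 2)" by (simp add: C_const_def Ci_def d_def)
      then show ?thesis using Ci0 by (simp add: powr_powr mult_ac flip: powr_realpow)
    qed
    have "C_const p q ^ k * W * T powr (real k * p / 2)
        \<le> C_const p q ^ k * W * (Ci powr (real k * p / 2) * (K / W))"
      using Tle 3 unfolding Cp by (intro mult_left_mono) auto
    also have "\<dots> = K" unfolding Cp using Ci0 3 by (simp add: powr_minus)
    finally show ?thesis .
  qed
  then show ?thesis unfolding lhs by (simp only: T_def W_def)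
qed

theorem theorem1p9:
  shows
    "(\<forall>n k (f :: (nat \<Rightarrow> real) \<Rightarrow> real) (q :: real). 1 \<le> n \<longrightarrow> k \<le> n \<longrightarrow> 1 \<le> q \<longrightarrow> q < 2 \<longrightarrow>
        (Lp_norm n 2 (nabla_abs n k f))\<^sup>2
          \<ge> W_ge n k f * (1 + q / (2 * real k * (2 - q)) *
                ln_plus (W_ge n k f / (\<Sum>J\<in>level n k. (Lp_norm n q (D_set J f))\<^sup>2))) ^ k
      \<and> (\<forall>p :: real. Linf_norm n f \<le> 1 \<longrightarrow> q \<le> p \<longrightarrow> p < 2 \<longrightarrow>
          Lp_norm n p (nabla_abs n k f) powr p
            \<ge> C_const p q ^ k * W_ge n k f * (1 + q / (2 * real k * (2 - q)) *
                ln_plus (1 / (\<Sum>J\<in>level n k. (Lp_norm n q (D_set J f))\<^sup>2))) powr (real k * p / 2)))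
    \<and> (\<exists>c > 0. \<forall>p q :: real. 1 \<le> q \<longrightarrow> q \<le> p \<longrightarrow> p < 2 \<longrightarrow>
          C_const p q \<ge> c * (2 - p) * (2 - q))"
  using L2_gradient_lower_bound bounded_gradient_lower_bound C_const_lower_bound by blast

end
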